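(* Let $d\ge1$, $1<r,s\le2$, $\alpha,\beta\ge0$, $0<a,b\le r'$, $r\le p\le r'$, $s\le q\le r'$, and suppose that $$\left(\tfrac{a-\alpha}{d}+\tfrac1p-\tfrac1r\right)\left(\tfrac{b-\beta}{d}+\tfrac1q-\tfrac1s\right)>\max\left\{\tfrac1r-\tfrac1{q'}+\tfrac\alpha d,\ \tfrac1r-\tfrac12+\tfrac\alpha d\right\}\cdot\max\left\{\tfrac1s-\tfrac1{p'}+\tfrac\beta d,\ \tfrac1s-\tfrac12+\tfrac\beta d\right\},$$ with all factors non-negative. Let $$\mathfrak{F}^{p,q}_{a,b}[f]=\|\,|x|^af\|_{L^p(\mathbb{R}^d)}+\|\,|\omega|^b\widehat f\|_{L^q(\mathbb{R}^d)},\qquad \Omega=\left\{f\in L^p_a(\mathbb{R}^d)\cap\mathcal{F}L^q_b(\mathbb{R}^d):\ \|f\|_{M^{r,s}_{\alpha,\beta}(\mathbb{R}^d)}=1\right\}.$$ Then every minimizer $f=f_0$ of $\mathfrak{F}^{p,q}_{a,b}$ in $\Omega$ is a solution, for some Lagrange multiplier $\lambda\in\mathbb{R}$, of the equation $$\begin{aligned}&\|\,|x|^af\|^{1-p}_{L^p(\mathbb{R}^d)}\int_{\mathbb{R}^d}|x|^{ap}|f(x)|^{p-2}f(x)\overline{u(x)}\,dx+\|\,|\omega|^b\widehat f\|^{1-q}_{L^q(\mathbb{R}^d)}\int_{\mathbb{R}^d}|\omega|^{bq}|\widehat f(\omega)|^{q-2}\widehat f(\omega)\overline{\widehat u(\omega)}\,d\omega\\&=\lambda\int_{\mathbb{R}^d}\|V_gf(\cdot,\omega)\|^{s-r}_{L^r_\alpha(\mathbb{R}^d)}\left[\int_{\mathbb{R}^d}|V_gf(x,\omega)|^{r-2}V_gf(x,\omega)\overline{V_gu(x,\omega)}(1+|x|)^{\alpha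 r}dx\right](1+|\omega|)^{\beta s}d\omega\end{aligned}$$ for all $u\in L^p_a(\mathbb{R}^d)\cap\mathcal{F}L^q_b(\mathbb{R}^d)$. Moreover, the minimizers satisfy this equation with the smallest possible value of $\lambda$, i.e. the smallest among all $\lambda$ for which the equation (for all $u$) has a solution $f\in\Omega$.
   Context: The Fourier transform is $\widehat f(\omega)=\int_{\mathbb{R}^d}f(x)e^{-2\pi ix\cdot\omega}dx$, and $p'$ denotes the Hölder dual exponent, $\frac1p+\frac1{p'}=1$. $L^p_a(\mathbb{R}^d)$ has norm $\|f\|_{L^p_a}=\left(\int_{\mathbb{R}^d}|f(x)|^p(1+|x|)^{ap}dx\right)^{1/p}$. $\mathcal{F}L^q_b(\mathbb{R}^d)$ is the space of $f\in\mathcal{S}'(\mathbb{R}^d)$ with $\widehat f\in L^q_b(\mathbb{R}^d)$, with norm $\|\widehat f\|_{L^q_b}$. Fix a window $g\in\mathcal{S}(\mathbb{R}^d)\setminus\{0\}$. The short-time Fourier transform is $V_gf(x,\omega)=\int_{\mathbb{R}^d}f(t)\overline{g(t-x)}e^{-2\pi it\cdot\omega}dt$ (extended to $\mathcal{S}'$ by duality). Set $$\|V_gf(\cdot,\omega)\|_{L^r_\alpha(\mathbb{R}^d)}=\left(\int_{\mathbb{R}^d}|V_gf(x,\omega)|^r(1+|x|)^{\alpha r}dx\right)^{1/r},\qquad \|f\|_{M^{r,s}_{\alpha,\beta}}=\left(\int_{\mathbb{R}^d}\|V_gf(\cdot,\omega)\|^s_{L^r_\alpha}(1+|\omega|)^{\beta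 s}d\omega\right)^{1/s}.$$ Expressions of the form $|z|^{p-2}z$ are read as $0$ at $z=0$, and the integrand in $\omega$ on the right-hand side is read as $0$ where $\|V_gf(\cdot,\omega)\|_{L^r_\alpha}=0$. *)

theory Defs
  imports "HOL-Analysis.Analysis"
begin

definition dual_exponent :: "real \<Rightarrow> real"
  where "dual_exponent p = p / (p - 1)"

lemma dual_exponent_conjugate: "p > 1 \<Longrightarrow> 1 / p + 1 / dual_exponent p = 1"
  by (simp add: dual_exponent_def field_simps)


section \<open>Schwartz functions and tempered distributions\<close>

definition partial_deriv :: "'a::euclidean_space \<Rightarrow> ('a \<Rightarrow> complex) \<Rightarrow> 'a \<Rightarrow> complex"
  where "partial_deriv i f = (\<lambda>x. frechet_derivative f (at x) i)"

text \<open>A multi-index is represented by a list of basis vectors.  On functions all of whose iterated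
  partial derivatives are differentiable everywhere (that is, smooth functions) the order of the
  list is irrelevant.\<close>

definition iter_deriv :: "'a::euclidean_space list \<Rightarrow> ('a \<Rightarrow> complex) \<Rightarrow> 'a \<Rightarrow> complex"
  where "iter_deriv is f = foldr partial_deriv is f"

definition schwartz :: "('a::euclidean_space \<Rightarrow> complex) set"
  where "schwartz = {f. \<forall>is. set is \<subseteq> Basis \<longrightarrow>
    (\<forall>x. iter_deriv is f differentiable (at x)) \<and>
    (\<forall>N::nat. bounded (range (\<lambda>x. (1 + norm x) ^ N *\<^sub>R iter_deriv is f x)))}"

definition schwartz_norm :: "nat \<Rightarrow> ('a::euclidean_space \<Rightarrow> complex) \<Rightarrow> real"
  where "schwartz_norm N f =
    (\<Sum>is | set is \<subseteq> Basis \<and> length is \<le> N. SUP x. (1 + norm x) ^ N * norm (iter_deriv is f x))"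

text \<open>A distribution is a complex-valued map on test functions of which only the restriction to
  \<open>schwartz\<close> matters; the pairing is bilinear (no conjugation).  The norms \<open>schwartz_norm N\<close>
  increase with \<open>N\<close> and generate the topology of the Schwartz space, so that continuity of a
  linear functional is boundedness with respect to one of them.\<close>

definition tempered :: "(('a::euclidean_space \<Rightarrow> complex) \<Rightarrow> complex) \<Rightarrow> bool"
  where "tempered T \<longleftrightarrow>
    (\<forall>\<phi>\<in>schwartz. \<forall>\<psi>\<in>schwartz. T (\<lambda>x. \<phi> x + \<psi> x) = T \<phi> + T \<psi>) \<and>
    (\<forall>c. \<forall>\<phi>\<in>schwartz. T (\<lambda>x. c * \<phi> x) = c * T \<phi>) \<and>
    (\<exists>C N. \<forall>\<phi>\<in>schwartz. norm (T \<phi>) \<le> C * schwartz_norm N \<phi>)"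

definition regdist :: "('a::euclidean_space \<Rightarrow> complex) \<Rightarrow> ('a \<Rightarrow> complex) \<Rightarrow> complex"
  where "regdist f \<phi> = (LINT x|lborel. f x * \<phi> x)"

definition represents ::
    "('a::euclidean_space \<Rightarrow> complex) \<Rightarrow> (('a \<Rightarrow> complex) \<Rightarrow> complex) \<Rightarrow> bool"
  where "represents F T \<longleftrightarrow> F \<in> borel_measurable lborel \<and>
    (\<forall>\<phi>\<in>schwartz. integrable lborel (\<lambda>x. F x * \<phi> x) \<and> T \<phi> = regdist F \<phi>)"

text \<open>The function (determined up to a null set) that a distribution is given by, if there is one.\<close>

definition dist_fun :: "(('a::euclidean_space \<Rightarrow> complex) \<Rightarrow> complex) \<Rightarrow> 'a \<Rightarrow> complex"
  where "dist_fun T = (SOME F. represents F T)"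


section \<open>Fourier transform and short-time Fourier transform\<close>

definition fourier :: "('a::euclidean_space \<Rightarrow> complex) \<Rightarrow> 'a \<Rightarrow> complex"
  where "fourier f \<omega> = (LINT x|lborel. f x * cis (- 2 * pi * (x \<bullet> \<omega>)))"

definition fourier_dist ::
    "(('a::euclidean_space \<Rightarrow> complex) \<Rightarrow> complex) \<Rightarrow> ('a \<Rightarrow> complex) \<Rightarrow> complex"
  where "fourier_dist T \<phi> = T (fourier \<phi>)"

text \<open>The Fourier transform of a function, taken in the sense of tempered distributions.\<close>

definition fhat :: "('a::euclidean_space \<Rightarrow> complex) \<Rightarrow> 'a \<Rightarrow> complex"
  where "fhat f = dist_fun (fourier_dist (regdist f))"

definition stft_dist ::
    "('a::euclidean_space \<Rightarrow> complex) \<Rightarrow> (('a \<Rightarrow> complex) \<Rightarrow> complex) \<Rightarrow> 'a \<Rightarrow> 'a \<Rightarrow> complex"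
  where "stft_dist g T x \<omega> = T (\<lambda>t. cnj (g (t - x)) * cis (- 2 * pi * (t \<bullet> \<omega>)))"

abbreviation stft :: "('a::euclidean_space \<Rightarrow> complex) \<Rightarrow> ('a \<Rightarrow> complex) \<Rightarrow> 'a \<Rightarrow> 'a \<Rightarrow> complex"
  where "stft g f \<equiv> stft_dist g (regdist f)"

lemma stft_eq:
  "stft g f x \<omega> = (LINT t|lborel. f t * cnj (g (t - x)) * cis (- 2 * pi * (t \<bullet> \<omega>)))"
  by (simp add: stft_dist_def regdist_def mult.assoc)


section \<open>Weighted Lebesgue, Fourier--Lebesgue and modulation norms\<close>

text \<open>Powers with positive exponent on the extended nonnegative reals.\<close>

definition epowr :: "ennreal \<Rightarrow> real \<Rightarrow> ennreal"
  where "epowr x t = (if x = \<infinity> then \<infinity> else ennreal (enn2real x powr t))"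

definition wnorm :: "real \<Rightarrow> real \<Rightarrow> ('a::euclidean_space \<Rightarrow> complex) \<Rightarrow> ennreal"
  where "wnorm p a f =
    epowr (\<integral>\<^sup>+x. ennreal (norm (f x) powr p * (1 + norm x) powr (a * p)) \<partial>lborel) (1 / p)"

abbreviation Lnorm :: "real \<Rightarrow> ('a::euclidean_space \<Rightarrow> complex) \<Rightarrow> ennreal"
  where "Lnorm p f \<equiv> wnorm p 0 f"

lemma Lnorm_eq: "Lnorm p f = epowr (\<integral>\<^sup>+x. ennreal (norm (f x) powr p) \<partial>lborel) (1 / p)"
proof -
  have "1 + norm x \<noteq> 0" for x :: 'a
    using norm_ge_zero[of x] by linarith
  then show ?thesis by (simp add: wnorm_def)
qed

definition Lw :: "real \<Rightarrow> real \<Rightarrow> ('a::euclidean_space \<Rightarrow> complex) set"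
  where "Lw p a = {f \<in> borel_measurable lborel. wnorm p a f < \<infinity>}"

definition FLw :: "real \<Rightarrow> real \<Rightarrow> (('a::euclidean_space \<Rightarrow> complex) \<Rightarrow> complex) set"
  where "FLw q b = {T. tempered T \<and> (\<exists>F\<in>Lw q b. represents F (fourier_dist T))}"

definition Lw_FLw ::
    "real \<Rightarrow> real \<Rightarrow> real \<Rightarrow> real \<Rightarrow> ('a::euclidean_space \<Rightarrow> complex) set"
  where "Lw_FLw p a q b = {f \<in> Lw p a. regdist f \<in> FLw q b}"

definition mod_norm ::
    "('a::euclidean_space \<Rightarrow> complex) \<Rightarrow> real \<Rightarrow> real \<Rightarrow> real \<Rightarrow> real
      \<Rightarrow> (('a \<Rightarrow> complex) \<Rightarrow> complex) \<Rightarrow> ennreal"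
  where "mod_norm g r s \<alpha> \<beta> T =
    epowr (\<integral>\<^sup>+\<omega>. epowr (wnorm r \<alpha> (\<lambda>x. stft_dist g T x \<omega>)) s
                   * ennreal ((1 + norm \<omega>) powr (\<beta> * s)) \<partial>lborel) (1 / s)"


section \<open>The variational problem\<close>

definition uncertainty_functional ::
    "real \<Rightarrow> real \<Rightarrow> real \<Rightarrow> real \<Rightarrow> ('a::euclidean_space \<Rightarrow> complex) \<Rightarrow> ennreal"
  where "uncertainty_functional p a q b f =
    Lnorm p (\<lambda>x. norm x powr a *\<^sub>R f x) + Lnorm q (\<lambda>\<omega>. norm \<omega> powr b *\<^sub>R fhat f \<omega>)"

definition admissible ::
    "('a::euclidean_space \<Rightarrow> complex) \<Rightarrow> real \<Rightarrow> real \<Rightarrow> real \<Rightarrow> real \<Rightarrow> real \<Rightarrow> real \<Rightarrow> real \<Rightarrow> real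
      \<Rightarrow> ('a \<Rightarrow> complex) set"
  where "admissible g r s \<alpha> \<beta> p a q b =
    {f \<in> Lw_FLw p a q b. mod_norm g r s \<alpha> \<beta> (regdist f) = 1}"

definition minimizer ::
    "('a::euclidean_space \<Rightarrow> complex) \<Rightarrow> real \<Rightarrow> real \<Rightarrow> real \<Rightarrow> real \<Rightarrow> real \<Rightarrow> real \<Rightarrow> real \<Rightarrow> real
      \<Rightarrow> ('a \<Rightarrow> complex) \<Rightarrow> bool"
  where "minimizer g r s \<alpha> \<beta> p a q b f \<longleftrightarrow> f \<in> admissible g r s \<alpha> \<beta> p a q b \<and>
    (\<forall>h\<in>admissible g r s \<alpha> \<beta> p a q b. uncertainty_functional p a q b f \<le> uncertainty_functional p a q b h)"

text \<open>The integrands of the three outer integrals of the Euler--Lagrange equation.  Since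
  \<open>0 powr t = 0\<close> for every \<open>t\<close>, they vanish where \<open>f\<close>, \<open>fhat f\<close>, \<open>stft g f\<close> or
  the inner norm is zero, also for negative exponents.\<close>

definition EL_time ::
    "real \<Rightarrow> real \<Rightarrow> ('a::euclidean_space \<Rightarrow> complex) \<Rightarrow> ('a \<Rightarrow> complex) \<Rightarrow> 'a \<Rightarrow> complex"
  where "EL_time p a f u x =
    of_real (norm x powr (a * p) * norm (f x) powr (p - 2)) * f x * cnj (u x)"

definition EL_freq ::
    "real \<Rightarrow> real \<Rightarrow> ('a::euclidean_space \<Rightarrow> complex) \<Rightarrow> ('a \<Rightarrow> complex) \<Rightarrow> 'a \<Rightarrow> complex"
  where "EL_freq q b f u \<omega> =
    of_real (norm \<omega> powr (b * q) * norm (fhat f \<omega>) powr (q - 2)) * fhat f \<omega> * cnj (fhat u \<omega>)"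

definition EL_inner ::
    "('a::euclidean_space \<Rightarrow> complex) \<Rightarrow> real \<Rightarrow> real \<Rightarrow> ('a \<Rightarrow> complex) \<Rightarrow> ('a \<Rightarrow> complex)
      \<Rightarrow> 'a \<Rightarrow> 'a \<Rightarrow> complex"
  where "EL_inner g r \<alpha> f u \<omega> x =
    of_real (norm (stft g f x \<omega>) powr (r - 2)) * stft g f x \<omega> * cnj (stft g u x \<omega>)
      * of_real ((1 + norm x) powr (\<alpha> * r))"

definition EL_mod ::
    "('a::euclidean_space \<Rightarrow> complex) \<Rightarrow> real \<Rightarrow> real \<Rightarrow> real \<Rightarrow> real
      \<Rightarrow> ('a \<Rightarrow> complex) \<Rightarrow> ('a \<Rightarrow> complex) \<Rightarrow> 'a \<Rightarrow> complex"
  where "EL_mod g r s \<alpha> \<beta> f u \<omega> =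
    of_real (enn2real (wnorm r \<alpha> (\<lambda>x. stft g f x \<omega>)) powr (s - r))
      * (LINT x|lborel. EL_inner g r \<alpha> f u \<omega> x)
      * of_real ((1 + norm \<omega>) powr (\<beta> * s))"

text \<open>Bochner integrals of non-integrable functions are \<open>0\<close>, so the existence of all integrals
  occurring in the equation is stated explicitly.\<close>

definition EL_solution ::
    "('a::euclidean_space \<Rightarrow> complex) \<Rightarrow> real \<Rightarrow> real \<Rightarrow> real \<Rightarrow> real \<Rightarrow> real \<Rightarrow> real \<Rightarrow> real \<Rightarrow> real
      \<Rightarrow> real \<Rightarrow> ('a \<Rightarrow> complex) \<Rightarrow> bool"
  where "EL_solution g r s \<alpha> \<beta> p a q b l f \<longleftrightarrow>
    (\<forall>u\<in>Lw_FLw p a q b.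
      integrable lborel (EL_time p a f u) \<and>
      integrable lborel (EL_freq q b f u) \<and>
      (AE \<omega> in lborel. integrable lborel (EL_inner g r \<alpha> f u \<omega>)) \<and>
      integrable lborel (EL_mod g r s \<alpha> \<beta> f u) \<and>
      of_real (enn2real (Lnorm p (\<lambda>x. norm x powr a *\<^sub>R f x)) powr (1 - p))
          * (LINT x|lborel. EL_time p a f u x)
        + of_real (enn2real (Lnorm q (\<lambda>\<omega>. norm \<omega> powr b *\<^sub>R fhat f \<omega>)) powr (1 - q))
          * (LINT \<omega>|lborel. EL_freq q b f u \<omega>)
      = of_real l * (LINT \<omega>|lborel. EL_mod g r s \<alpha> \<beta> f u \<omega>))"

end

theory Submission
  imports Defs "HOL-Probability.Characteristic_Functions" "HOL-Probability.Sinc_Integral"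
begin

text \<open>
Write \<open>X\<close> for the space \<open>Lw_FLw p a q b\<close>, \<open>F\<close> for the uncertainty functional and \<open>M\<close> for the
modulation norm.  Both \<open>F\<close> and \<open>M\<close> are positively homogeneous, so a minimizer \<open>f\<close> under the constraint
\<open>M(f) = 1\<close> satisfies \<open>l * M(h) \<le> F(h)\<close> with \<open>l = F(f)\<close>, for every \<open>h\<close> in \<open>X\<close> of finite modulation norm
(lemma \<open>minimizer_inequality\<close>).  Hence, for \<open>u\<close> in \<open>X\<close>, the function \<open>F(f + tu) - l * M(f + tu)\<close> of the
real variable \<open>t\<close> is nonnegative and vanishes at \<open>t = 0\<close>; its derivative there is zero.  That derivative is
the real part of the difference of the two sides of the Euler--Lagrange equation (\<open>Re_EL_defect\<close>), and
\<open>\<i>u\<close> in place of \<open>u\<close> gives the imaginary part.  The multiplier is the smallest one because testing the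
equation of any solution \<open>h\<close> with \<open>u = h\<close> identifies its multiplier as \<open>F(h)\<close>
(\<open>EL_solution_multiplier\<close>).

This argument presupposes that every \<open>u\<close> in \<open>X\<close> has a finite modulation norm.  The minimizer itself
provides this (\<open>X_mod_finite\<close>).  Regularise \<open>u\<close> by convolution with a narrow Gaussian followed by
multiplication with a wide one.  On the Fourier side this is a multiplication followed by a convolution, so
both summands of \<open>F\<close> stay bounded along the regularisation.  The regularised functions are Schwartz
functions, which have finite modulation norm, so the inequality above bounds their modulation norms by a
constant.  Their short-time Fourier transforms converge pointwise to that of \<open>u\<close>, and Fatou's lemma bounds
\<open>M(u)\<close> by the same constant.

Differentiability rests on convexity: the difference quotients of a convex function on \<open>[-1, 1]\<close> are bounded
by its increments at \<open>1\<close> and \<open>-1\<close>, so dominated convergence applies with a majorant that comes for free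
(\<open>integral_convex_derivative\<close>).  This is used for the integrals of \<open>|z + tw| powr p\<close>, and once more for
the outer integral of the mixed norm, whose integrand is a power of a norm and thus convex.  As the
exponents exceed \<open>1\<close>, these powers are differentiable also where they vanish.  Finally, both summands of
\<open>F(f)\<close> are positive, because a function whose Fourier transform vanishes has vanishing Gaussian
regularisations (\<open>fhat_zero_imp_pairings_zero\<close>).
\<close>

section \<open>Smooth functions with controlled derivatives\<close>

text \<open>For \<open>P\<close> rapid decay this is the Schwartz space, for \<open>P\<close> polynomial growth the algebra of its
multipliers.\<close>

definition smooth_with ::
    "(('a::euclidean_space \<Rightarrow> complex) \<Rightarrow> bool) \<Rightarrow> ('a \<Rightarrow> complex) set"
  where "smooth_with P = {f. \<forall>is. set is \<subseteq> Basis \<longrightarrow>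
    (\<forall>x. iter_deriv is f differentiable (at x)) \<and> P (iter_deriv is f)}"

definition rapid :: "('a::euclidean_space \<Rightarrow> complex) \<Rightarrow> bool"
  where "rapid f \<longleftrightarrow> (\<forall>N. \<exists>C. \<forall>x. (1 + norm x) ^ N * norm (f x) \<le> C)"

definition moderate :: "('a::euclidean_space \<Rightarrow> complex) \<Rightarrow> bool"
  where "moderate f \<longleftrightarrow> (\<exists>N C. \<forall>x. norm (f x) \<le> C * (1 + norm x) ^ N)"

lemma iter_deriv_Nil [simp]: "iter_deriv [] f = f"
  by (simp add: iter_deriv_def)

lemma iter_deriv_snoc: "iter_deriv (is @ [i]) f = iter_deriv is (partial_deriv i f)"
  by (simp add: iter_deriv_def)

text \<open>The class is the largest set of differentiable functions with property \<open>P\<close> that is closed under partial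
derivatives.  Membership is therefore proved by exhibiting a closed set of functions, without
computing any iterated derivative.\<close>

lemma smooth_with_coinduct:
  assumes "f \<in> A"
    and "\<And>f x. f \<in> A \<Longrightarrow> f differentiable (at x)"
    and "\<And>f. f \<in> A \<Longrightarrow> P f"
    and "\<And>f i. f \<in> A \<Longrightarrow> i \<in> Basis \<Longrightarrow> partial_deriv i f \<in> A"
  shows "f \<in> smooth_with P"
proof -
  have "iter_deriv is f \<in> A" if "set is \<subseteq> Basis" for "is"
    using that assms(1)
  proof (induction "is" arbitrary: f rule: rev_induct)
    case (snoc i "is")
    then show ?case by (simp add: iter_deriv_snoc assms(4))
  qed simp
  then show ?thesis using assms(2,3) by (auto simp: smooth_with_def)
qed

lemma smooth_withD:
  assumes "f \<in> smooth_with P"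
  shows smooth_with_differentiable: "f differentiable (at x)"
    and smooth_with_bound: "P f"
    and smooth_with_partial: "i \<in> Basis \<Longrightarrow> partial_deriv i f \<in> smooth_with P"
proof -
  have *: "set is \<subseteq> Basis \<Longrightarrow> (\<forall>x. iter_deriv is f differentiable (at x)) \<and> P (iter_deriv is f)" for "is"
    using assms by (simp add: smooth_with_def)
  show "f differentiable (at x)" "P f" using *[of "[]"] by auto
  show "partial_deriv i f \<in> smooth_with P" if "i \<in> Basis"
    unfolding smooth_with_def
  proof (intro CollectI allI impI)
    fix "is" :: "'a list" assume "set is \<subseteq> Basis"
    then show "(\<forall>x. iter_deriv is (partial_deriv i f) differentiable (at x)) \<and> P (iter_deriv is (partial_deriv i f))"
      using *[of "is @ [i]"] that by (simp add: iter_deriv_snoc)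
  qed
qed

lemma rapid_iff_bounded: "rapid f \<longleftrightarrow> (\<forall>N. bounded (range (\<lambda>x. (1 + norm x) ^ N *\<^sub>R f x)))"
  by (auto simp: rapid_def bounded_iff)

lemma schwartz_eq: "schwartz = smooth_with rapid"
  by (simp add: schwartz_def smooth_with_def rapid_iff_bounded)

definition slow :: "('a::euclidean_space \<Rightarrow> complex) set"
  where "slow = smooth_with moderate"

lemma partial_deriv_eqI: "(f has_derivative f') (at x) \<Longrightarrow> partial_deriv i f x = f' i"
  unfolding partial_deriv_def using frechet_derivative_at by metis

lemma has_derivative_partial:
  assumes "f differentiable (at x)"
  shows "(f has_derivative (\<lambda>v. \<Sum>i\<in>Basis. (v \<bullet> i) *\<^sub>R partial_deriv i f x)) (at x)"
proof -
  let ?D = "frechet_derivative f (at x)"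
  have D: "(f has_derivative ?D) (at x)"
    using assms frechet_derivative_works by blast
  then have lin: "linear ?D" by (rule has_derivative_linear)
  have "?D v = (\<Sum>i\<in>Basis. (v \<bullet> i) *\<^sub>R ?D i)" for v
  proof -
    have "?D v = ?D (\<Sum>i\<in>Basis. (v \<bullet> i) *\<^sub>R i)" by (simp add: euclidean_representation)
    also have "\<dots> = (\<Sum>i\<in>Basis. (v \<bullet> i) *\<^sub>R ?D i)"
      by (simp add: linear_sum[OF lin] linear_scale[OF lin])
    finally show ?thesis .
  qed
  then have "(\<lambda>v. \<Sum>i\<in>Basis. (v \<bullet> i) *\<^sub>R partial_deriv i f x) = ?D"
    unfolding partial_deriv_def by (intro ext) (rule sym)
  then show ?thesis using D by simp
qed

lemma smooth_with_continuous: "f \<in> smooth_with P \<Longrightarrow> continuous_on UNIV f"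
  by (meson continuous_at_imp_continuous_on differentiable_imp_continuous_within smooth_with_differentiable)

lemma schwartz_continuous: "f \<in> schwartz \<Longrightarrow> continuous_on UNIV f"
  by (simp add: schwartz_eq smooth_with_continuous)

lemma schwartz_measurable [measurable_dest]: "f \<in> schwartz \<Longrightarrow> f \<in> borel_measurable borel"
  by (simp add: schwartz_continuous borel_measurable_continuous_onI)

lemma schwartz_partial: "f \<in> schwartz \<Longrightarrow> i \<in> Basis \<Longrightarrow> partial_deriv i f \<in> schwartz"
  by (simp add: schwartz_eq smooth_with_partial)

lemma schwartz_differentiable: "f \<in> schwartz \<Longrightarrow> f differentiable (at x)"
  by (simp add: schwartz_eq smooth_with_differentiable)

lemma rapid_obtain:
  assumes "rapid f"
  obtains C where "C > 0" "\<And>x. norm (f x) \<le> C / (1 + norm x) ^ N"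
proof -
  obtain C where C: "\<And>x. (1 + norm x) ^ N * norm (f x) \<le> C"
    using assms by (auto simp: rapid_def)
  have "norm (f x) \<le> (\<bar>C\<bar> + 1) / (1 + norm x) ^ N" for x
  proof -
    have "0 < (1 + norm x) ^ N" by (simp add: add_pos_nonneg)
    then show ?thesis using C[of x] by (simp add: pos_le_divide_eq mult.commute)
  qed
  then show ?thesis using that[of "\<bar>C\<bar> + 1"] by simp
qed

lemma rapidI:
  assumes "\<And>N. \<exists>C. \<forall>x. norm (f x) \<le> C / (1 + norm x) ^ N"
  shows "rapid f"
  unfolding rapid_def
proof
  fix N
  obtain C where C: "\<And>x. norm (f x) \<le> C / (1 + norm x) ^ N"
    using assms by blast
  have "(1 + norm x) ^ N * norm (f x) \<le> C" for x
  proof -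
    have "0 < (1 + norm x) ^ N" by (simp add: add_pos_nonneg)
    then show ?thesis using C[of x] by (simp add: pos_le_divide_eq mult.commute)
  qed
  then show "\<exists>C. \<forall>x. (1 + norm x) ^ N * norm (f x) \<le> C" by blast
qed

lemma schwartz_bound:
  assumes "f \<in> schwartz"
  obtains C where "C > 0" "\<And>x. norm (f x) \<le> C / (1 + norm x) ^ N"
  using assms rapid_obtain smooth_with_bound unfolding schwartz_eq by metis

lemma one_plus_norm_pos [simp]: "0 < 1 + norm x" "0 \<le> 1 + norm x" "1 + norm x \<noteq> 0"
  using norm_ge_zero[of x] by linarith+

lemma weight_submult: "1 + norm (y::'a::real_normed_vector) \<le> (1 + norm x) * (1 + norm (x - y))"
proof -
  have "norm y \<le> norm x + norm (x - y)" using norm_triangle_sub[of y x] by (simp add: norm_minus_commute)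
  also have "1 + \<dots> \<le> (1 + norm x) * (1 + norm (x - y))" by (simp add: algebra_simps)
  finally show ?thesis by simp
qed

lemma inverse_weight_submult:
  "1 / (1 + norm (x - y :: 'a::real_normed_vector)) ^ N \<le> (1 + norm x) ^ N / (1 + norm y) ^ N"
proof -
  have "(1 + norm y) ^ N \<le> (1 + norm x) ^ N * (1 + norm (x - y)) ^ N"
    unfolding power_mult_distrib[symmetric] by (rule power_mono[OF weight_submult]) simp
  then show ?thesis by (simp add: divide_simps mult.commute)
qed

lemma partial_deriv_add:
  assumes "\<And>x. f differentiable (at x)" "\<And>x. g differentiable (at x)"
  shows "partial_deriv i (\<lambda>x. f x + g x) = (\<lambda>x. partial_deriv i f x + partial_deriv i g x)"
proof
  fix x
  have "((\<lambda>x. f x + g x) has_derivative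
      (\<lambda>h. frechet_derivative f (at x) h + frechet_derivative g (at x) h)) (at x)"
    using assms[of x] unfolding frechet_derivative_works by (rule has_derivative_add)
  from partial_deriv_eqI[OF this, of i]
  show "partial_deriv i (\<lambda>x. f x + g x) x = partial_deriv i f x + partial_deriv i g x"
    by (simp add: partial_deriv_def)
qed

lemma partial_deriv_mult:
  assumes "\<And>x. f differentiable (at x)" "\<And>x. g differentiable (at x)"
  shows "partial_deriv i (\<lambda>x. f x * g x) = (\<lambda>x. partial_deriv i f x * g x + f x * partial_deriv i g x)"
proof
  fix x
  have "((\<lambda>x. f x * g x) has_derivative
      (\<lambda>h. f x * frechet_derivative g (at x) h + frechet_derivative f (at x) h * g x)) (at x)"
    using assms[of x] unfolding frechet_derivative_works by (rule has_derivative_mult)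
  from partial_deriv_eqI[OF this, of i]
  show "partial_deriv i (\<lambda>x. f x * g x) x = partial_deriv i f x * g x + f x * partial_deriv i g x"
    by (simp add: partial_deriv_def)
qed

lemma partial_deriv_cmult:
  assumes "\<And>x. f differentiable (at x)"
  shows "partial_deriv i (\<lambda>x. c * f x) = (\<lambda>x. c * partial_deriv i f x)"
proof
  fix x
  have "((\<lambda>x. c * f x) has_derivative (\<lambda>h. c * frechet_derivative f (at x) h)) (at x)"
    using assms[of x] unfolding frechet_derivative_works by (rule has_derivative_mult_right)
  from partial_deriv_eqI[OF this, of i]
  show "partial_deriv i (\<lambda>x. c * f x) x = c * partial_deriv i f x"
    by (simp add: partial_deriv_def)
qed

lemma translate_has_derivative:
  assumes "f differentiable (at (t - x))"
  shows "((\<lambda>t. f (t - x)) has_derivative frechet_derivative f (at (t - x))) (at t)"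
proof -
  have "((\<lambda>t. t - x) has_derivative (\<lambda>h. h)) (at t)"
    by (auto intro!: derivative_eq_intros)
  from has_derivative_compose[OF this, of f] assms show ?thesis
    unfolding frechet_derivative_works by blast
qed

lemma partial_deriv_translate:
  assumes "\<And>x. f differentiable (at x)"
  shows "partial_deriv i (\<lambda>t. f (t - x)) = (\<lambda>t. partial_deriv i f (t - x))"
  using partial_deriv_eqI[OF translate_has_derivative[OF assms]] by (auto simp: partial_deriv_def)

lemma reflect_has_derivative:
  assumes "f differentiable (at (x - t))"
  shows "((\<lambda>t. f (x - t)) has_derivative (\<lambda>h. frechet_derivative f (at (x - t)) (- h))) (at t)"
proof -
  have "((\<lambda>t. x - t) has_derivative (\<lambda>h. - h)) (at t)"
    by (auto intro!: derivative_eq_intros)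
  from has_derivative_compose[OF this, of f] assms show ?thesis
    unfolding frechet_derivative_works by blast
qed

lemma partial_deriv_reflect:
  assumes "\<And>x. f differentiable (at x)"
  shows "partial_deriv i (\<lambda>t. f (x - t)) = (\<lambda>t. - partial_deriv i f (x - t))"
proof
  fix t
  have "linear (frechet_derivative f (at (x - t)))"
    using assms frechet_derivative_works has_derivative_linear by blast
  then show "partial_deriv i (\<lambda>t. f (x - t)) t = - partial_deriv i f (x - t)"
    using partial_deriv_eqI[OF reflect_has_derivative[OF assms], of i x t]
    by (simp add: partial_deriv_def linear_neg)
qed

lemma cnj_has_derivative:
  assumes "f differentiable (at t)"
  shows "((\<lambda>t. cnj (f t)) has_derivative (\<lambda>h. cnj (frechet_derivative f (at t) h))) (at t)"
  using assms unfolding frechet_derivative_works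
  by (rule bounded_linear.has_derivative[OF bounded_linear_cnj])

lemma partial_deriv_cnj:
  assumes "\<And>x. f differentiable (at x)"
  shows "partial_deriv i (\<lambda>t. cnj (f t)) = (\<lambda>t. cnj (partial_deriv i f t))"
  using partial_deriv_eqI[OF cnj_has_derivative[OF assms]] by (auto simp: partial_deriv_def)

lemma smooth_with_add:
  assumes P: "\<And>f g. P f \<Longrightarrow> P g \<Longrightarrow> P (\<lambda>x. f x + g x)"
    and "f \<in> smooth_with P" "g \<in> smooth_with P"
  shows "(\<lambda>x. f x + g x) \<in> smooth_with P"
proof (rule smooth_with_coinduct[where A="{\<lambda>x. f x + g x |f g. f \<in> smooth_with P \<and> g \<in> smooth_with P}"])
  show "(\<lambda>x. f x + g x) \<in> {\<lambda>x. f x + g x |f g. f \<in> smooth_with P \<and> g \<in> smooth_with P}"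
    using assms by auto
next
  fix h :: "'a \<Rightarrow> complex" and x i :: 'a
  assume "h \<in> {\<lambda>x. f x + g x |f g. f \<in> smooth_with P \<and> g \<in> smooth_with P}"
  then obtain f g where h: "h = (\<lambda>x. f x + g x)" "f \<in> smooth_with P" "g \<in> smooth_with P" by auto
  show "h differentiable (at x)" unfolding h(1)
    by (intro differentiable_add smooth_with_differentiable[OF h(2)] smooth_with_differentiable[OF h(3)])
  show "P h" unfolding h(1) by (rule P[OF smooth_with_bound[OF h(2)] smooth_with_bound[OF h(3)]])
  assume i: "i \<in> Basis"
  have "partial_deriv i h = (\<lambda>x. partial_deriv i f x + partial_deriv i g x)"
    unfolding h(1) by (intro partial_deriv_add smooth_with_differentiable[OF h(2)] smooth_with_differentiable[OF h(3)])
  then show "partial_deriv i h \<in> {\<lambda>x. f x + g x |f g. f \<in> smooth_with P \<and> g \<in> smooth_with P}"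
    using smooth_with_partial[OF h(2) i] smooth_with_partial[OF h(3) i] by auto
qed

lemma smooth_with_cmult:
  assumes P: "\<And>f. P f \<Longrightarrow> P (\<lambda>x. c * f x)" and "f \<in> smooth_with P"
  shows "(\<lambda>x. c * f x) \<in> smooth_with P"
proof (rule smooth_with_coinduct[where A="{\<lambda>x. c * f x |f. f \<in> smooth_with P}"])
  fix h :: "'a \<Rightarrow> complex" and x i :: 'a
  assume "h \<in> {\<lambda>x. c * f x |f. f \<in> smooth_with P}"
  then obtain f where h: "h = (\<lambda>x. c * f x)" "f \<in> smooth_with P" by auto
  show "h differentiable (at x)" unfolding h(1)
    by (intro differentiable_mult differentiable_const smooth_with_differentiable[OF h(2)])
  show "P h" unfolding h(1) by (rule P[OF smooth_with_bound[OF h(2)]])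
  assume i: "i \<in> Basis"
  have "partial_deriv i h = (\<lambda>x. c * partial_deriv i f x)"
    unfolding h(1) by (intro partial_deriv_cmult smooth_with_differentiable[OF h(2)])
  then show "partial_deriv i h \<in> {\<lambda>x. c * f x |f. f \<in> smooth_with P}"
    using smooth_with_partial[OF h(2) i] by auto
qed (use assms in auto)

text \<open>By the Leibniz rule sums of products are closed under differentiation, which single products are not.\<close>

inductive_set sums_of_products for A B :: "('a::euclidean_space \<Rightarrow> complex) set" where
  mult: "f \<in> A \<Longrightarrow> g \<in> B \<Longrightarrow> (\<lambda>x. f x * g x) \<in> sums_of_products A B"
| add: "f \<in> sums_of_products A B \<Longrightarrow> g \<in> sums_of_products A B
    \<Longrightarrow> (\<lambda>x. f x + g x) \<in> sums_of_products A B"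

lemma smooth_with_mult:
  assumes mult: "\<And>f g. P f \<Longrightarrow> Q g \<Longrightarrow> R (\<lambda>x. f x * g x)"
    and add: "\<And>f g. R f \<Longrightarrow> R g \<Longrightarrow> R (\<lambda>x. f x + g x)"
    and "f \<in> smooth_with P" "g \<in> smooth_with Q"
  shows "(\<lambda>x. f x * g x) \<in> smooth_with R"
proof -
  let ?S = "sums_of_products (smooth_with P) (smooth_with Q)"
  have *: "(\<forall>x. h differentiable (at x)) \<and> R h \<and> (\<forall>i\<in>Basis. partial_deriv i h \<in> ?S)" if "h \<in> ?S" for h
    using that
  proof induction
    case (mult f g)
    have d: "\<And>x. f differentiable (at x)" "\<And>x. g differentiable (at x)"
      using mult smooth_with_differentiable by blast+
    show ?case unfolding partial_deriv_mult[OF d]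
      using mult assms(1)[OF smooth_with_bound[OF mult(1)] smooth_with_bound[OF mult(2)]]
      by (auto intro!: sums_of_products.intros smooth_with_partial derivative_intros d)
  next
    case (add f g)
    then show ?case
      using assms(2)[of f g] by (auto simp: partial_deriv_add intro: sums_of_products.add)
  qed
  show ?thesis
  proof (rule smooth_with_coinduct[where A="?S"])
    show "(\<lambda>x. f x * g x) \<in> ?S" using assms(3,4) by (rule sums_of_products.mult)
  qed (use * in auto)
qed

lemma rapid_add: "rapid f \<Longrightarrow> rapid g \<Longrightarrow> rapid (\<lambda>x. f x + g x)"
proof (rule rapidI)
  fix N assume *: "rapid f" "rapid g"
  obtain C where C: "\<And>x. norm (f x) \<le> C / (1 + norm x) ^ N" using rapid_obtain[OF *(1)] by metis
  obtain D where D: "\<And>x. norm (g x) \<le> D / (1 + norm x) ^ N" using rapid_obtain[OF *(2)] by metis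
  have "norm (f x + g x) \<le> (C + D) / (1 + norm x) ^ N" for x
    using norm_triangle_le[OF add_mono[OF C[of x] D[of x]]] by (simp add: add_divide_distrib)
  then show "\<exists>C. \<forall>x. norm (f x + g x) \<le> C / (1 + norm x) ^ N" by blast
qed

lemma moderate_obtain:
  assumes "moderate f"
  obtains C N where "C > 0" "\<And>x. norm (f x) \<le> C * (1 + norm x) ^ N"
proof -
  obtain C N where C: "\<And>x. norm (f x) \<le> C * (1 + norm x) ^ N"
    using assms by (auto simp: moderate_def)
  have "norm (f x) \<le> (\<bar>C\<bar> + 1) * (1 + norm x) ^ N" for x
    by (rule order_trans[OF C]) (intro mult_right_mono, auto)
  then show ?thesis using that[of "\<bar>C\<bar> + 1" N] by simp
qed

lemma rapid_mult_moderate: "rapid f \<Longrightarrow> moderate g \<Longrightarrow> rapid (\<lambda>x. f x * g x)"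
proof (rule rapidI)
  fix N assume *: "rapid f" "moderate g"
  obtain D M where D: "D > 0" "\<And>x. norm (g x) \<le> D * (1 + norm x) ^ M" using moderate_obtain[OF *(2)] by metis
  obtain C where C: "C > 0" "\<And>x. norm (f x) \<le> C / (1 + norm x) ^ (N + M)" using rapid_obtain[OF *(1)] by metis
  have "norm (f x * g x) \<le> (C * D) / (1 + norm x) ^ N" for x
    using mult_mono[OF C(2)[of x] D(2)[of x]] C(1) by (simp add: norm_mult power_add)
  then show "\<exists>C. \<forall>x. norm (f x * g x) \<le> C / (1 + norm x) ^ N" by blast
qed

lemma moderate_const: "moderate (\<lambda>_. c)"
  unfolding moderate_def by (rule exI[of _ 0]) auto

lemma rapid_imp_moderate: "rapid f \<Longrightarrow> moderate f"
  unfolding moderate_def by (rule rapid_obtain[of f 0], assumption) (rule exI[of _ 0], auto)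

lemma rapid_translate: "rapid f \<Longrightarrow> rapid (\<lambda>t. f (t - x))"
proof (rule rapidI)
  fix N assume "rapid f"
  then obtain C where C: "C > 0" "\<And>x. norm (f x) \<le> C / (1 + norm x) ^ N" using rapid_obtain by metis
  have "norm (f (t - x)) \<le> C * (1 + norm x) ^ N / (1 + norm t) ^ N" for t
  proof -
    have "norm (f (t - x)) \<le> C * (1 / (1 + norm (x - t)) ^ N)" using C(2)[of "t - x"] by (simp add: norm_minus_commute)
    also have "\<dots> \<le> C * ((1 + norm x) ^ N / (1 + norm t) ^ N)"
      using C(1) by (intro mult_left_mono inverse_weight_submult) auto
    finally show ?thesis by simp
  qed
  then show "\<exists>C. \<forall>t. norm (f (t - x)) \<le> C / (1 + norm t) ^ N" by blast
qed

lemma rapid_reflect: "rapid f \<Longrightarrow> rapid (\<lambda>t. f (x - t))"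
proof -
  assume f: "rapid f"
  have "rapid (\<lambda>t. f (- t))"
    unfolding rapid_def
  proof
    fix N
    obtain C where C: "\<And>x. (1 + norm x) ^ N * norm (f x) \<le> C" using f by (auto simp: rapid_def)
    then show "\<exists>C. \<forall>x. (1 + norm x) ^ N * norm (f (- x)) \<le> C"
      by (intro exI[of _ C] allI) (metis norm_minus_cancel)
  qed
  from rapid_translate[OF this, of x] show ?thesis by simp
qed

lemma schwartz_add: "f \<in> schwartz \<Longrightarrow> g \<in> schwartz \<Longrightarrow> (\<lambda>x. f x + g x) \<in> schwartz"
  unfolding schwartz_eq by (rule smooth_with_add[of rapid, OF rapid_add])

lemma schwartz_cmult: "f \<in> schwartz \<Longrightarrow> (\<lambda>x. c * f x) \<in> schwartz"
  unfolding schwartz_eq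
  by (rule smooth_with_cmult[of rapid]) (use rapid_mult_moderate[OF _ moderate_const] in \<open>auto simp: mult.commute\<close>)

lemma schwartz_mult_slow: "f \<in> schwartz \<Longrightarrow> m \<in> slow \<Longrightarrow> (\<lambda>x. f x * m x) \<in> schwartz"
  unfolding slow_def schwartz_eq
  by (rule smooth_with_mult[where R=rapid, OF rapid_mult_moderate rapid_add])

lemma schwartz_imp_slow: "f \<in> schwartz \<Longrightarrow> f \<in> slow"
  unfolding slow_def schwartz_eq smooth_with_def by (auto intro: rapid_imp_moderate)

lemma schwartz_mult: "f \<in> schwartz \<Longrightarrow> g \<in> schwartz \<Longrightarrow> (\<lambda>x. f x * g x) \<in> schwartz"
  by (intro schwartz_mult_slow schwartz_imp_slow)

lemma schwartz_translate: 
  assumes "f \<in> schwartz" shows "(\<lambda>t. f (t - x)) \<in> schwartz"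
  unfolding schwartz_eq
proof (rule smooth_with_coinduct[where A="{\<lambda>t. f (t - x) |f. f \<in> schwartz}"])
  fix h :: "'a \<Rightarrow> complex" and t i :: 'a
  assume "h \<in> {\<lambda>t. f (t - x) |f. f \<in> schwartz}"
  then obtain f where h: "h = (\<lambda>t. f (t - x))" "f \<in> schwartz" by auto
  have d: "f differentiable (at t)" for t by (rule schwartz_differentiable[OF h(2)])
  show "h differentiable (at t)" unfolding h(1) using translate_has_derivative[OF d] differentiableI by blast
  show "rapid h" using h rapid_translate unfolding schwartz_eq by (auto dest: smooth_with_bound)
  show "i \<in> Basis \<Longrightarrow> partial_deriv i h \<in> {\<lambda>t. f (t - x) |f. f \<in> schwartz}"
    unfolding h(1) partial_deriv_translate[OF d] using schwartz_partial[OF h(2)] by auto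
qed (use assms in auto)

lemma schwartz_reflect: 
  assumes "f \<in> schwartz" shows "(\<lambda>t. f (x - t)) \<in> schwartz"
  unfolding schwartz_eq
proof (rule smooth_with_coinduct[where A="{\<lambda>t. f (x - t) |f. f \<in> schwartz}"])
  fix h :: "'a \<Rightarrow> complex" and t i :: 'a
  assume "h \<in> {\<lambda>t. f (x - t) |f. f \<in> schwartz}"
  then obtain f where h: "h = (\<lambda>t. f (x - t))" "f \<in> schwartz" by auto
  have d: "f differentiable (at t)" for t by (rule schwartz_differentiable[OF h(2)])
  show "h differentiable (at t)" unfolding h(1) using reflect_has_derivative[OF d] differentiableI by blast
  show "rapid h" using h rapid_reflect unfolding schwartz_eq by (auto dest: smooth_with_bound)
  show "partial_deriv i h \<in> {\<lambda>t. f (x - t) |f. f \<in> schwartz}" if "i \<in> Basis"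
  proof -
    have "partial_deriv i h = (\<lambda>t. (\<lambda>y. (-1) * partial_deriv i f y) (x - t))"
      unfolding h(1) partial_deriv_reflect[OF d] by simp
    then show ?thesis using schwartz_cmult[OF schwartz_partial[OF h(2) that], of "-1"]
      by (intro CollectI exI[of _ "\<lambda>y. (-1) * partial_deriv i f y"]) simp
  qed
qed (use assms in auto)

lemma schwartz_cnj: 
  assumes "f \<in> schwartz" shows "(\<lambda>t. cnj (f t)) \<in> schwartz"
  unfolding schwartz_eq
proof (rule smooth_with_coinduct[where A="{\<lambda>t. cnj (f t) |f. f \<in> schwartz}"])
  fix h :: "'a \<Rightarrow> complex" and t i :: 'a
  assume "h \<in> {\<lambda>t. cnj (f t) |f. f \<in> schwartz}"
  then obtain f where h: "h = (\<lambda>t. cnj (f t))" "f \<in> schwartz" by auto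
  have d: "f differentiable (at t)" for t by (rule schwartz_differentiable[OF h(2)])
  show "h differentiable (at t)" unfolding h(1) using cnj_has_derivative[OF d] differentiableI by blast
  show "rapid h" using h unfolding schwartz_eq by (auto dest!: smooth_with_bound simp: rapid_def)
  show "i \<in> Basis \<Longrightarrow> partial_deriv i h \<in> {\<lambda>t. cnj (f t) |f. f \<in> schwartz}"
    unfolding h(1) partial_deriv_cnj[OF d] using schwartz_partial[OF h(2)] by auto
qed (use assms in auto)

abbreviation wave :: "'a::euclidean_space \<Rightarrow> 'a \<Rightarrow> complex"
  where "wave \<omega> \<equiv> (\<lambda>x. cis (- 2 * pi * (x \<bullet> \<omega>)))"

lemma wave_has_derivative:
  fixes x \<omega> :: "'a::euclidean_space"
  shows
  "(wave \<omega> has_derivative (\<lambda>h. - 2 * pi * \<i> * (h \<bullet> \<omega>) * wave \<omega> x)) (at x)"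
proof -
  have "((\<lambda>x. cis (- 2 * pi * (x \<bullet> \<omega>))) has_derivative
      (\<lambda>h. (- 2 * pi * (h \<bullet> \<omega>)) *\<^sub>R (\<i> * cis (- 2 * pi * (x \<bullet> \<omega>))))) (at x)"
    by (auto intro!: derivative_eq_intros)
  then show ?thesis by (simp add: scaleR_conv_of_real mult_ac)
qed

lemma partial_deriv_wave: "partial_deriv i (wave \<omega>) = (\<lambda>x. - 2 * pi * \<i> * (i \<bullet> \<omega>) * wave \<omega> x)"
  using partial_deriv_eqI[OF wave_has_derivative] by blast

lemma slow_wave: "wave \<omega> \<in> slow"
  unfolding slow_def
proof (rule smooth_with_coinduct[where A="{\<lambda>x. c * wave \<omega> x |c. True}"])
  show "wave \<omega> \<in> {\<lambda>x. c * wave \<omega> x |c. True}" by (intro CollectI exI[of _ 1]) auto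
next
  fix h :: "'a \<Rightarrow> complex" and x i :: 'a
  assume "h \<in> {\<lambda>x. c * wave \<omega> x |c. True}"
  then obtain c where h: "h = (\<lambda>x. c * wave \<omega> x)" by auto
  have d: "wave \<omega> differentiable (at x)" for x using wave_has_derivative differentiableI by blast
  show "h differentiable (at x)" unfolding h by (intro differentiable_mult differentiable_const d)
  show "moderate h" unfolding h moderate_def
    by (rule exI[of _ 0]) (auto simp: norm_mult)
  show "partial_deriv i h \<in> {\<lambda>x. c * wave \<omega> x |c. True}"
    unfolding h partial_deriv_cmult[OF d] partial_deriv_wave mult.assoc[symmetric] by blast
qed

lemma schwartz_wave: "f \<in> schwartz \<Longrightarrow> (\<lambda>x. f x * wave \<omega> x) \<in> schwartz"
  by (intro schwartz_mult_slow slow_wave)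

section \<open>Integrals of Schwartz functions\<close>

lemma
  fixes f :: "'a::euclidean_space \<Rightarrow> real \<Rightarrow> 'b::{real_normed_field,banach,second_countable_topology}"
  assumes f: "\<And>b. b \<in> Basis \<Longrightarrow> integrable lborel (f b)"
  shows integrable_prod_Basis: "integrable lborel (\<lambda>x::'a. \<Prod>b\<in>Basis. f b (x \<bullet> b))"
    and integral_prod_Basis: "(LINT x::'a|lborel. (\<Prod>b\<in>Basis. f b (x \<bullet> b))) = (\<Prod>b\<in>Basis. (LINT t|lborel. f b t))"
proof -
  interpret product_sigma_finite "\<lambda>b::'a. lborel :: real measure" by standard
  have m: "(\<lambda>g. \<Sum>b\<in>Basis. g b *\<^sub>R b) \<in> (\<Pi>\<^sub>M b\<in>Basis. lborel :: real measure) \<rightarrow>\<^sub>M (borel :: 'a measure)"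
    by simp
  have fm: "f b \<in> borel_measurable borel" if "b \<in> Basis" for b
    using borel_measurable_integrable[OF f[OF that]] by simp
  have mm: "(\<lambda>x::'a. \<Prod>b\<in>Basis. f b (x \<bullet> b)) \<in> borel_measurable borel"
    by (intro borel_measurable_prod measurable_compose[OF _ fm]) auto
  have e: "(\<Prod>b\<in>Basis. f b ((\<Sum>c\<in>Basis. g c *\<^sub>R c) \<bullet> b)) = (\<Prod>b\<in>Basis. f b (g b))" for g
    by (intro prod.cong) auto
  show "integrable lborel (\<lambda>x::'a. \<Prod>b\<in>Basis. f b (x \<bullet> b))"
    unfolding lborel_eq[where 'a='a] using product_integrable_prod[OF finite_Basis f]
    by (subst integrable_distr_eq[OF m mm]) (simp add: e)
  show "(LINT x::'a|lborel. (\<Prod>b\<in>Basis. f b (x \<bullet> b))) = (\<Prod>b\<in>Basis. (LINT t|lborel. f b t))"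
    unfolding lborel_eq[where 'a='a] using product_integral_prod[OF finite_Basis f]
    by (subst integral_distr[OF m mm]) (simp add: e)
qed

lemma norm_integral_le:
  fixes f :: "'b \<Rightarrow> complex"
  assumes "integrable M g" "\<And>x. norm (f x) \<le> g x"
  shows "norm (LINT x|M. f x) \<le> (LINT x|M. g x)"
proof (cases "integrable M f")
  case True
  have "norm (LINT x|M. f x) \<le> (LINT x|M. norm (f x))" by (rule integral_norm_bound)
  also have "\<dots> \<le> (LINT x|M. g x)" by (intro integral_mono integrable_norm True assms)
  finally show ?thesis .
next
  case False
  have "0 \<le> g x" for x using assms(2)[of x] norm_ge_zero[of "f x"] by linarith
  then show ?thesis using False by (simp add: not_integrable_integral_eq)
qed

lemma integrable_inverse_square: "integrable lborel (\<lambda>t::real. 1 / (1 + t\<^sup>2))"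
  using integrable_inverse_1_plus_square by (simp add: set_integrable_def inverse_eq_divide)

text \<open>The function \<open>(1 + norm x)\<^sup>2\<close> dominates \<open>1 + (x \<bullet> b)\<^sup>2\<close> for each coordinate, and the product of
the reciprocals of the latter is integrable by Fubini.\<close>

lemma integrable_weight:
  "integrable lborel (\<lambda>x::'a::euclidean_space. 1 / (1 + norm x) ^ (2 * DIM('a)))"
proof (rule Bochner_Integration.integrable_bound[OF integrable_prod_Basis[where f="\<lambda>_ t. 1 / (1 + t\<^sup>2)"]])
  show "integrable lborel (\<lambda>t::real. 1 / (1 + t\<^sup>2))" by (rule integrable_inverse_square)
  show "(\<lambda>x::'a. 1 / (1 + norm x) ^ (2 * DIM('a))) \<in> borel_measurable lborel" by simp
  show "AE x::'a in lborel. norm (1 / (1 + norm x) ^ (2 * DIM('a)))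
      \<le> norm (\<Prod>b\<in>Basis. 1 / (1 + (x \<bullet> b)\<^sup>2))"
  proof (rule AE_I2)
    fix x :: 'a
    have "(\<Prod>b\<in>(Basis::'a set). 1 + (x \<bullet> b)\<^sup>2) \<le> (\<Prod>b\<in>(Basis::'a set). (1 + norm x)\<^sup>2)"
    proof (rule prod_mono, intro conjI)
      fix b :: 'a assume "b \<in> Basis"
      then have "\<bar>x \<bullet> b\<bar> \<le> norm x" by (rule Basis_le_norm)
      then have "(x \<bullet> b)\<^sup>2 \<le> (norm x)\<^sup>2" by (rule abs_le_square_iff[THEN iffD1, of "x \<bullet> b" "norm x", simplified])
      then show "0 \<le> 1 + (x \<bullet> b)\<^sup>2" "1 + (x \<bullet> b)\<^sup>2 \<le> (1 + norm x)\<^sup>2"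
        using add_increasing2[of "2 * norm x" "(x \<bullet> b)\<^sup>2" "(norm x)\<^sup>2"] by (auto simp: power2_sum)
    qed
    then have *: "(\<Prod>b\<in>(Basis::'a set). 1 + (x \<bullet> b)\<^sup>2) \<le> (1 + norm x) ^ (2 * DIM('a))"
      by (simp add: power_mult)
    have "(\<Prod>b\<in>(Basis::'a set). 1 + (x \<bullet> b)\<^sup>2) > 0" by (intro prod_pos) (simp add: add_pos_nonneg)
    then show "norm (1 / (1 + norm x) ^ (2 * DIM('a))) \<le> norm (\<Prod>b\<in>Basis. 1 / (1 + (x \<bullet> b)\<^sup>2))"
      using * by (simp add: prod_dividef frac_le)
  qed
qed

lemma integrable_weight_ge:
  assumes "2 * DIM('a::euclidean_space) \<le> N"
  shows "integrable lborel (\<lambda>x::'a. C / (1 + norm x) ^ N)"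
proof -
  have "integrable lborel (\<lambda>x::'a. 1 / (1 + norm x) ^ N)"
    by (rule Bochner_Integration.integrable_bound[OF integrable_weight])
      (auto simp: assms intro!: frac_le power_increasing AE_I2)
  from integrable_mult_right[OF this, of C] show ?thesis by simp
qed

lemma schwartz_integrable:
  fixes f :: "'a::euclidean_space \<Rightarrow> complex"
  assumes "f \<in> schwartz"
  shows "integrable lborel f"
proof -
  obtain C where "C > 0" "\<And>x. norm (f x) \<le> C / (1 + norm x) ^ (2 * DIM('a))"
    using schwartz_bound[OF assms] by metis
  then show ?thesis
    by (intro Bochner_Integration.integrable_bound[OF integrable_weight_ge[OF order.refl, of C]])
      (use schwartz_measurable[OF assms] in \<open>auto intro!: AE_I2\<close>)
qed

lemma norm_sum_Basis_le:
  fixes v :: "'a::euclidean_space"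
  shows
  "norm (\<Sum>i\<in>Basis. (v \<bullet> i) *\<^sub>R (c i :: complex)) \<le> norm v * (\<Sum>i\<in>Basis. norm (c i))"
proof -
  have "norm (\<Sum>i\<in>Basis. (v \<bullet> i) *\<^sub>R c i) \<le> (\<Sum>i\<in>Basis. norm v * norm (c i))"
    by (rule sum_norm_le) (simp add: Basis_le_norm mult_right_mono)
  then show ?thesis by (simp add: sum_distrib_left)
qed

lemma weight_near:
  fixes x y :: "'a::real_normed_vector"
  assumes "norm (y - x) \<le> 1"
  shows "1 / (1 + norm y) ^ N \<le> 2 ^ N / (1 + norm x) ^ N"
proof -
  have "norm x \<le> norm y + 1"
    using add_left_mono[OF assms, of "norm y"] norm_triangle_sub[of x y] by (simp add: norm_minus_commute)
  then have "1 + norm x \<le> 2 * (1 + norm y)"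
    using norm_ge_zero[of y] by argo
  then have "(1 + norm x) ^ N \<le> 2 ^ N * (1 + norm y) ^ N"
    unfolding power_mult_distrib[symmetric] by (rule power_mono) simp
  then show ?thesis by (simp add: divide_simps mult.commute)
qed

text \<open>On a unit ball the weight changes by a bounded factor only, so the mean value inequality inherits
the decay of the partial derivatives.\<close>

lemma schwartz_lipschitz:
  fixes f :: "'a::euclidean_space \<Rightarrow> complex"
  assumes f: "f \<in> schwartz"
  obtains B where "B \<ge> 0"
    "\<And>x y. norm (y - x) \<le> 1 \<Longrightarrow> norm (f y - f x) \<le> B / (1 + norm x) ^ N * norm (y - x)"
proof -
  have "\<forall>i. \<exists>C. i \<in> Basis \<longrightarrow> C > 0 \<and> (\<forall>x. norm (partial_deriv i f x) \<le> C / (1 + norm x) ^ N)"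
    using schwartz_bound[OF schwartz_partial[OF f], of _ N] by metis
  then obtain C where C: "\<And>i. i \<in> Basis \<Longrightarrow> C i > 0"
    "\<And>i x. i \<in> Basis \<Longrightarrow> norm (partial_deriv i f x) \<le> C i / (1 + norm x) ^ N" by metis
  define B where "B = 2 ^ N * (\<Sum>i\<in>Basis. C i)"
  have B0: "B \<ge> 0" unfolding B_def using C(1) by (intro mult_nonneg_nonneg sum_nonneg) (auto simp: less_imp_le)
  have "norm (f y - f x) \<le> B / (1 + norm x) ^ N * norm (y - x)" if "norm (y - x) \<le> 1" for x y
  proof (rule differentiable_bound[of "cball x 1"])
    show "(f has_derivative (\<lambda>v. \<Sum>i\<in>Basis. (v \<bullet> i) *\<^sub>R partial_deriv i f z)) (at z within cball x 1)" for z
      using has_derivative_partial[OF schwartz_differentiable[OF f]] has_derivative_at_withinI by blast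
    show "onorm (\<lambda>v. \<Sum>i\<in>Basis. (v \<bullet> i) *\<^sub>R partial_deriv i f z) \<le> B / (1 + norm x) ^ N"
      if z: "z \<in> cball x 1" for z
    proof (rule onorm_le)
      fix v :: 'a
      have "(\<Sum>i\<in>Basis. norm (partial_deriv i f z)) \<le> (\<Sum>i\<in>Basis. C i * (2 ^ N / (1 + norm x) ^ N))"
      proof (rule sum_mono)
        fix i :: 'a assume i: "i \<in> Basis"
        have "norm (partial_deriv i f z) \<le> C i * (1 / (1 + norm z) ^ N)" using C(2)[OF i] by simp
        also have "\<dots> \<le> C i * (2 ^ N / (1 + norm x) ^ N)"
          using C(1)[OF i] z by (intro mult_left_mono weight_near) (auto simp: dist_norm norm_minus_commute)
        finally show "norm (partial_deriv i f z) \<le> C i * (2 ^ N / (1 + norm x) ^ N)" .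
      qed
      also have "\<dots> = B / (1 + norm x) ^ N"
        unfolding B_def sum_distrib_right[symmetric] by simp
      finally have "norm v * (\<Sum>i\<in>Basis. norm (partial_deriv i f z)) \<le> norm v * (B / (1 + norm x) ^ N)"
        by (rule mult_left_mono) simp
      then show "norm (\<Sum>i\<in>Basis. (v \<bullet> i) *\<^sub>R partial_deriv i f z) \<le> B / (1 + norm x) ^ N * norm v"
        using norm_sum_Basis_le[of v "\<lambda>i. partial_deriv i f z"] by (simp add: mult.commute)
    qed
  qed (use that in \<open>auto simp: dist_norm norm_minus_commute\<close>)
  then show ?thesis using that B0 by blast
qed

text \<open>The quadratic remainder decays rapidly in the base point.  It can thus be integrated against functions of
polynomial growth, which yields the derivatives of convolutions, and against \<open>1\<close>, which yields that
derivatives have integral zero.\<close>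

lemma schwartz_taylor:
  fixes f :: "'a::euclidean_space \<Rightarrow> complex"
  assumes f: "f \<in> schwartz"
  obtains B where "B \<ge> 0"
    "\<And>x y. norm (y - x) \<le> 1 \<Longrightarrow>
      norm (f y - f x - (\<Sum>i\<in>Basis. ((y - x) \<bullet> i) *\<^sub>R partial_deriv i f x))
        \<le> B / (1 + norm x) ^ N * (norm (y - x))\<^sup>2"
proof -
  have "\<forall>i. \<exists>C. i \<in> Basis \<longrightarrow> C \<ge> 0 \<and> (\<forall>x y. norm (y - x) \<le> 1 \<longrightarrow>
      norm (partial_deriv i f y - partial_deriv i f x) \<le> C / (1 + norm x) ^ N * norm (y - x))"
    using schwartz_lipschitz[OF schwartz_partial[OF f], of _ N] by metis
  then obtain C where C: "\<And>i. i \<in> Basis \<Longrightarrow> C i \<ge> 0"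
    "\<And>i x y. i \<in> Basis \<Longrightarrow> norm (y - x) \<le> 1 \<Longrightarrow>
      norm (partial_deriv i f y - partial_deriv i f x) \<le> C i / (1 + norm x) ^ N * norm (y - x)" by metis
  define B where "B = (\<Sum>i\<in>Basis. C i)"
  have B0: "B \<ge> 0" unfolding B_def using C(1) by (intro sum_nonneg) auto
  have "norm (f y - f x - (\<Sum>i\<in>Basis. ((y - x) \<bullet> i) *\<^sub>R partial_deriv i f x))
        \<le> B / (1 + norm x) ^ N * (norm (y - x))\<^sup>2" if xy: "norm (y - x) \<le> 1" for x y
  proof -
    let ?D = "\<lambda>z v. \<Sum>i\<in>Basis. (v \<bullet> i) *\<^sub>R partial_deriv i f z"
    have "norm (f y - f x - ?D x (y - x)) \<le> norm (y - x) * (B / (1 + norm x) ^ N * norm (y - x))"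
    proof (rule differentiable_bound_linearization[where S="cball x (norm (y - x))"])
      show "(f has_derivative ?D z) (at z within cball x (norm (y - x)))" for z
        using has_derivative_partial[OF schwartz_differentiable[OF f]] has_derivative_at_withinI by blast
      show "x + t *\<^sub>R (y - x) \<in> cball x (norm (y - x))" if "t \<in> {0..1}" for t
        using that by (auto simp: dist_norm mult_left_le_one_le)
      show "onorm (?D z - ?D x) \<le> B / (1 + norm x) ^ N * norm (y - x)" if z: "z \<in> cball x (norm (y - x))" for z
      proof (rule onorm_le)
        fix v :: 'a
        have zx: "norm (z - x) \<le> norm (y - x)" using z by (simp add: dist_norm norm_minus_commute)
        have "(\<Sum>i\<in>Basis. norm (partial_deriv i f z - partial_deriv i f x))
            \<le> (\<Sum>i\<in>Basis. C i * (norm (y - x) / (1 + norm x) ^ N))"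
        proof (rule sum_mono)
          fix i :: 'a assume i: "i \<in> Basis"
          have "norm (partial_deriv i f z - partial_deriv i f x) \<le> C i / (1 + norm x) ^ N * norm (z - x)"
            using C(2)[OF i] zx xy by fastforce
          also have "\<dots> \<le> C i / (1 + norm x) ^ N * norm (y - x)"
            using C(1)[OF i] zx by (intro mult_left_mono) auto
          finally show "norm (partial_deriv i f z - partial_deriv i f x) \<le> C i * (norm (y - x) / (1 + norm x) ^ N)"
            by simp
        qed
        also have "\<dots> = B / (1 + norm x) ^ N * norm (y - x)"
          unfolding B_def sum_distrib_right[symmetric] by simp
        finally have "norm v * (\<Sum>i\<in>Basis. norm (partial_deriv i f z - partial_deriv i f x))
            \<le> norm v * (B / (1 + norm x) ^ N * norm (y - x))"
          by (rule mult_left_mono) simp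
        then show "norm ((?D z - ?D x) v) \<le> B / (1 + norm x) ^ N * norm (y - x) * norm v"
          using norm_sum_Basis_le[of v "\<lambda>i. partial_deriv i f z - partial_deriv i f x"]
          by (simp add: mult.commute scaleR_diff_right sum_subtractf)
      qed
    qed simp
    then show ?thesis by (simp add: power2_eq_square mult_ac)
  qed
  then show ?thesis using that B0 by blast
qed

section \<open>Convolution with functions of polynomial growth\<close>

text \<open>Functions that pair absolutely convergently with all Schwartz functions because they are integrable
against some polynomial weight.\<close>

definition tame :: "('a::euclidean_space \<Rightarrow> complex) \<Rightarrow> bool"
  where "tame u \<longleftrightarrow> u \<in> borel_measurable lborel \<and>
    (\<exists>N. integrable lborel (\<lambda>y. norm (u y) / (1 + norm y) ^ N))"

definition conv :: "('a::euclidean_space \<Rightarrow> complex) \<Rightarrow> ('a \<Rightarrow> complex) \<Rightarrow> 'a \<Rightarrow> complex"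
  where "conv \<eta> u x = (LINT y|lborel. \<eta> (x - y) * u y)"

lemma tame_measurable: "tame u \<Longrightarrow> u \<in> borel_measurable borel"
  by (simp add: tame_def)

lemma tame_rapid_integrable:
  assumes u: "tame u" and [measurable]: "f \<in> borel_measurable borel" and f: "rapid f"
  shows "integrable lborel (\<lambda>y. u y * f y)"
proof -
  have [measurable]: "u \<in> borel_measurable borel" by (rule tame_measurable[OF u])
  obtain N where N: "integrable lborel (\<lambda>y. norm (u y) / (1 + norm y) ^ N)"
    using u by (auto simp: tame_def)
  obtain C where C: "C > 0" "\<And>x. norm (f x) \<le> C / (1 + norm x) ^ N" by (rule rapid_obtain[OF f, where N=N]) blast
  show ?thesis
  proof (rule Bochner_Integration.integrable_bound[OF integrable_mult_right[OF N, of C]])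
    show "AE x in lborel. norm (u x * f x) \<le> norm (C * (norm (u x) / (1 + norm x) ^ N))"
    proof (rule AE_I2)
      fix x
      show "norm (u x * f x) \<le> norm (C * (norm (u x) / (1 + norm x) ^ N))"
        using mult_left_mono[OF C(2)[of x] norm_ge_zero[of "u x"]] C(1)
        by (simp add: norm_mult abs_mult mult_ac)
    qed
  qed measurable
qed

lemma schwartz_rapid: "f \<in> schwartz \<Longrightarrow> rapid f"
  unfolding schwartz_eq by (rule smooth_with_bound)

lemma tame_integrable: "tame u \<Longrightarrow> f \<in> schwartz \<Longrightarrow> integrable lborel (\<lambda>y. u y * f y)"
  by (intro tame_rapid_integrable schwartz_rapid schwartz_measurable)

lemma conv_integrable:
  assumes u: "tame u" and f: "\<eta> \<in> schwartz"
  shows "integrable lborel (\<lambda>y. \<eta> (x - y) * u y)"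
  using tame_integrable[OF u schwartz_reflect[OF f, of x]] by (simp add: mult.commute)

lemma conv_dominated:
  fixes k u :: "'a::euclidean_space \<Rightarrow> complex"
  assumes C: "\<And>z. norm (k z) \<le> C / (1 + norm z) ^ N" and C0: "0 \<le> C"
    and N: "integrable lborel (\<lambda>y. norm (u y) / (1 + norm y) ^ N)"
  shows "norm (LINT y|lborel. k (x - y) * u y)
    \<le> C * (LINT y|lborel. norm (u y) / (1 + norm y) ^ N) * (1 + norm x) ^ N"
proof -
  have "norm (LINT y|lborel. k (x - y) * u y)
      \<le> (LINT y|lborel. C * (1 + norm x) ^ N * (norm (u y) / (1 + norm y) ^ N))"
  proof (rule norm_integral_le)
    show "integrable lborel (\<lambda>y. C * (1 + norm x) ^ N * (norm (u y) / (1 + norm y) ^ N))"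
      by (intro integrable_mult_right N)
    fix y
    have "norm (k (x - y)) \<le> C * (1 / (1 + norm (x - y)) ^ N)" using C by simp
    also have "\<dots> \<le> C * ((1 + norm x) ^ N / (1 + norm y) ^ N)"
      by (intro mult_left_mono inverse_weight_submult C0)
    finally show "norm (k (x - y) * u y) \<le> C * (1 + norm x) ^ N * (norm (u y) / (1 + norm y) ^ N)"
      using mult_right_mono[of "norm (k (x - y))" _ "norm (u y)"] by (fastforce simp: norm_mult)
  qed
  also have "\<dots> = C * (1 + norm x) ^ N * (LINT y|lborel. norm (u y) / (1 + norm y) ^ N)"
    by (rule integral_mult_right_zero)
  finally show ?thesis by (simp only: mult_ac)
qed

lemma conv_moderate:
  assumes u: "tame u" and f: "\<eta> \<in> schwartz"
  shows "moderate (conv \<eta> u)"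
proof -
  obtain N where N: "integrable lborel (\<lambda>y. norm (u y) / (1 + norm y) ^ N)"
    using u by (auto simp: tame_def)
  obtain C where C: "C > 0" "\<And>x. norm (\<eta> x) \<le> C / (1 + norm x) ^ N" using schwartz_bound[OF f] by metis
  show ?thesis unfolding moderate_def conv_def
    using conv_dominated[OF C(2) less_imp_le[OF C(1)] N] by blast
qed

text \<open>Integrating the Taylor estimate of \<open>\<eta>\<close> at \<open>x - y\<close> against \<open>u y\<close> gives an error that is quadratic in the
increment.\<close>

lemma conv_has_derivative:
  fixes \<eta> :: "'a::euclidean_space \<Rightarrow> complex"
  assumes u: "tame u" and f: "\<eta> \<in> schwartz"
  shows "(conv \<eta> u has_derivative (\<lambda>v. \<Sum>i\<in>Basis. (v \<bullet> i) *\<^sub>R conv (partial_deriv i \<eta>) u x)) (at x)"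
proof -
  obtain N where N: "integrable lborel (\<lambda>y. norm (u y) / (1 + norm y) ^ N)"
    using u by (auto simp: tame_def)
  obtain B where B: "B \<ge> 0" "\<And>x y. norm (y - x) \<le> 1 \<Longrightarrow>
      norm (\<eta> y - \<eta> x - (\<Sum>i\<in>Basis. ((y - x) \<bullet> i) *\<^sub>R partial_deriv i \<eta> x))
        \<le> B / (1 + norm x) ^ N * (norm (y - x))\<^sup>2"
    using schwartz_taylor[OF f] by metis
  define K where "K = B * (LINT y|lborel. norm (u y) / (1 + norm y) ^ N) * (1 + norm x) ^ N"
  let ?D = "\<lambda>v. \<Sum>i\<in>Basis. (v \<bullet> i) *\<^sub>R conv (partial_deriv i \<eta>) u x"
  show ?thesis
  proof (rule has_derivativeI_sandwich[where e=1 and H="\<lambda>y. K * norm (y - x)"])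
    show "bounded_linear ?D"
      by (intro bounded_linear_sum bounded_linear_compose[OF bounded_linear_scaleR_left bounded_linear_inner_left])
    show "((\<lambda>y. K * norm (y - x)) \<longlongrightarrow> 0) (at x)"
      by (auto intro!: tendsto_eq_intros)
    fix y assume y: "y \<noteq> x" "dist y x < 1"
    define v where "v = y - x"
    have v: "norm v \<le> 1" "v \<noteq> 0" "y = x + v" using y by (auto simp: v_def dist_norm)
    let ?R = "\<lambda>z. \<eta> (z + v) - \<eta> z - (\<Sum>i\<in>Basis. (v \<bullet> i) *\<^sub>R partial_deriv i \<eta> z)"
    have R: "norm (?R z) \<le> B * (norm v)\<^sup>2 / (1 + norm z) ^ N" for z
      using B(2)[of "z + v" z] v by (simp add: mult_ac)
    have I: "integrable lborel (\<lambda>w. partial_deriv i \<eta> (x - w) * u w)" if "i \<in> Basis" for i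
      by (rule conv_integrable[OF u schwartz_partial[OF f that]])
    have "(LINT w|lborel. ?R (x - w) * u w)
        = (LINT w|lborel. \<eta> (y - w) * u w - \<eta> (x - w) * u w
            - (\<Sum>i\<in>Basis. (v \<bullet> i) *\<^sub>R (partial_deriv i \<eta> (x - w) * u w)))"
      unfolding v(3) by (simp add: algebra_simps sum_distrib_left sum_distrib_right)
    also have "\<dots> = conv \<eta> u y - conv \<eta> u x - ?D v"
      unfolding conv_def
      using conv_integrable[OF u f] I
      by (simp add: Bochner_Integration.integral_sum)
    finally have "norm (conv \<eta> u y - conv \<eta> u x - ?D (y - x)) = norm (LINT w|lborel. ?R (x - w) * u w)"
      by (simp add: v_def)
    also have "\<dots> \<le> B * (norm v)\<^sup>2 * (LINT y|lborel. norm (u y) / (1 + norm y) ^ N) * (1 + norm x) ^ N"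
      by (rule conv_dominated[OF R _ N]) (simp add: B)
    also have "\<dots> = K * (norm v)\<^sup>2" by (simp add: K_def)
    finally have "norm (conv \<eta> u y - conv \<eta> u x - ?D (y - x)) \<le> K * norm (y - x) * norm (y - x)"
      by (simp add: v_def power2_eq_square mult_ac)
    then show "norm (conv \<eta> u y - conv \<eta> u x - ?D (y - x)) / norm (y - x) \<le> K * norm (y - x)"
      using y(1) by (simp add: pos_divide_le_eq)
  qed simp
qed

lemma partial_deriv_conv:
  assumes u: "tame u" and f: "\<eta> \<in> schwartz" and i: "i \<in> Basis"
  shows "partial_deriv i (conv \<eta> u) = conv (partial_deriv i \<eta>) u"
proof
  fix x
  show "partial_deriv i (conv \<eta> u) x = conv (partial_deriv i \<eta>) u x"
    using partial_deriv_eqI[OF conv_has_derivative[OF u f], of i x] i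
    by (simp add: inner_Basis if_distrib[of "\<lambda>c. c *\<^sub>R _"] sum.delta cong: if_cong)
qed

lemma slow_conv:
  fixes \<eta> :: "'a::euclidean_space \<Rightarrow> complex"
  assumes u: "tame u" and f: "\<eta> \<in> schwartz"
  shows "conv \<eta> u \<in> slow"
  unfolding slow_def
proof (rule smooth_with_coinduct[where A="{conv \<eta> u |\<eta>. \<eta> \<in> schwartz}"])
  fix h :: "'a \<Rightarrow> complex" and x i :: 'a
  assume "h \<in> {conv \<eta> u |\<eta>. \<eta> \<in> schwartz}"
  then obtain \<eta> where h: "h = conv \<eta> u" "\<eta> \<in> schwartz" by auto
  show "h differentiable (at x)" unfolding h(1) using conv_has_derivative[OF u h(2)] differentiableI by blast
  show "moderate h" unfolding h(1) by (rule conv_moderate[OF u h(2)])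
  show "i \<in> Basis \<Longrightarrow> partial_deriv i h \<in> {conv \<eta> u |\<eta>. \<eta> \<in> schwartz}"
    unfolding h(1) using partial_deriv_conv[OF u h(2)] schwartz_partial[OF h(2)] by auto
qed (use f in auto)

lemma schwartz_imp_tame: "f \<in> schwartz \<Longrightarrow> tame f"
  unfolding tame_def using schwartz_measurable[of f] integrable_norm[OF schwartz_integrable[of f]]
  by (intro conjI exI[of _ 0]) auto

section \<open>Decay of Fourier transforms\<close>

lemma lborel_integral_translate:
  fixes f :: "'a::euclidean_space \<Rightarrow> complex"
  shows "(LINT x|lborel. f (x + v)) = (LINT x|lborel. f x)"
proof (cases "f \<in> borel_measurable borel")
  case True
  have "(LINT x|lborel. f x) = (LINT x|distr lborel borel ((+) v). f x)"
    by (simp add: lborel_distr_plus)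
  also have "\<dots> = (LINT x|lborel. f (x + v))"
    using True by (subst integral_distr) (auto simp: add.commute)
  finally show ?thesis ..
next
  case False
  have "\<not> integrable lborel f" using False by (auto dest: borel_measurable_integrable)
  moreover have "\<not> integrable lborel (\<lambda>x. f (x + v))"
  proof
    assume "integrable lborel (\<lambda>x. f (x + v))"
    then have "(\<lambda>x. f (x + v)) \<in> borel_measurable borel" by (auto dest: borel_measurable_integrable)
    then have "(\<lambda>x. f ((x - v) + v)) \<in> borel_measurable borel"
      by (rule measurable_compose[rotated]) simp
    with False show False by simp
  qed
  ultimately show ?thesis by (simp add: not_integrable_integral_eq)
qed

text \<open>The integral of \<open>f (x + t i) - f x\<close> vanishes by translation invariance; by the Taylor estimate it differs
from \<open>t\<close> times the integral in question by \<open>O(t\<^sup>2)\<close>.\<close>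

lemma integral_partial_deriv:
  fixes f :: "'a::euclidean_space \<Rightarrow> complex"
  assumes f: "f \<in> schwartz" and i: "i \<in> Basis"
  shows "(LINT x|lborel. partial_deriv i f x) = 0"
proof -
  let ?N = "2 * DIM('a)"
  obtain B where B: "B \<ge> 0" "\<And>x y. norm (y - x) \<le> 1 \<Longrightarrow>
      norm (f y - f x - (\<Sum>i\<in>Basis. ((y - x) \<bullet> i) *\<^sub>R partial_deriv i f x))
        \<le> B / (1 + norm x) ^ ?N * (norm (y - x))\<^sup>2"
    using schwartz_taylor[OF f] by metis
  define K where "K = (LINT x::'a|lborel. B / (1 + norm x) ^ ?N)"
  let ?I = "LINT x|lborel. partial_deriv i f x"
  have f': "integrable lborel (partial_deriv i f)" by (intro schwartz_integrable schwartz_partial f i)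
  have *: "norm ?I \<le> K * t" if t: "0 < t" "t \<le> 1" for t :: real
  proof -
    have e: "(\<Sum>j\<in>Basis. ((t *\<^sub>R i) \<bullet> j) *\<^sub>R partial_deriv j f x) = t *\<^sub>R partial_deriv i f x" for x
      using i by (simp add: inner_Basis if_distrib[of "\<lambda>c. c *\<^sub>R _"] if_distrib[of "\<lambda>c. _ * c"] sum.delta cong: if_cong)
    have ft: "integrable lborel (\<lambda>x. f (x + t *\<^sub>R i))"
      using schwartz_integrable[OF schwartz_translate[OF f, of "- (t *\<^sub>R i)"]] by simp
    have "(LINT x|lborel. f (x + t *\<^sub>R i) - f x - t *\<^sub>R partial_deriv i f x) = - (t *\<^sub>R ?I)"
      using ft schwartz_integrable[OF f] f' lborel_integral_translate[of f "t *\<^sub>R i"] by simp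
    then have "norm (t *\<^sub>R ?I) = norm (LINT x|lborel. f (x + t *\<^sub>R i) - f x - t *\<^sub>R partial_deriv i f x)"
      by simp
    also have "\<dots> \<le> (LINT x::'a|lborel. t\<^sup>2 * (B / (1 + norm x) ^ ?N))"
    proof (rule norm_integral_le)
      show "integrable lborel (\<lambda>x::'a. t\<^sup>2 * (B / (1 + norm x) ^ ?N))"
        by (intro integrable_mult_right integrable_weight_ge) simp
      show "norm (f (x + t *\<^sub>R i) - f x - t *\<^sub>R partial_deriv i f x) \<le> t\<^sup>2 * (B / (1 + norm x) ^ ?N)" for x
        using B(2)[of "x + t *\<^sub>R i" x] t i e[of x] by (simp add: mult_ac)
    qed
    also have "\<dots> = t * (K * t)"
      unfolding K_def by (subst integral_mult_right_zero) (simp only: power2_eq_square mult_ac)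
    finally show ?thesis using t by simp
  qed
  have "norm ?I \<le> 0"
  proof (rule tendsto_lowerbound)
    show "((\<lambda>t. K * t) \<longlongrightarrow> 0) (at_right 0)" by (auto intro!: tendsto_eq_intros)
    show "\<forall>\<^sub>F t in at_right 0. norm ?I \<le> K * t"
      using * by (auto simp: eventually_at_right[of 0 1] intro!: exI[of _ 1])
  qed simp
  then show ?thesis by simp
qed

lemma fourier_partial_deriv:
  assumes f: "f \<in> schwartz" and i: "i \<in> Basis"
  shows "fourier (partial_deriv i f) \<omega> = 2 * pi * \<i> * (i \<bullet> \<omega>) * fourier f \<omega>"
proof -
  have d: "wave \<omega> differentiable (at x)" for x using wave_has_derivative differentiableI by blast
  have e: "partial_deriv i (\<lambda>x. f x * wave \<omega> x) x
      = partial_deriv i f x * wave \<omega> x - 2 * pi * \<i> * (i \<bullet> \<omega>) * (f x * wave \<omega> x)" for x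
    unfolding partial_deriv_mult[OF schwartz_differentiable[OF f] d] partial_deriv_wave by simp
  have "0 = (LINT x|lborel. partial_deriv i (\<lambda>x. f x * wave \<omega> x) x)"
    using integral_partial_deriv[OF schwartz_wave[OF f] i] by simp
  also have "\<dots> = fourier (partial_deriv i f) \<omega> - 2 * pi * \<i> * (i \<bullet> \<omega>) * fourier f \<omega>"
    unfolding e fourier_def
    using schwartz_integrable[OF schwartz_wave[OF f]] schwartz_integrable[OF schwartz_wave[OF schwartz_partial[OF f i]]]
    by (subst Bochner_Integration.integral_diff) (auto intro!: integrable_mult_right)
  finally show ?thesis by simp
qed

lemma one_plus_norm_le_Basis: "1 + norm (\<omega>::'a::euclidean_space) \<le> 1 + (\<Sum>i\<in>Basis. \<bar>i \<bullet> \<omega>\<bar>)"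
  using norm_le_l1[of \<omega>] by (simp add: inner_commute)

text \<open>Each further power of \<open>\<omega>\<close> is paid for by one partial derivative.  The parameter \<open>x\<close>, controlled by the
weight \<open>W\<close>, lets the same induction cover a single Schwartz function and the products with a sliding
window, for which the decay in \<open>x\<close> and \<open>\<omega>\<close> must be joint.\<close>

lemma fourier_family_decay:
  fixes P :: "('b \<Rightarrow> 'a::euclidean_space \<Rightarrow> complex) set"
  assumes S: "\<And>h x. h \<in> P \<Longrightarrow> h x \<in> schwartz"
    and D: "\<And>h i. h \<in> P \<Longrightarrow> i \<in> Basis \<Longrightarrow> (\<lambda>x. partial_deriv i (h x)) \<in> P"
    and W: "\<And>h. h \<in> P \<Longrightarrow> \<exists>C\<ge>0. \<forall>x t. norm (h x t) \<le> C * W x / (1 + norm t) ^ (2 * DIM('a))"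
    and W0: "\<And>x. 0 \<le> W x"
    and "h \<in> P"
  shows "\<exists>C\<ge>0. \<forall>x \<omega>. norm (fourier (h x) \<omega>) \<le> C * W x / (1 + norm \<omega>) ^ M"
  using \<open>h \<in> P\<close>
proof (induction M arbitrary: h)
  case 0
  obtain C where C: "C \<ge> 0" "\<And>x t. norm (h x t) \<le> C * W x / (1 + norm t) ^ (2 * DIM('a))" using W[OF 0] by blast
  define K where "K = (LINT t::'a|lborel. 1 / (1 + norm t) ^ (2 * DIM('a)))"
  have "norm (fourier (h x) \<omega>) \<le> (C * K) * W x" for x \<omega>
  proof -
    have "norm (fourier (h x) \<omega>) \<le> (LINT t::'a|lborel. C * W x * (1 / (1 + norm t) ^ (2 * DIM('a))))"
      unfolding fourier_def
    proof (rule norm_integral_le)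
      show "integrable lborel (\<lambda>t::'a. C * W x * (1 / (1 + norm t) ^ (2 * DIM('a))))"
        by (intro integrable_mult_right integrable_weight)
    qed (use C(2)[of x] in \<open>simp add: norm_mult\<close>)
    also have "\<dots> = C * K * W x"
      unfolding K_def by (subst integral_mult_right_zero) (simp only: mult_ac)
    finally show ?thesis .
  qed
  moreover have "C * K \<ge> 0" unfolding K_def using C by (intro mult_nonneg_nonneg Bochner_Integration.integral_nonneg) auto
  ultimately show ?case by auto
next
  case (Suc M)
  obtain C where C: "C \<ge> 0" "\<And>x \<omega>. norm (fourier (h x) \<omega>) \<le> C * W x / (1 + norm \<omega>) ^ M"
    using Suc.IH[OF Suc.prems] by blast
  have "\<forall>i. \<exists>c. i \<in> Basis \<longrightarrow> c \<ge> 0 \<and> (\<forall>x \<omega>. norm (fourier (partial_deriv i (h x)) \<omega>) \<le> c * W x / (1 + norm \<omega>) ^ M)"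
    using Suc.IH[OF D[OF Suc.prems]] by metis
  then obtain c where c: "\<And>i. i \<in> Basis \<Longrightarrow> c i \<ge> 0"
    "\<And>i x \<omega>. i \<in> Basis \<Longrightarrow> norm (fourier (partial_deriv i (h x)) \<omega>) \<le> c i * W x / (1 + norm \<omega>) ^ M"
    by metis
  define K where "K = C + (\<Sum>i\<in>Basis. c i)"
  have "norm (fourier (h x) \<omega>) \<le> K * W x / (1 + norm \<omega>) ^ Suc M" for x \<omega>
  proof -
    let ?F = "norm (fourier (h x) \<omega>)"
    have ci: "\<bar>i \<bullet> \<omega>\<bar> * ?F \<le> c i * (W x / (1 + norm \<omega>) ^ M)" if i: "i \<in> Basis" for i
    proof -
      have "\<bar>i \<bullet> \<omega>\<bar> * ?F \<le> 2 * pi * (\<bar>i \<bullet> \<omega>\<bar> * ?F)"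
        using mult_right_mono[of 1 "2 * pi" "\<bar>i \<bullet> \<omega>\<bar> * ?F"] pi_ge_two by simp
      also have "\<dots> = norm (fourier (partial_deriv i (h x)) \<omega>)"
        unfolding fourier_partial_deriv[OF S[OF Suc.prems] i] by (simp add: norm_mult)
      also have "\<dots> \<le> c i * (W x / (1 + norm \<omega>) ^ M)" using c(2)[OF i, of x \<omega>] by simp
      finally show ?thesis .
    qed
    have "(1 + norm \<omega>) * ?F \<le> (1 + (\<Sum>i\<in>Basis. \<bar>i \<bullet> \<omega>\<bar>)) * ?F"
      by (rule mult_right_mono[OF one_plus_norm_le_Basis]) simp
    also have "\<dots> = ?F + (\<Sum>i\<in>Basis. \<bar>i \<bullet> \<omega>\<bar> * ?F)" by (simp add: distrib_right sum_distrib_right)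
    also have "\<dots> \<le> C * (W x / (1 + norm \<omega>) ^ M) + (\<Sum>i\<in>Basis. c i * (W x / (1 + norm \<omega>) ^ M))"
      using C(2)[of x \<omega>] by (intro add_mono sum_mono ci) auto
    also have "\<dots> = K * W x / (1 + norm \<omega>) ^ M" 
      unfolding sum_distrib_right[symmetric] by (simp add: K_def distrib_right add_divide_distrib)
    finally have "?F \<le> K * W x / (1 + norm \<omega>) ^ M / (1 + norm \<omega>)"
      by (subst pos_le_divide_eq) (simp_all only: one_plus_norm_pos mult.commute)
    then show ?thesis by (simp add: mult.commute divide_divide_eq_left)
  qed
  moreover have "K \<ge> 0" unfolding K_def using C(1) c(1) by (intro add_nonneg_nonneg sum_nonneg) auto
  ultimately show ?case by blast
qed

lemma fourier_schwartz_bound: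
  fixes f :: "'a::euclidean_space \<Rightarrow> complex"
  assumes "f \<in> schwartz"
  obtains C where "C \<ge> 0" "\<And>\<omega>. norm (fourier f \<omega>) \<le> C / (1 + norm \<omega>) ^ M"
proof -
  have "\<exists>C\<ge>0. \<forall>x \<omega>. norm (fourier ((\<lambda>_::unit. f) x) \<omega>) \<le> C * 1 / (1 + norm \<omega>) ^ M"
  proof (rule fourier_family_decay[where P="{\<lambda>_. f |f. f \<in> schwartz}" and W="\<lambda>_. 1"])
    fix h :: "unit \<Rightarrow> 'a \<Rightarrow> complex" assume "h \<in> {\<lambda>_. f |f. f \<in> schwartz}"
    then obtain f where h: "h = (\<lambda>_. f)" "f \<in> schwartz" by blast
    show "\<And>x. h x \<in> schwartz" "\<And>i. i \<in> Basis \<Longrightarrow> (\<lambda>x. partial_deriv i (h x)) \<in> {\<lambda>_. f |f. f \<in> schwartz}"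
      using h schwartz_partial by auto
    obtain C where "C > 0" "\<And>x. norm (f x) \<le> C / (1 + norm x) ^ (2 * DIM('a))"
      using schwartz_bound[OF h(2)] by metis
    then show "\<exists>C\<ge>0. \<forall>x t. norm (h x t) \<le> C * 1 / (1 + norm t) ^ (2 * DIM('a))"
      unfolding h(1) by (intro exI[of _ C]) auto
  qed (use assms in auto)
  then show ?thesis using that by auto
qed

section \<open>Gaussians\<close>

definition gauss :: "real \<Rightarrow> 'a::euclidean_space \<Rightarrow> complex"
  where "gauss c x = of_real (exp (- (pi * c * (x \<bullet> x))))"

text \<open>The factor makes the integral equal to \<open>1\<close> and the Fourier transform equal to \<open>gauss (1 / c)\<close>; the kernel
concentrates at the origin as \<open>c\<close> grows.\<close>

definition heat :: "real \<Rightarrow> 'a::euclidean_space \<Rightarrow> complex"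
  where "heat c x = of_real (c powr (DIM('a) / 2)) * gauss c x"

lemma gauss_has_derivative:
  "(gauss c has_derivative (\<lambda>h. of_real (- (2 * pi * c * (x \<bullet> h))) * gauss c x)) (at x)"
proof -
  have "((\<lambda>x. exp (- (pi * c * (x \<bullet> x)))) has_derivative
      (\<lambda>h. - (2 * pi * c * (x \<bullet> h)) * exp (- (pi * c * (x \<bullet> x))))) (at x)"
    by (auto intro!: derivative_eq_intros simp: inner_commute algebra_simps)
  from bounded_linear.has_derivative[OF bounded_linear_of_real this]
  show ?thesis unfolding gauss_def[abs_def] by simp
qed

text \<open>The polynomial multiples of the Gaussian, a set of rapidly decreasing functions that is closed under
partial derivatives.\<close>

inductive_set polynomial_gauss :: "real \<Rightarrow> ('a::euclidean_space \<Rightarrow> complex) set" for c where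
  base: "gauss c \<in> polynomial_gauss c"
| coord: "f \<in> polynomial_gauss c \<Longrightarrow> i \<in> Basis \<Longrightarrow> (\<lambda>x. of_real (x \<bullet> i) * f x) \<in> polynomial_gauss c"
| scale: "f \<in> polynomial_gauss c \<Longrightarrow> (\<lambda>x. k * f x) \<in> polynomial_gauss c"
| add: "f \<in> polynomial_gauss c \<Longrightarrow> g \<in> polynomial_gauss c \<Longrightarrow> (\<lambda>x. f x + g x) \<in> polynomial_gauss c"

lemma power_le_fact_exp:
  assumes "0 \<le> (y::real)" shows "y ^ N \<le> fact N * exp y"
proof -
  have "y ^ N / fact N = (\<Sum>n\<in>{N}. y ^ n / fact n)" by simp
  also have "\<dots> \<le> (\<Sum>n. y ^ n / fact n)"
    using assms by (intro sum_le_suminf summable_exp_generic[of y, simplified scaleR_conv_of_real]) (auto simp: summable_exp divide_inverse mult.commute)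
  also have "\<dots> = exp y" by (simp add: exp_def divide_inverse mult.commute)
  finally show ?thesis by (simp add: pos_divide_le_eq mult.commute)
qed

lemma rapid_gauss:
  assumes "c > 0" shows "rapid (gauss c :: 'a::euclidean_space \<Rightarrow> complex)"
  unfolding rapid_def
proof
  fix N
  define \<delta> where "\<delta> = pi * c"
  have \<delta>: "\<delta> > 0" using assms by (simp add: \<delta>_def)
  have "(1 + norm x) ^ N * norm (gauss c x) \<le> (2 / \<delta>) ^ N * fact N * exp \<delta>" for x :: 'a
  proof -
    let ?r = "norm x"
    \<comment> \<open>The power of \<open>1 + norm x\<close> is at most that of a multiple of \<open>\<delta> * (1 + (norm x)\<^sup>2)\<close>, which is
      absorbed by the exponential of the same quantity.\<close>
    have "1 + ?r \<le> 2 * (1 + ?r\<^sup>2)"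
      using zero_le_power2[of "?r - 1"] zero_le_power2[of ?r] unfolding power2_diff power_one mult_1_right by argo
    also have "\<dots> = (2 / \<delta>) * (\<delta> * (1 + ?r\<^sup>2))" using \<delta> by simp
    finally have "(1 + ?r) ^ N \<le> (2 / \<delta>) ^ N * (\<delta> * (1 + ?r\<^sup>2)) ^ N"
      unfolding power_mult_distrib[symmetric] by (rule power_mono) simp
    also have "\<dots> \<le> (2 / \<delta>) ^ N * (fact N * exp (\<delta> * (1 + ?r\<^sup>2)))"
      using \<delta> by (intro mult_left_mono power_le_fact_exp) auto
    finally have "(1 + ?r) ^ N * exp (- (\<delta> * ?r\<^sup>2))
        \<le> (2 / \<delta>) ^ N * (fact N * exp (\<delta> * (1 + ?r\<^sup>2))) * exp (- (\<delta> * ?r\<^sup>2))"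
      by (rule mult_right_mono) simp
    also have "\<dots> = (2 / \<delta>) ^ N * fact N * exp (\<delta> * (1 + ?r\<^sup>2) + - (\<delta> * ?r\<^sup>2))"
      unfolding exp_add by simp
    also have "\<dots> = (2 / \<delta>) ^ N * fact N * exp \<delta>" by (simp add: distrib_left)
    finally show ?thesis by (simp add: gauss_def \<delta>_def power2_norm_eq_inner)
  qed
  then show "\<exists>C. \<forall>x::'a. (1 + norm x) ^ N * norm (gauss c x) \<le> C" by blast
qed

lemma moderate_coord: "i \<in> Basis \<Longrightarrow> moderate (\<lambda>x. of_real (x \<bullet> i))"
  unfolding moderate_def
proof (intro exI allI)
  fix x :: 'a assume "i \<in> Basis"
  then show "norm (of_real (x \<bullet> i) :: complex) \<le> 1 * (1 + norm x) ^ 1"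
    using Basis_le_norm[of i x] by simp
qed

lemma gauss_schwartz:
  assumes c: "c > 0" shows "gauss c \<in> (schwartz :: ('a::euclidean_space \<Rightarrow> complex) set)"
proof -
  have *: "(\<forall>x. f differentiable (at x)) \<and> rapid f \<and> (\<forall>i\<in>Basis. partial_deriv i f \<in> polynomial_gauss c)"
    if "f \<in> polynomial_gauss c" for f :: "'a \<Rightarrow> complex"
    using that
  proof induction
    case base
    have "partial_deriv i (gauss c) = (\<lambda>x. (- (2 * pi * c)) * (of_real (x \<bullet> i) * gauss c x))" for i :: 'a
      using partial_deriv_eqI[OF gauss_has_derivative, of i c] by (auto simp: fun_eq_iff)
    then have "partial_deriv i (gauss c) \<in> polynomial_gauss c" if "i \<in> Basis" for i :: 'a
      using polynomial_gauss.scale[OF polynomial_gauss.coord[OF polynomial_gauss.base that]] by metis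
    then show ?case using c rapid_gauss gauss_has_derivative differentiableI
      by (intro conjI allI ballI; fast)
  next
    case (coord f j)
    have hd: "((\<lambda>x. of_real (x \<bullet> j) :: complex) has_derivative (\<lambda>h. of_real (h \<bullet> j))) (at x)" for x :: 'a
      by (rule bounded_linear.has_derivative[OF bounded_linear_of_real]) (auto intro!: derivative_eq_intros)
    then have d: "(\<lambda>x. of_real (x \<bullet> j) :: complex) differentiable (at x)" for x :: 'a
      using differentiableI by blast
    have e: "partial_deriv i (\<lambda>x. of_real (x \<bullet> j) * f x)
        = (\<lambda>x. of_real (i \<bullet> j) * f x + of_real (x \<bullet> j) * partial_deriv i f x)" for i
      using partial_deriv_mult[OF d, of f i] coord.IH partial_deriv_eqI[OF hd] by simp
    have "rapid (\<lambda>x. f x * of_real (x \<bullet> j))"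
      using coord.IH by (intro rapid_mult_moderate moderate_coord coord.hyps) auto
    then have "rapid (\<lambda>x. of_real (x \<bullet> j) * f x)" by (simp only: mult.commute)
    then show ?case using coord d unfolding e
      by (auto intro!: polynomial_gauss.intros derivative_intros)
  next
    case (scale f k)
    have "rapid (\<lambda>x. f x * k)"
      using scale.IH by (intro rapid_mult_moderate moderate_const) auto
    then have "rapid (\<lambda>x. k * f x)" by (simp only: mult.commute)
    moreover have "partial_deriv i (\<lambda>x. k * f x) = (\<lambda>x. k * partial_deriv i f x)" for i
      using scale.IH by (intro partial_deriv_cmult) auto
    ultimately show ?case using scale
      by (auto intro!: polynomial_gauss.intros derivative_intros)
  next
    case (add f g)
    then show ?case 
      using rapid_add[of f g] by (auto intro!: polynomial_gauss.intros derivative_intros simp: partial_deriv_add)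
  qed
  show ?thesis unfolding schwartz_eq
  proof (rule smooth_with_coinduct[where A="polynomial_gauss c"])
    show "gauss c \<in> polynomial_gauss c" by (rule polynomial_gauss.base)
  qed (use * in auto)
qed

lemma heat_schwartz: "c > 0 \<Longrightarrow> heat c \<in> schwartz"
  unfolding heat_def[abs_def] by (intro schwartz_cmult gauss_schwartz)

text \<open>After rescaling this is the characteristic function of the standard normal distribution.\<close>

lemma integral_gauss_real:
  assumes c: "c > 0"
  shows "integrable lborel (\<lambda>x::real. of_real (exp (- (pi * c * x\<^sup>2))) * cis (- 2 * pi * (x * w)))"
    and "(LINT x|lborel. of_real (exp (- (pi * c * x\<^sup>2))) * cis (- 2 * pi * (x * w)))
      = of_real (exp (- (pi * w\<^sup>2 / c)) / sqrt c)"
proof -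
  let ?f = "\<lambda>x::real. of_real (exp (- (pi * c * x\<^sup>2))) * cis (- 2 * pi * (x * w))"
  have "gauss c \<in> (schwartz :: (real \<Rightarrow> complex) set)" by (rule gauss_schwartz[OF c])
  from schwartz_integrable[OF schwartz_wave[OF this, of w]]
  show I: "integrable lborel ?f" by (simp add: gauss_def power2_eq_square)
  define k where "k = 1 / sqrt (2 * pi * c)"
  define t where "t = - 2 * pi * w * k"
  have k: "k > 0" using c by (simp add: k_def)
  have k2: "pi * c * k\<^sup>2 = 1 / 2" using c by (simp add: k_def power_divide)
  have t2: "t\<^sup>2 / 2 = pi * w\<^sup>2 / c" using c by (simp add: t_def k_def power_divide power_mult_distrib power2_eq_square)
  have e1: "pi * c * (k * y)\<^sup>2 = y\<^sup>2 / 2" for y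
  proof -
    have "pi * c * (k * y)\<^sup>2 = (pi * c * k\<^sup>2) * y\<^sup>2" by (simp add: power_mult_distrib)
    then show ?thesis unfolding k2 by simp
  qed
  have "(LINT x|lborel. ?f x) = k *\<^sub>R (LINT y|lborel. ?f (0 + k * y))"
    using k by (subst lborel_integral_real_affine[of k _ 0]) auto
  also have "(LINT y|lborel. ?f (0 + k * y))
      = (LINT y|lborel. of_real (sqrt (2 * pi)) * (std_normal_density y *\<^sub>R exp (\<i> * of_real (t * y))))"
    unfolding add_0 e1
    by (intro Bochner_Integration.integral_cong refl)
      (simp add: std_normal_density_def cis_conv_exp t_def scaleR_conv_of_real mult_ac)
  also have "\<dots> = of_real (sqrt (2 * pi)) * char std_normal_distribution t"
    unfolding integral_mult_right_zero char_def
    by (subst integral_density) (simp_all add: normal_density_nonneg)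
  also have "\<dots> = of_real (sqrt (2 * pi) * exp (- (pi * w\<^sup>2 / c)))"
    unfolding char_std_normal_distribution using t2 by (simp add: exp_of_real flip: of_real_power)
  also have "k *\<^sub>R of_real (sqrt (2 * pi) * exp (- (pi * w\<^sup>2 / c)))
      = (of_real (exp (- (pi * w\<^sup>2 / c)) / sqrt c) :: complex)"
    using c by (simp add: k_def real_sqrt_mult scaleR_conv_of_real)
  finally show "(LINT x|lborel. ?f x) = of_real (exp (- (pi * w\<^sup>2 / c)) / sqrt c)" .
qed

lemma fourier_gauss:
  assumes c: "c > 0"
  shows "fourier (gauss c :: 'a::euclidean_space \<Rightarrow> complex) = heat (1 / c)"
proof
  fix \<omega> :: 'a
  let ?f = "\<lambda>b x::real. of_real (exp (- (pi * c * x\<^sup>2))) * cis (- 2 * pi * (x * (\<omega> \<bullet> b)))"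
  have prod_cis: "(\<Prod>b\<in>A. cis (f b)) = cis (\<Sum>b\<in>A. f b)" for A and f :: "'a \<Rightarrow> real"
    by (induction A rule: infinite_finite_induct) (auto simp: cis_mult)
  have e: "gauss c x * wave \<omega> x = (\<Prod>b\<in>Basis. ?f b (x \<bullet> b))" for x :: 'a
  proof -
    have "x \<bullet> x = (\<Sum>b\<in>Basis. (x \<bullet> b)\<^sup>2)" by (subst euclidean_inner) (simp add: power2_eq_square)
    moreover have "x \<bullet> \<omega> = (\<Sum>b\<in>Basis. (x \<bullet> b) * (\<omega> \<bullet> b))" by (rule euclidean_inner)
    moreover have "exp (- (pi * c * (x \<bullet> x))) = (\<Prod>b\<in>Basis. exp (- (pi * c * (x \<bullet> b)\<^sup>2)))"
      unfolding calculation(1) by (simp add: exp_sum[symmetric] sum_negf sum_distrib_left)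
    ultimately show ?thesis
      by (simp add: gauss_def prod.distrib prod_cis sum_distrib_left sum_negf flip: of_real_prod)
  qed
  have "fourier (gauss c) \<omega> = (\<Prod>b\<in>(Basis::'a set). of_real (exp (- (pi * (\<omega> \<bullet> b)\<^sup>2 / c)) / sqrt c))"
    unfolding fourier_def e using integral_gauss_real[OF c]
    by (subst integral_prod_Basis) (auto simp del: of_real_divide of_real_exp)
  also have "\<dots> = of_real ((\<Prod>b\<in>(Basis::'a set). exp (- (pi * (\<omega> \<bullet> b)\<^sup>2 / c))) / sqrt c ^ DIM('a))"
    by (simp add: prod_dividef)
  also have "(\<Prod>b\<in>(Basis::'a set). exp (- (pi * (\<omega> \<bullet> b)\<^sup>2 / c))) = exp (- (pi * (1 / c) * (\<omega> \<bullet> \<omega>)))"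
    by (subst euclidean_inner) (simp add: exp_sum[symmetric] sum_negf sum_distrib_left power2_eq_square sum_divide_distrib)
  also have "sqrt c ^ DIM('a) = c powr (DIM('a) / 2)"
  proof -
    have "sqrt c ^ DIM('a) = (c powr (1 / 2)) powr DIM('a)"
      using c by (subst powr_realpow) (simp_all add: powr_half_sqrt)
    then show ?thesis by (simp add: powr_powr)
  qed
  also have "exp (- (pi * (1 / c) * (\<omega> \<bullet> \<omega>))) / c powr (DIM('a) / 2)
      = (1 / c) powr (DIM('a) / 2) * exp (- (pi * (1 / c) * (\<omega> \<bullet> \<omega>)))" using c by (simp add: powr_divide)
  finally show "fourier (gauss c) \<omega> = heat (1 / c) \<omega>"
    unfolding heat_def gauss_def[of "1 / c"] by simp
qed

lemma fourier_heat:
  assumes c: "c > 0"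
  shows "fourier (heat c :: 'a::euclidean_space \<Rightarrow> complex) = gauss (1 / c)"
proof
  fix \<omega> :: 'a
  have "fourier (heat c) \<omega> = of_real (c powr (DIM('a) / 2)) * fourier (gauss c) \<omega>"
    unfolding fourier_def heat_def by (simp add: mult.assoc)
  also have "\<dots> = gauss (1 / c) \<omega>"
    unfolding fourier_gauss[OF c] heat_def using c by (simp add: powr_mult[symmetric] flip: of_real_mult mult.assoc)
  finally show "fourier (heat c) \<omega> = gauss (1 / c) \<omega>" .
qed

lemma norm_heat: "norm (heat c (x::'a::euclidean_space)) = c powr (DIM('a) / 2) * exp (- (pi * c * (x \<bullet> x)))"
  by (simp add: heat_def gauss_def norm_mult)

lemma heat_eq_norm: "heat c x = of_real (norm (heat c x))"
  unfolding norm_heat by (simp add: heat_def gauss_def)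

lemma heat_even: "heat c (- x) = heat c x" "heat c (x - y) = heat c (y - x)"
  by (simp_all add: heat_def gauss_def inner_diff_left inner_diff_right inner_commute)

lemma norm_gauss_le: "c \<ge> 0 \<Longrightarrow> norm (gauss c x) \<le> 1"
  by (simp add: gauss_def)

lemma integral_heat:
  assumes c: "c > 0"
  shows "integrable lborel (\<lambda>x::'a::euclidean_space. norm (heat c x))"
    and "(LINT x::'a|lborel. norm (heat c x)) = 1"
proof -
  show "integrable lborel (\<lambda>x::'a. norm (heat c x))"
    by (intro integrable_norm schwartz_integrable heat_schwartz c)
  have "of_real (LINT x::'a|lborel. norm (heat c x)) = fourier (heat c :: 'a \<Rightarrow> complex) 0"
    unfolding fourier_def by (simp add: integral_complex_of_real[symmetric] heat_eq_norm[symmetric])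
  also have "\<dots> = 1" by (simp add: fourier_heat[OF c] gauss_def)
  finally show "(LINT x::'a|lborel. norm (heat c x)) = 1" by (simp only: of_real_eq_1_iff)
qed

section \<open>Averages against the heat kernel\<close>

text \<open>The graph of a power lies above its tangents.  This is Jensen's inequality before integration, and it
yields the convexity of the power on the closed half-line.\<close>

lemma powr_tangent:
  fixes P y m :: real
  assumes "1 \<le> P" "0 \<le> y" "0 < m"
  shows "m powr P + P * m powr (P - 1) * (y - m) \<le> y powr P"
proof (cases "y = 0")
  case True
  have "m powr (P - 1) * m = m powr P" using assms powr_add[of m "P - 1" 1] by simp
  then have "m powr P + P * m powr (P - 1) * (y - m) = (1 - P) * m powr P"
    using True by (simp add: algebra_simps)
  also have "\<dots> \<le> 0" using assms by (simp add: mult_nonpos_nonneg)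
  finally show ?thesis using True by simp
next
  case False
  have "P * m powr (P - 1) * (y - m) \<le> y powr P - m powr P"
  proof (rule convex_on_imp_above_tangent[OF powr_convex[OF assms(1)]])
    show "((\<lambda>x. x powr P) has_real_derivative P * m powr (P - 1)) (at m within {0<..})"
      using assms by (auto intro!: derivative_eq_intros)
  qed (use assms False in \<open>auto simp: interior_open\<close>)
  then show ?thesis by simp
qed

lemma le_one_plus_powr: "0 \<le> s \<Longrightarrow> 1 \<le> p \<Longrightarrow> s \<le> 1 + s powr p" for s p :: real
proof (cases "s \<le> 1")
  case False
  assume "1 \<le> p"
  then have "s powr 1 \<le> s powr p" using False by (intro powr_mono) auto
  then show ?thesis using False by simp
qed (simp add: add_increasing2)

lemma lborel_integral_affine:
  fixes f :: "'a::euclidean_space \<Rightarrow> 'b::{banach,second_countable_topology}"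
  assumes c: "c \<noteq> 0" and [measurable]: "f \<in> borel_measurable borel"
  shows "(LINT x|lborel. f x) = \<bar>c\<bar> ^ DIM('a) *\<^sub>R (LINT x|lborel. f (t + c *\<^sub>R x))"
proof -
  have "(LINT x|lborel. f x)
      = (LINT x|density (distr lborel borel (\<lambda>x. t + c *\<^sub>R x)) (\<lambda>_. ennreal (\<bar>c\<bar> ^ DIM('a))). f x)"
    using lborel_affine[OF c, of t] by (simp add: ennreal_power)
  also have "\<dots> = \<bar>c\<bar> ^ DIM('a) *\<^sub>R (LINT x|lborel. f (t + c *\<^sub>R x))"
    by (subst integral_density) (simp_all add: integral_distr)
  finally show ?thesis .
qed

lemma lborel_integrable_affine:
  fixes f :: "'a::euclidean_space \<Rightarrow> 'b::{banach,second_countable_topology}"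
  assumes c: "c \<noteq> 0" and [measurable]: "f \<in> borel_measurable borel"
  shows "integrable lborel f \<longleftrightarrow> integrable lborel (\<lambda>x. f (t + c *\<^sub>R x))"
proof -
  have "integrable lborel f
      = integrable (density (distr lborel borel (\<lambda>x. t + c *\<^sub>R x)) (\<lambda>_. ennreal (\<bar>c\<bar> ^ DIM('a)))) f"
    using lborel_affine[OF c, of t] by (simp add: ennreal_power)
  also have "\<dots> = integrable lborel (\<lambda>x. f (t + c *\<^sub>R x))"
  proof -
    have "integrable lborel (\<lambda>x. f (t + c *\<^sub>R x))" if "integrable lborel (\<lambda>x. \<bar>c\<bar> ^ DIM('a) *\<^sub>R f (t + c *\<^sub>R x))"
      using integrable_scaleR_right[OF that, of "inverse (\<bar>c\<bar> ^ DIM('a))"] c by simp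
    then show ?thesis
      by (subst integrable_density) (auto simp: integrable_distr_eq intro: integrable_scaleR_right)
  qed
  finally show ?thesis .
qed

lemma heat_measurable [measurable]: "heat c \<in> borel_measurable borel"
  unfolding heat_def[abs_def] gauss_def[abs_def] by measurable

lemma gauss_measurable [measurable]: "gauss c \<in> borel_measurable borel"
  unfolding gauss_def[abs_def] by measurable

lemma heat_rescale:
  fixes z :: "'a::euclidean_space"
  assumes c: "c > 0"
  shows "(1 / sqrt c) ^ DIM('a) *\<^sub>R heat c ((1 / sqrt c) *\<^sub>R z) = heat 1 z"
proof -
  have "sqrt c ^ DIM('a) = (c powr (1 / 2)) powr DIM('a)"
    using c by (subst powr_realpow) (simp_all add: powr_half_sqrt)
  then have 1: "sqrt c ^ DIM('a) = c powr (DIM('a) / 2)" by (simp add: powr_powr)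
  have 2: "pi * c * ((1 / sqrt c) *\<^sub>R z \<bullet> (1 / sqrt c) *\<^sub>R z) = pi * 1 * (z \<bullet> z)"
    using c by (simp add: power2_eq_square[symmetric])
  have "(1 / sqrt c) ^ DIM('a) * c powr (DIM('a) / 2) = 1" using c 1 by (simp add: power_divide)
  then have "(1 / sqrt c) ^ DIM('a) * (c powr (DIM('a) / 2) * exp (- (pi * 1 * (z \<bullet> z)))) = exp (- (pi * 1 * (z \<bullet> z)))"
    by (simp only: mult.assoc[symmetric] mult_1_left)
  then show ?thesis unfolding heat_def gauss_def 2
    unfolding scaleR_conv_of_real of_real_mult[symmetric] by (simp only: powr_one_eq_one mult_1_left)
qed

lemma heat_average:
  fixes f :: "'a::euclidean_space \<Rightarrow> complex"
  assumes c: "c > 0" and [measurable]: "f \<in> borel_measurable borel"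
  shows "(LINT y|lborel. heat c (x - y) * f y) = (LINT z|lborel. heat 1 z * f (x + (1 / sqrt c) *\<^sub>R z))"
proof -
  let ?k = "1 / sqrt c"
  have k: "?k \<noteq> 0" "\<bar>?k\<bar> = ?k" using c by auto
  have "(LINT y|lborel. heat c (x - y) * f y)
      = \<bar>?k\<bar> ^ DIM('a) *\<^sub>R (LINT z|lborel. heat c (x - (x + ?k *\<^sub>R z)) * f (x + ?k *\<^sub>R z))"
    by (rule lborel_integral_affine[OF k(1)]) measurable
  also have "\<dots> = (LINT z|lborel. (?k ^ DIM('a) *\<^sub>R heat c (?k *\<^sub>R z)) * f (x + ?k *\<^sub>R z))"
    unfolding k(2) mult_scaleR_left integral_scaleR_right by (simp add: heat_even(1))
  also have "\<dots> = (LINT z|lborel. heat 1 z * f (x + ?k *\<^sub>R z))"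
    unfolding heat_rescale[OF c] ..
  finally show ?thesis .
qed

text \<open>Substituting \<open>z / sqrt c\<close> turns the kernel into \<open>heat 1\<close> and, as \<open>c \<ge> 1\<close>, does not increase the
weight; so the moments are bounded uniformly in \<open>c\<close>.\<close>

lemma heat_moment:
  obtains K where "0 \<le> K"
    "\<And>c. 1 \<le> c \<Longrightarrow> integrable lborel (\<lambda>z::'a::euclidean_space. norm (heat c z) * (1 + norm z) ^ N)"
    "\<And>c. 1 \<le> c \<Longrightarrow> (LINT z::'a|lborel. norm (heat c z) * (1 + norm z) ^ N) \<le> K"
proof -
  have I: "integrable lborel (\<lambda>z::'a. norm (heat c z) * (1 + norm z) ^ N)" if "1 \<le> c" for c
  proof -
    have "heat c \<in> (schwartz :: ('a \<Rightarrow> complex) set)" using that by (intro heat_schwartz) simp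
    then obtain C where C: "C > 0" "\<And>z::'a. norm (heat c z) \<le> C / (1 + norm z) ^ (2 * DIM('a) + N)"
      by (rule schwartz_bound[where N="2 * DIM('a) + N"]) blast
    show ?thesis
    proof (rule Bochner_Integration.integrable_bound[OF integrable_weight_ge[OF order.refl, of C]])
      show "AE z::'a in lborel. norm (norm (heat c z) * (1 + norm z) ^ N) \<le> norm (C / (1 + norm z) ^ (2 * DIM('a)))"
      proof (rule AE_I2)
        fix z :: 'a
        have "norm (heat c z) * (1 + norm z) ^ N \<le> C / (1 + norm z) ^ (2 * DIM('a) + N) * (1 + norm z) ^ N"
          by (rule mult_right_mono[OF C(2)]) simp
        then show "norm (norm (heat c z) * (1 + norm z) ^ N) \<le> norm (C / (1 + norm z) ^ (2 * DIM('a)))"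
          using C(1) by (simp add: power_add)
      qed
    qed measurable
  qed
  define K where "K = (LINT z::'a|lborel. norm (heat 1 z) * (1 + norm z) ^ N)"
  have KI: "(LINT z::'a|lborel. norm (heat c z) * (1 + norm z) ^ N) \<le> K" if c: "1 \<le> c" for c
  proof -
    have k: "0 < 1 / sqrt c" "1 / sqrt c \<le> 1" using c by auto
    have k': "1 / sqrt c \<noteq> 0" "\<bar>1 / sqrt c\<bar> = 1 / sqrt c" using c by auto
    have r: "(1 / sqrt c) ^ DIM('a) * norm (heat c ((1 / sqrt c) *\<^sub>R z)) = norm (heat 1 z)" for z :: 'a
    proof -
      have "norm (heat 1 z) = norm ((1 / sqrt c) ^ DIM('a) *\<^sub>R heat c ((1 / sqrt c) *\<^sub>R z))"
        by (subst heat_rescale) (use c in auto)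
      then show ?thesis using c by simp
    qed
    have "(LINT z::'a|lborel. norm (heat c z) * (1 + norm z) ^ N)
        = \<bar>1 / sqrt c\<bar> ^ DIM('a) *\<^sub>R (LINT z::'a|lborel. norm (heat c (0 + (1 / sqrt c) *\<^sub>R z)) * (1 + norm (0 + (1 / sqrt c) *\<^sub>R z)) ^ N)"
      by (rule lborel_integral_affine[OF k'(1)]) measurable
    also have "\<dots> = (LINT z::'a|lborel. (1 / sqrt c) ^ DIM('a) * norm (heat c ((1 / sqrt c) *\<^sub>R z)) * (1 + norm ((1 / sqrt c) *\<^sub>R z)) ^ N)"
      unfolding k'(2) mult.assoc integral_mult_right_zero real_scaleR_def add_0 ..
    also have "\<dots> = (LINT z::'a|lborel. norm (heat 1 z) * (1 + norm ((1 / sqrt c) *\<^sub>R z)) ^ N)"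
      unfolding r ..
    also have "\<dots> \<le> K"
      unfolding K_def
    proof (rule integral_mono')
      fix z :: 'a
      have "norm ((1 / sqrt c) *\<^sub>R z) \<le> norm z"
        using k mult_right_mono[OF k(2) norm_ge_zero[of z]] by simp
      then show "norm (heat 1 z) * (1 + norm ((1 / sqrt c) *\<^sub>R z)) ^ N \<le> norm (heat 1 z) * (1 + norm z) ^ N"
        by (intro mult_left_mono power_mono) auto
    qed (auto intro: I)
    finally show ?thesis .
  qed
  have "0 \<le> K" unfolding K_def by (intro Bochner_Integration.integral_nonneg) auto
  then show ?thesis using I KI by (rule that)
qed

lemma heat_translate_integral:
  fixes f :: "'a::euclidean_space \<Rightarrow> real"
  assumes [measurable]: "f \<in> borel_measurable borel"
  shows "(LINT y|lborel. norm (heat c (x - y)) * f (x - y)) = (LINT z|lborel. norm (heat c z) * f z)"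
proof -
  have "(LINT z|lborel. norm (heat c z) * f z)
      = \<bar>-1\<bar> ^ DIM('a) *\<^sub>R (LINT y|lborel. norm (heat c (x + (-1) *\<^sub>R y)) * f (x + (-1) *\<^sub>R y))"
    by (rule lborel_integral_affine) auto
  then show ?thesis by simp
qed

lemma heat_translate_integrable:
  fixes f :: "'a::euclidean_space \<Rightarrow> real"
  assumes [measurable]: "f \<in> borel_measurable borel"
  shows "integrable lborel (\<lambda>y. norm (heat c (x - y)) * f (x - y)) \<longleftrightarrow> integrable lborel (\<lambda>z. norm (heat c z) * f z)"
proof -
  have "integrable lborel (\<lambda>z. norm (heat c z) * f z)
      \<longleftrightarrow> integrable lborel (\<lambda>y. norm (heat c (x + (-1) *\<^sub>R y)) * f (x + (-1) *\<^sub>R y))"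
    by (rule lborel_integrable_affine) auto
  then show ?thesis by simp
qed

lemma conv_heat_decay:
  obtains K where "0 \<le> K"
    "\<And>c C (f::'a::euclidean_space \<Rightarrow> complex) x. 1 \<le> c \<Longrightarrow> 0 \<le> C \<Longrightarrow> (\<And>x. norm (f x) \<le> C / (1 + norm x) ^ N)
      \<Longrightarrow> norm (conv (heat c) f x) \<le> K * C / (1 + norm x) ^ N"
proof -
  obtain K where K: "0 \<le> K"
    "\<And>c. 1 \<le> c \<Longrightarrow> integrable lborel (\<lambda>z::'a. norm (heat c z) * (1 + norm z) ^ N)"
    "\<And>c. 1 \<le> c \<Longrightarrow> (LINT z::'a|lborel. norm (heat c z) * (1 + norm z) ^ N) \<le> K"
    by (rule heat_moment[where N=N and 'a='a]) blast
  have KI: "norm (conv (heat c) f x) \<le> K * C / (1 + norm x) ^ N"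
    if c: "1 \<le> c" and C: "0 \<le> C" and f: "\<And>x. norm (f x) \<le> C / (1 + norm x) ^ N"
    for c C x and f :: "'a \<Rightarrow> complex"
  proof -
    have "norm (conv (heat c) f x)
        \<le> (LINT y|lborel. C / (1 + norm x) ^ N * (norm (heat c (x - y)) * (1 + norm (x - y)) ^ N))"
      unfolding conv_def
    proof (rule norm_integral_le)
      show "integrable lborel (\<lambda>y. C / (1 + norm x) ^ N * (norm (heat c (x - y)) * (1 + norm (x - y)) ^ N))"
        by (intro integrable_mult_right) (simp add: heat_translate_integrable[of "\<lambda>z. (1 + norm z) ^ N"] K(2)[OF c])
      fix y
      have "1 / (1 + norm y) ^ N \<le> (1 + norm (x - y)) ^ N / (1 + norm x) ^ N"
        using inverse_weight_submult[of "x - y" x N] by (simp add: norm_minus_commute)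
      then have "C * (1 / (1 + norm y) ^ N) \<le> C * ((1 + norm (x - y)) ^ N / (1 + norm x) ^ N)"
        using C by (rule mult_left_mono)
      then have "norm (f y) \<le> C / (1 + norm x) ^ N * (1 + norm (x - y)) ^ N"
        using f[of y] by simp
      from mult_left_mono[OF this norm_ge_zero[of "heat c (x - y)"]]
      show "norm (heat c (x - y) * f y) \<le> C / (1 + norm x) ^ N * (norm (heat c (x - y)) * (1 + norm (x - y)) ^ N)"
        by (simp add: norm_mult mult_ac)
    qed
    also have "\<dots> = C / (1 + norm x) ^ N * (LINT z::'a|lborel. norm (heat c z) * (1 + norm z) ^ N)"
      by (subst integral_mult_right_zero) (simp add: heat_translate_integral[of "\<lambda>z. (1 + norm z) ^ N"])
    also have "\<dots> \<le> C / (1 + norm x) ^ N * K"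
      using C by (intro mult_left_mono K(3)[OF c]) auto
    finally show ?thesis by (simp add: mult.commute)
  qed
  show ?thesis using K(1) KI by (rule that)
qed

lemma conv_heat_rapid:
  fixes f :: "'a::euclidean_space \<Rightarrow> complex"
  assumes "1 \<le> c" "rapid f"
  shows "rapid (conv (heat c) f)"
proof (rule rapidI)
  fix N
  obtain C where C: "C > 0" "\<And>x. norm (f x) \<le> C / (1 + norm x) ^ N" using rapid_obtain[OF assms(2)] by metis
  obtain K where "\<And>c C (f::'a \<Rightarrow> complex) x. 1 \<le> c \<Longrightarrow> 0 \<le> C \<Longrightarrow> (\<And>x. norm (f x) \<le> C / (1 + norm x) ^ N)
      \<Longrightarrow> norm (conv (heat c) f x) \<le> K * C / (1 + norm x) ^ N"
    by (rule conv_heat_decay[where N=N and 'a='a]) blast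
  from this[OF assms(1) less_imp_le[OF C(1)] C(2)]
  show "\<exists>C. \<forall>x. norm (conv (heat c) f x) \<le> C / (1 + norm x) ^ N" by blast
qed

text \<open>Jensen's inequality for the probability density \<open>y \<mapsto> heat c (x - y)\<close> moves the power under the integral,
and the weight at \<open>x\<close> is at most the product of the weights at \<open>y\<close> and \<open>x - y\<close>.  What is left is a moment
of the heat kernel.\<close>

lemma conv_heat_norm:
  assumes P: "1 \<le> P" and A: "0 \<le> A"
  obtains K where "\<And>c (v::'a::euclidean_space \<Rightarrow> complex). 1 \<le> c \<Longrightarrow> v \<in> borel_measurable borel \<Longrightarrow>
    (\<integral>\<^sup>+x. ennreal (norm (conv (heat c) v x) powr P * (1 + norm x) powr A) \<partial>lborel)
      \<le> ennreal K * (\<integral>\<^sup>+y. ennreal (norm (v y) powr P * (1 + norm y) powr A) \<partial>lborel)"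
proof -
  define N where "N = nat \<lceil>A\<rceil>"
  have N: "r powr A \<le> r ^ N" if "1 \<le> r" for r
    using that by (subst powr_realpow[symmetric]) (auto simp: N_def intro!: powr_mono real_nat_ceiling_ge)
  obtain K where K: "0 \<le> K"
    "\<And>c. 1 \<le> c \<Longrightarrow> integrable lborel (\<lambda>z::'a. norm (heat c z) * (1 + norm z) ^ N)"
    "\<And>c. 1 \<le> c \<Longrightarrow> (LINT z::'a|lborel. norm (heat c z) * (1 + norm z) ^ N) \<le> K"
    by (rule heat_moment[where N=N and 'a='a]) blast
  have KI: "(\<integral>\<^sup>+x. ennreal (norm (conv (heat c) v x) powr P * (1 + norm x) powr A) \<partial>lborel)
      \<le> ennreal K * (\<integral>\<^sup>+y. ennreal (norm (v y) powr P * (1 + norm y) powr A) \<partial>lborel)"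
    if c: "1 \<le> c" and v[measurable]: "v \<in> borel_measurable borel" for c and v :: "'a \<Rightarrow> complex"
  proof -
    have c0: "c > 0" using c by simp
    let ?h = "\<lambda>x y. norm (heat c (x - y))"
    have hI: "integrable lborel (?h x)" "(LINT y|lborel. ?h x y) = 1" for x :: 'a
      using heat_translate_integrable[of "\<lambda>_. 1" c x] heat_translate_integral[of "\<lambda>_. 1" c x] integral_heat[OF c0, where 'a='a]
      by simp_all
    have jensen: "ennreal (norm (conv (heat c) v x) powr P) \<le> (\<integral>\<^sup>+y. ennreal (?h x y * norm (v y) powr P) \<partial>lborel)" for x
    proof (cases "(\<integral>\<^sup>+y. ennreal (?h x y * norm (v y) powr P) \<partial>lborel) = \<infinity>")
      case False
      then have I1: "integrable lborel (\<lambda>y. ?h x y * norm (v y) powr P)"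
        by (intro integrableI_nonneg) (auto simp: top.not_eq_extremum)
      have I0: "integrable lborel (\<lambda>y. ?h x y * norm (v y))"
      proof (rule Bochner_Integration.integrable_bound[OF Bochner_Integration.integrable_add[OF hI(1) I1]])
        show "AE y in lborel. norm (?h x y * norm (v y)) \<le> norm (?h x y + ?h x y * norm (v y) powr P)"
        proof (rule AE_I2)
          fix y
          show "norm (?h x y * norm (v y)) \<le> norm (?h x y + ?h x y * norm (v y) powr P)"
            using mult_left_mono[OF le_one_plus_powr[OF norm_ge_zero[of "v y"] P], of "?h x y"] by (simp add: distrib_left)
        qed
      qed measurable
      define m where "m = (LINT y|lborel. ?h x y * norm (v y))"
      have m0: "0 \<le> m" unfolding m_def by (intro Bochner_Integration.integral_nonneg) auto
      have le: "norm (conv (heat c) v x) \<le> m"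
        unfolding conv_def m_def by (rule norm_integral_le[OF I0]) (simp add: norm_mult)
      have "m powr P \<le> (LINT y|lborel. ?h x y * norm (v y) powr P)"
      proof (cases "m = 0")
        case True then show ?thesis by (auto intro!: Bochner_Integration.integral_nonneg)
      next
        case False
        then have m: "m > 0" using m0 by simp
        \<comment> \<open>The tangent of the power at the mean \<open>m\<close>, integrated against the kernel.\<close>
        let ?T = "\<lambda>y. (m powr P - P * m powr (P - 1) * m) * ?h x y + P * m powr (P - 1) * (?h x y * norm (v y))"
        have "(LINT y|lborel. ?T y) = m powr P"
          using hI I0 by (simp add: m_def[symmetric])
        moreover have "(LINT y|lborel. ?T y) \<le> (LINT y|lborel. ?h x y * norm (v y) powr P)"
        proof (rule integral_mono)
          show "integrable lborel ?T" using hI I0 by (intro Bochner_Integration.integrable_add integrable_mult_right)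
          fix y
          show "?T y \<le> ?h x y * norm (v y) powr P"
            using mult_left_mono[OF powr_tangent[OF P norm_ge_zero[of "v y"] m], of "?h x y"]
            by (simp add: algebra_simps)
        qed (rule I1)
        ultimately show ?thesis by simp
      qed
      moreover have "norm (conv (heat c) v x) powr P \<le> m powr P"
        using le P by (intro powr_mono2) auto
      ultimately have "norm (conv (heat c) v x) powr P \<le> (LINT y|lborel. ?h x y * norm (v y) powr P)" by simp
      then show ?thesis by (subst nn_integral_eq_integral[OF I1]) (auto intro: ennreal_leI)
    qed simp
    have "(\<integral>\<^sup>+x. ennreal (norm (conv (heat c) v x) powr P * (1 + norm x) powr A) \<partial>lborel)
        \<le> (\<integral>\<^sup>+x. \<integral>\<^sup>+y. ennreal (?h x y * norm (v y) powr P) * ennreal ((1 + norm x) powr A) \<partial>lborel \<partial>lborel)"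
    proof (intro nn_integral_mono)
      fix x :: 'a
      have "ennreal (norm (conv (heat c) v x) powr P * (1 + norm x) powr A)
          = ennreal (norm (conv (heat c) v x) powr P) * ennreal ((1 + norm x) powr A)"
        by (rule ennreal_mult) auto
      also have "\<dots> \<le> (\<integral>\<^sup>+y. ennreal (?h x y * norm (v y) powr P) \<partial>lborel) * ennreal ((1 + norm x) powr A)"
        by (rule mult_right_mono[OF jensen]) simp
      also have "\<dots> = (\<integral>\<^sup>+y. ennreal (?h x y * norm (v y) powr P) * ennreal ((1 + norm x) powr A) \<partial>lborel)"
        by (rule nn_integral_multc[symmetric]) measurable
      finally show "ennreal (norm (conv (heat c) v x) powr P * (1 + norm x) powr A)
          \<le> (\<integral>\<^sup>+y. ennreal (?h x y * norm (v y) powr P) * ennreal ((1 + norm x) powr A) \<partial>lborel)" .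
    qed
    also have "\<dots> \<le> (\<integral>\<^sup>+x. \<integral>\<^sup>+y. ennreal (norm (v y) powr P * (1 + norm y) powr A) * ennreal (?h x y * (1 + norm (x - y)) ^ N) \<partial>lborel \<partial>lborel)"
    proof (intro nn_integral_mono)
      fix x y :: 'a
      have "(1 + norm x) powr A \<le> ((1 + norm y) * (1 + norm (x - y))) powr A"
        using weight_submult[of x y] A by (intro powr_mono2) (auto simp: norm_minus_commute)
      also have "\<dots> \<le> (1 + norm y) powr A * (1 + norm (x - y)) ^ N"
        unfolding powr_mult by (intro mult_left_mono N) auto
      finally have "(?h x y * norm (v y) powr P) * (1 + norm x) powr A
          \<le> (?h x y * norm (v y) powr P) * ((1 + norm y) powr A * (1 + norm (x - y)) ^ N)"
        by (rule mult_left_mono) simp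
      then show "ennreal (?h x y * norm (v y) powr P) * ennreal ((1 + norm x) powr A)
        \<le> ennreal (norm (v y) powr P * (1 + norm y) powr A) * ennreal (?h x y * (1 + norm (x - y)) ^ N)"
        by (simp add: ennreal_mult[symmetric] ennreal_leI mult_ac)
    qed
    also have "\<dots> = (\<integral>\<^sup>+y. \<integral>\<^sup>+x. ennreal (norm (v y) powr P * (1 + norm y) powr A) * ennreal (?h x y * (1 + norm (x - y)) ^ N) \<partial>lborel \<partial>lborel)"
      by (rule lborel_pair.Fubini') measurable
    also have "\<dots> \<le> (\<integral>\<^sup>+y. ennreal (norm (v y) powr P * (1 + norm y) powr A) * ennreal K \<partial>lborel)"
    proof (intro nn_integral_mono)
      fix y :: 'a
      have e: "?h x y * (1 + norm (x - y)) ^ N = norm (heat c (y - x)) * (1 + norm (y - x)) ^ N" for x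
        by (simp add: heat_even(2)[of c x y] norm_minus_commute)
      have "(\<integral>\<^sup>+x. ennreal (?h x y * (1 + norm (x - y)) ^ N) \<partial>lborel)
          = ennreal (LINT x|lborel. norm (heat c (y - x)) * (1 + norm (y - x)) ^ N)"
        unfolding e by (rule nn_integral_eq_integral)
          (simp_all add: heat_translate_integrable[of "\<lambda>z. (1 + norm z) ^ N"] K(2)[OF c])
      also have "\<dots> \<le> ennreal K"
        using K(3)[OF c] by (intro ennreal_leI) (simp add: heat_translate_integral[of "\<lambda>z. (1 + norm z) ^ N"])
      finally show "(\<integral>\<^sup>+x. ennreal (norm (v y) powr P * (1 + norm y) powr A) * ennreal (?h x y * (1 + norm (x - y)) ^ N) \<partial>lborel)
          \<le> ennreal (norm (v y) powr P * (1 + norm y) powr A) * ennreal K"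
        by (simp add: nn_integral_cmult mult_left_mono)
    qed
    also have "\<dots> = ennreal K * (\<integral>\<^sup>+y. ennreal (norm (v y) powr P * (1 + norm y) powr A) \<partial>lborel)"
      unfolding mult.commute[of _ "ennreal K"] by (rule nn_integral_cmult) measurable
    finally show ?thesis .
  qed
  show ?thesis using KI by (rule that)
qed

section \<open>Gaussian regularisation\<close>

text \<open>The Fourier transform interchanges \<open>mollify c\<close> and \<open>comollify c\<close> (\<open>fourier_mollify\<close>), and the two
operators are transposes of each other (\<open>mollify_adjoint\<close>).  Both are bounded on weighted
Lebesgue spaces uniformly in \<open>c \<ge> 1\<close>, so \<open>mollify c\<close> acts well on a function and on its
Fourier transform at the same time.\<close>

definition mollify :: "real \<Rightarrow> ('a::euclidean_space \<Rightarrow> complex) \<Rightarrow> 'a \<Rightarrow> complex"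
  where "mollify c u x = gauss (1 / c) x * conv (heat c) u x"

definition comollify :: "real \<Rightarrow> ('a::euclidean_space \<Rightarrow> complex) \<Rightarrow> 'a \<Rightarrow> complex"
  where "comollify c u = conv (heat c) (\<lambda>y. gauss (1 / c) y * u y)"

lemma slow_measurable: "m \<in> slow \<Longrightarrow> m \<in> borel_measurable borel"
  unfolding slow_def by (intro borel_measurable_continuous_onI smooth_with_continuous)

lemma mollify_schwartz: "tame u \<Longrightarrow> 0 < c \<Longrightarrow> mollify c u \<in> schwartz"
  unfolding mollify_def[abs_def]
  by (intro schwartz_mult_slow gauss_schwartz slow_conv heat_schwartz) auto

lemma tame_gauss_mult:
  assumes "tame u" "c \<ge> 0"
  shows "tame (\<lambda>y. gauss c y * u y)"
proof -
  have m[measurable]: "u \<in> borel_measurable borel" using assms by (simp add: tame_def)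
  obtain N where N: "integrable lborel (\<lambda>y. norm (u y) / (1 + norm y) ^ N)"
    using assms(1) by (auto simp: tame_def)
  have "integrable lborel (\<lambda>y. norm (gauss c y * u y) / (1 + norm y) ^ N)"
  proof (rule Bochner_Integration.integrable_bound[OF N])
    show "AE y in lborel. norm (norm (gauss c y * u y) / (1 + norm y) ^ N) \<le> norm (norm (u y) / (1 + norm y) ^ N)"
    proof (rule AE_I2)
      fix y
      show "norm (norm (gauss c y * u y) / (1 + norm y) ^ N) \<le> norm (norm (u y) / (1 + norm y) ^ N)"
        using mult_right_mono[OF norm_gauss_le[OF assms(2), of y] norm_ge_zero[of "u y"]]
        by (simp add: norm_mult divide_right_mono)
    qed
  qed measurable
  then show ?thesis unfolding tame_def by auto
qed

lemma tame_bounded: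
  assumes [measurable]: "u \<in> borel_measurable borel" and B: "\<And>x. norm (u x) \<le> B"
  shows "tame (u :: 'a::euclidean_space \<Rightarrow> complex)"
proof -
  have "integrable lborel (\<lambda>y. norm (u y) / (1 + norm y) ^ (2 * DIM('a)))"
    by (rule Bochner_Integration.integrable_bound[OF integrable_weight_ge[OF order.refl, of B]])
      (use B in \<open>auto intro!: divide_right_mono order_trans[OF B abs_ge_self] AE_I2\<close>)
  then show ?thesis unfolding tame_def by auto
qed

lemma rapid_integrable:
  fixes f :: "'a::euclidean_space \<Rightarrow> complex"
  assumes [measurable]: "f \<in> borel_measurable borel" and "rapid f"
  shows "integrable lborel f"
proof -
  obtain C where C: "C > 0" "\<And>x. norm (f x) \<le> C / (1 + norm x) ^ (2 * DIM('a))"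
    using rapid_obtain[OF assms(2)] by metis
  show ?thesis
    by (rule Bochner_Integration.integrable_bound[OF integrable_weight_ge[OF order.refl, of C]])
      (use C in \<open>auto intro!: AE_I2\<close>)
qed

text \<open>Fubini's theorem; the polynomial growth of the convolution is absorbed by the rapid decay of \<open>f\<close>.\<close>

lemma conv_adjoint:
  fixes u f \<eta> :: "'a::euclidean_space \<Rightarrow> complex"
  assumes u: "tame u" and \<eta>: "\<eta> \<in> schwartz" and f: "rapid f" and mf[measurable]: "f \<in> borel_measurable borel"
  shows "(LINT x|lborel. f x * conv \<eta> u x) = (LINT y|lborel. u y * (LINT x|lborel. f x * \<eta> (x - y)))"
proof -
  have [measurable]: "u \<in> borel_measurable borel" by (rule tame_measurable[OF u])
  have [measurable]: "\<eta> \<in> borel_measurable borel" by (rule schwartz_measurable[OF \<eta>])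
  obtain N where N: "integrable lborel (\<lambda>y. norm (u y) / (1 + norm y) ^ N)"
    using u by (auto simp: tame_def)
  obtain C where C: "C > 0" "\<And>x. norm (\<eta> x) \<le> C / (1 + norm x) ^ N" using schwartz_bound[OF \<eta>] by metis
  define K where "K = C * (LINT y|lborel. norm (u y) / (1 + norm y) ^ N)"
  have K0: "0 \<le> K" unfolding K_def using C by (intro mult_nonneg_nonneg Bochner_Integration.integral_nonneg) auto
  have rf: "rapid (\<lambda>x. f x * of_real ((1 + norm x) ^ N))"
  proof (rule rapid_mult_moderate[OF f])
    have "norm (complex_of_real ((1 + norm x) ^ N)) \<le> 1 * (1 + norm x) ^ N" for x :: 'a
      by (subst norm_of_real) simp
    then show "moderate (\<lambda>x::'a. complex_of_real ((1 + norm x) ^ N))" unfolding moderate_def by blast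
  qed
  have nw: "norm (f x * complex_of_real ((1 + norm x) ^ N)) = norm (f x) * (1 + norm x) ^ N" for x
    unfolding norm_mult by (subst norm_of_real) simp
  have "integrable lborel (\<lambda>x. norm (f x * of_real ((1 + norm x) ^ N)))"
    by (intro integrable_norm rapid_integrable rf) measurable
  then have If: "integrable lborel (\<lambda>x. norm (f x) * (1 + norm x) ^ N)" unfolding nw .
  let ?g = "\<lambda>x y. f x * (\<eta> (x - y) * u y)"
  have pair: "integrable (lborel \<Otimes>\<^sub>M lborel) (case_prod ?g)"
  proof (rule lborel_pair.Fubini_integrable)
    show "integrable lborel (\<lambda>x. LINT y|lborel. norm (case_prod ?g (x, y)))"
    proof (rule Bochner_Integration.integrable_bound[OF integrable_mult_right[OF If, of K]])
      show "AE x in lborel. norm (LINT y|lborel. norm (case_prod ?g (x, y))) \<le> norm (K * (norm (f x) * (1 + norm x) ^ N))"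
      proof (rule AE_I2)
        fix x
        have "norm (LINT y|lborel. of_real (norm (\<eta> (x - y))) * complex_of_real (norm (u y)))
            \<le> C * (LINT y|lborel. norm (complex_of_real (norm (u y))) / (1 + norm y) ^ N) * (1 + norm x) ^ N"
          by (rule conv_dominated) (use C N in auto)
        then have "norm (complex_of_real (LINT y|lborel. norm (\<eta> (x - y)) * norm (u y))) \<le> K * (1 + norm x) ^ N"
          unfolding K_def by (simp only: integral_complex_of_real[symmetric] of_real_mult norm_of_real abs_norm_cancel)
        then have *: "(LINT y|lborel. norm (\<eta> (x - y)) * norm (u y)) \<le> K * (1 + norm x) ^ N" by simp
        have "(LINT y|lborel. norm (case_prod ?g (x, y))) = norm (f x) * (LINT y|lborel. norm (\<eta> (x - y)) * norm (u y))"
          by (simp add: norm_mult mult.assoc)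
        also have "\<dots> \<le> norm (f x) * (K * (1 + norm x) ^ N)" by (intro mult_left_mono *) auto
        finally show "norm (LINT y|lborel. norm (case_prod ?g (x, y))) \<le> norm (K * (norm (f x) * (1 + norm x) ^ N))"
          using K0 by (simp add: abs_mult mult_ac Bochner_Integration.integral_nonneg)
      qed
    qed measurable
    show "AE x in lborel. integrable lborel (\<lambda>y. case_prod ?g (x, y))"
      using conv_integrable[OF u \<eta>] by (intro AE_I2) simp
  qed measurable
  have "(LINT x|lborel. f x * conv \<eta> u x) = (LINT x|lborel. LINT y|lborel. ?g x y)"
    by (simp add: conv_def)
  also have "\<dots> = (LINT y|lborel. LINT x|lborel. ?g x y)"
    by (rule lborel_pair.Fubini_integral[symmetric, OF pair])
  also have "\<dots> = (LINT y|lborel. u y * (LINT x|lborel. f x * \<eta> (x - y)))"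
    by (simp add: mult_ac flip: integral_mult_right_zero)
  finally show ?thesis .
qed

lemma heat_adjoint:
  fixes u f :: "'a::euclidean_space \<Rightarrow> complex"
  assumes "tame u" "0 < c" "rapid f" "f \<in> borel_measurable borel"
  shows "(LINT x|lborel. f x * conv (heat c) u x) = (LINT y|lborel. u y * conv (heat c) f y)"
proof -
  have "(LINT x|lborel. f x * heat c (x - y)) = conv (heat c) f y" for y
    unfolding conv_def by (intro Bochner_Integration.integral_cong refl) (simp add: heat_even(2)[of c _ y] mult.commute)
  then show ?thesis
    using conv_adjoint[OF assms(1) heat_schwartz[OF assms(2)] assms(3,4)] by simp
qed

lemma cis_measurable [measurable]: "cis \<in> borel_measurable borel"
  by (intro borel_measurable_continuous_onI continuous_on_cis continuous_on_id)

text \<open>Plane waves are eigenfunctions of convolutions, the eigenvalue being the Fourier transform of the kernel.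
Through \<open>heat_adjoint\<close> this is the convolution theorem.\<close>

lemma conv_heat_wave:
  assumes "0 < c"
  shows "conv (heat c) (wave \<omega>) x = wave \<omega> x * gauss (1 / c) \<omega>"
proof -
  have "conv (heat c) (wave \<omega>) x = (LINT y|lborel. heat c (x - y) * wave \<omega> y)" by (simp add: conv_def)
  also have "\<dots> = \<bar>1\<bar> ^ DIM('a) *\<^sub>R (LINT z|lborel. heat c (x - (x + 1 *\<^sub>R z)) * wave \<omega> (x + 1 *\<^sub>R z))"
    by (rule lborel_integral_affine) auto
  also have "\<dots> = (LINT z|lborel. wave \<omega> x * (heat c z * wave \<omega> z))"
  proof -
    have "heat c (x - (x + 1 *\<^sub>R z)) * wave \<omega> (x + 1 *\<^sub>R z) = wave \<omega> x * (heat c z * wave \<omega> z)" for z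
    proof -
      have "wave \<omega> (x + z) = wave \<omega> x * wave \<omega> z" by (simp add: cis_mult inner_add_left distrib_left)
      then show ?thesis using heat_even(1)[of c z] by simp
    qed
    then show ?thesis by simp
  qed
  also have "\<dots> = wave \<omega> x * gauss (1 / c) \<omega>"
    using fourier_heat[OF assms, where 'a='a] unfolding fourier_def fun_eq_iff by simp
  finally show ?thesis .
qed

lemma fourier_conv_heat:
  fixes f :: "'a::euclidean_space \<Rightarrow> complex"
  assumes "0 < c" "rapid f" "f \<in> borel_measurable borel"
  shows "fourier (conv (heat c) f) \<omega> = gauss (1 / c) \<omega> * fourier f \<omega>"
proof -
  have "tame (wave \<omega>)" by (rule tame_bounded[of _ 1]) auto
  from heat_adjoint[OF this assms]
  have "(LINT y|lborel. wave \<omega> y * conv (heat c) f y) = (LINT x|lborel. f x * (wave \<omega> x * gauss (1 / c) \<omega>))"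
    unfolding conv_heat_wave[OF assms(1)] ..
  also have "\<dots> = gauss (1 / c) \<omega> * (LINT x|lborel. f x * wave \<omega> x)"
    unfolding integral_mult_right_zero[symmetric] by (simp only: mult_ac)
  finally show ?thesis unfolding fourier_def by (simp only: mult.commute)
qed

text \<open>Here \<open>gauss (1 / c)\<close> is itself a Fourier transform, that of \<open>heat c\<close>; so this dual convolution theorem needs
Fubini's theorem only and no Fourier inversion.\<close>

lemma fourier_gauss_mult:
  fixes G :: "'a::euclidean_space \<Rightarrow> complex"
  assumes c: "0 < c" and G: "integrable lborel G"
  shows "fourier (\<lambda>t. gauss (1 / c) t * G t) \<omega> = conv (heat c) (fourier G) \<omega>"
proof -
  have [measurable]: "G \<in> borel_measurable borel" using borel_measurable_integrable[OF G] by simp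
  have hI: "integrable lborel (\<lambda>y. heat c (\<omega> - y))"
    using schwartz_integrable[OF schwartz_reflect[OF heat_schwartz[OF c], of \<omega>]] .
  let ?g = "\<lambda>y t. heat c (\<omega> - y) * (G t * wave y t)"
  have pair: "integrable (lborel \<Otimes>\<^sub>M lborel) (case_prod ?g)"
  proof (rule lborel_pair.Fubini_integrable)
    show "integrable lborel (\<lambda>y. LINT t|lborel. norm (case_prod ?g (y, t)))"
      using integrable_norm[OF hI] by (simp add: norm_mult)
    show "AE y in lborel. integrable lborel (\<lambda>t. case_prod ?g (y, t))"
    proof (rule AE_I2)
      fix y :: 'a
      have "integrable lborel (\<lambda>t. G t * wave y t)"
        by (rule Bochner_Integration.integrable_bound[OF G]) (auto simp: norm_mult)
      then show "integrable lborel (\<lambda>t. case_prod ?g (y, t))" by simp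
    qed
  qed measurable
  have "conv (heat c) (fourier G) \<omega> = (LINT y|lborel. LINT t|lborel. ?g y t)"
    by (simp add: conv_def fourier_def)
  also have "\<dots> = (LINT t|lborel. LINT y|lborel. ?g y t)"
    by (rule lborel_pair.Fubini_integral[symmetric, OF pair])
  also have "\<dots> = (LINT t|lborel. G t * conv (heat c) (wave t) \<omega>)"
    by (simp add: conv_def mult_ac inner_commute flip: integral_mult_right_zero)
  also have "\<dots> = fourier (\<lambda>t. gauss (1 / c) t * G t) \<omega>"
    unfolding conv_heat_wave[OF c] fourier_def by (simp add: mult_ac inner_commute)
  finally show ?thesis ..
qed

lemma fourier_mollify:
  assumes c: "1 \<le> c" and f: "f \<in> schwartz"
  shows "fourier (mollify c f) = comollify c (fourier f)"
proof
  fix \<omega>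
  have r: "rapid f" using f unfolding schwartz_eq by (rule smooth_with_bound)
  have m: "f \<in> borel_measurable borel" by (rule schwartz_measurable[OF f])
  have c0: "0 < c" using c by simp
  have "integrable lborel (conv (heat c) f)"
    by (intro rapid_integrable conv_heat_rapid c r slow_measurable slow_conv schwartz_imp_tame f heat_schwartz c0)
  from fourier_gauss_mult[OF c0 this, of \<omega>]
  show "fourier (mollify c f) \<omega> = comollify c (fourier f) \<omega>"
    unfolding mollify_def[abs_def] comollify_def fourier_conv_heat[OF c0 r m, abs_def] .
qed

lemma comollify_tendsto:
  fixes f :: "'a::euclidean_space \<Rightarrow> complex"
  assumes f: "continuous_on UNIV f" and B: "\<And>x. norm (f x) \<le> B"
  shows "(\<lambda>n. comollify (real (Suc n)) f x) \<longlonglongrightarrow> f x"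
proof -
  have [measurable]: "f \<in> borel_measurable borel" using f by (rule borel_measurable_continuous_onI)
  let ?c = "\<lambda>n. real (Suc n)"
  let ?F = "\<lambda>n z. heat 1 z * (gauss (1 / ?c n) (x + (1 / sqrt (?c n)) *\<^sub>R z) * f (x + (1 / sqrt (?c n)) *\<^sub>R z))"
  have e: "comollify (?c n) f x = (LINT z|lborel. ?F n z)" for n
    unfolding comollify_def conv_def by (rule heat_average) auto
  have g0: "(\<lambda>n. 1 / ?c n) \<longlonglongrightarrow> 0"
    using LIMSEQ_inverse_real_of_nat unfolding inverse_eq_divide .
  have s0: "(\<lambda>n. 1 / sqrt (?c n)) \<longlonglongrightarrow> 0"
    using tendsto_real_sqrt[OF g0] unfolding real_sqrt_divide real_sqrt_one real_sqrt_zero .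
  have "(\<lambda>n. LINT z|lborel. ?F n z) \<longlonglongrightarrow> (LINT z::'a|lborel. heat 1 z * (1 * f x))"
  proof (rule integral_dominated_convergence[where w="\<lambda>z. norm (heat 1 z) * B"])
    show "AE z in lborel. (\<lambda>n. ?F n z) \<longlonglongrightarrow> heat 1 z * (1 * f x)"
    proof (rule AE_I2)
      fix z :: 'a
      have p: "(\<lambda>n. x + (1 / sqrt (?c n)) *\<^sub>R z) \<longlonglongrightarrow> x"
        using tendsto_add[OF tendsto_const tendsto_scaleR[OF s0 tendsto_const], of x z] by simp
      have "(\<lambda>n. exp (- (pi * (1 / ?c n) * ((x + (1 / sqrt (?c n)) *\<^sub>R z) \<bullet> (x + (1 / sqrt (?c n)) *\<^sub>R z)))))
          \<longlonglongrightarrow> exp (- (pi * 0 * (x \<bullet> x)))"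
        by (intro tendsto_intros p g0)
      then have "(\<lambda>n. gauss (1 / ?c n) (x + (1 / sqrt (?c n)) *\<^sub>R z)) \<longlonglongrightarrow> 1"
        unfolding gauss_def by (auto dest: tendsto_of_real[where 'a=complex])
      moreover have "(\<lambda>n. f (x + (1 / sqrt (?c n)) *\<^sub>R z)) \<longlonglongrightarrow> f x"
        by (rule continuous_on_tendsto_compose[OF f p]) auto
      ultimately show "(\<lambda>n. ?F n z) \<longlonglongrightarrow> heat 1 z * (1 * f x)" by (intro tendsto_intros)
    qed
    show "integrable lborel (\<lambda>z::'a. norm (heat 1 z) * B)"
      using integral_heat(1)[of 1, where 'a='a] by simp
    fix n
    show "AE z in lborel. norm (?F n z) \<le> norm (heat 1 z) * B"
    proof (rule AE_I2)
      fix z :: 'a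
      have "norm (gauss (1 / ?c n) (x + (1 / sqrt (?c n)) *\<^sub>R z) * f (x + (1 / sqrt (?c n)) *\<^sub>R z)) \<le> 1 * B"
        unfolding norm_mult by (intro mult_mono norm_gauss_le B) auto
      then show "norm (?F n z) \<le> norm (heat 1 z) * B"
        unfolding norm_mult[of "heat 1 z"] by (intro mult_left_mono) auto
    qed
  qed measurable
  moreover have "(LINT z::'a|lborel. heat 1 z) = 1"
    using arg_cong[OF fourier_heat[of 1], of "\<lambda>f. f (0::'a)"] by (simp add: fourier_def gauss_def)
  ultimately show ?thesis unfolding e by simp
qed

lemma mollify_adjoint:
  fixes u f :: "'a::euclidean_space \<Rightarrow> complex"
  assumes u: "tame u" and c: "0 < c" and f[measurable]: "f \<in> borel_measurable borel" and B: "\<And>x. norm (f x) \<le> B"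
  shows "(LINT x|lborel. mollify c u x * f x) = (LINT y|lborel. u y * comollify c f y)"
proof -
  have "rapid (\<lambda>x. gauss (1 / c) x * f x)"
    using c B by (intro rapid_mult_moderate rapid_gauss) (auto simp: moderate_def intro!: exI[of _ 0] exI[of _ B])
  from heat_adjoint[OF u c this]
  show ?thesis unfolding mollify_def comollify_def by (simp add: mult_ac)
qed

lemma schwartz_bounded:
  assumes "f \<in> schwartz" obtains B where "\<And>x. norm (f x) \<le> B"
  using schwartz_bound[OF assms, of 0] by auto

text \<open>The regularisation is moved to the test function, where the convergence is pointwise and dominated
uniformly in \<open>n\<close>.\<close>

lemma mollify_weak_limit:
  fixes u f :: "'a::euclidean_space \<Rightarrow> complex"
  assumes u: "tame u" and f: "f \<in> schwartz"
  shows "(\<lambda>n. LINT x|lborel. mollify (real (Suc n)) u x * f x) \<longlonglongrightarrow> (LINT x|lborel. u x * f x)"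
proof -
  have [measurable]: "u \<in> borel_measurable borel" by (rule tame_measurable[OF u])
  have mf[measurable]: "f \<in> borel_measurable borel" by (rule schwartz_measurable[OF f])
  obtain N where N: "integrable lborel (\<lambda>y. norm (u y) / (1 + norm y) ^ N)"
    using u by (auto simp: tame_def)
  obtain C where C: "C > 0" "\<And>x. norm (f x) \<le> C / (1 + norm x) ^ N" using schwartz_bound[OF f] by metis
  obtain K where K: "0 \<le> K"
    "\<And>c C (f::'a::euclidean_space \<Rightarrow> complex) x. 1 \<le> c \<Longrightarrow> 0 \<le> C \<Longrightarrow> (\<And>x. norm (f x) \<le> C / (1 + norm x) ^ N)
      \<Longrightarrow> norm (conv (heat c) f x) \<le> K * C / (1 + norm x) ^ N"
    by (rule conv_heat_decay[where N=N and 'a='a]) blast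
  obtain B where B: "\<And>x. norm (f x) \<le> B" using schwartz_bounded[OF f] by blast
  have b: "norm (comollify (real (Suc n)) f y) \<le> K * C / (1 + norm y) ^ N" for n y
    unfolding comollify_def
  proof (rule K(2))
    fix x :: 'a
    have "norm (gauss (1 / real (Suc n)) x * f x) \<le> 1 * (C / (1 + norm x) ^ N)"
      unfolding norm_mult by (intro mult_mono norm_gauss_le C) auto
    then show "norm (gauss (1 / real (Suc n)) x * f x) \<le> C / (1 + norm x) ^ N" by simp
  qed (use C in auto)
  have mc: "comollify (real (Suc n)) f \<in> borel_measurable borel" for n
    unfolding comollify_def
    by (intro slow_measurable slow_conv tame_gauss_mult schwartz_imp_tame f heat_schwartz) auto
  have "(\<lambda>n. LINT y|lborel. u y * comollify (real (Suc n)) f y) \<longlonglongrightarrow> (LINT y|lborel. u y * f y)"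
  proof (rule integral_dominated_convergence[where w="\<lambda>y. K * C * (norm (u y) / (1 + norm y) ^ N)"])
    show "AE y in lborel. (\<lambda>n. u y * comollify (real (Suc n)) f y) \<longlonglongrightarrow> u y * f y"
      by (intro AE_I2 tendsto_intros comollify_tendsto[OF schwartz_continuous[OF f] B])
    show "AE y in lborel. norm (u y * comollify (real (Suc n)) f y) \<le> K * C * (norm (u y) / (1 + norm y) ^ N)" for n
    proof (rule AE_I2)
      fix y
      show "norm (u y * comollify (real (Suc n)) f y) \<le> K * C * (norm (u y) / (1 + norm y) ^ N)"
        using mult_left_mono[OF b[of n y] norm_ge_zero[of "u y"]] by (simp add: norm_mult mult_ac)
    qed
    show "integrable lborel (\<lambda>y. K * C * (norm (u y) / (1 + norm y) ^ N))"
      by (intro integrable_mult_right N)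
    show "(\<lambda>y. u y * comollify (real (Suc n)) f y) \<in> borel_measurable lborel" for n
      using mc[of n] by simp
  qed measurable
  moreover have "(LINT x|lborel. mollify (real (Suc n)) u x * f x) = (LINT y|lborel. u y * comollify (real (Suc n)) f y)" for n
    by (rule mollify_adjoint[OF u _ mf B]) simp
  ultimately show ?thesis by simp
qed

lemma mollify_norm:
  fixes v :: "'a::euclidean_space \<Rightarrow> complex"
  assumes P: "1 \<le> P" and A: "0 \<le> A" and v[measurable]: "v \<in> borel_measurable borel"
  obtains K where "\<And>c. 1 \<le> c \<Longrightarrow>
      (\<integral>\<^sup>+x. ennreal (norm (mollify c v x) powr P * (1 + norm x) powr A) \<partial>lborel)
        \<le> ennreal K * (\<integral>\<^sup>+y. ennreal (norm (v y) powr P * (1 + norm y) powr A) \<partial>lborel)"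
    "\<And>c. 1 \<le> c \<Longrightarrow>
      (\<integral>\<^sup>+x. ennreal (norm (comollify c v x) powr P * (1 + norm x) powr A) \<partial>lborel)
        \<le> ennreal K * (\<integral>\<^sup>+y. ennreal (norm (v y) powr P * (1 + norm y) powr A) \<partial>lborel)"
proof -
  obtain K where K: "\<And>c (v::'a::euclidean_space \<Rightarrow> complex). 1 \<le> c \<Longrightarrow> v \<in> borel_measurable borel \<Longrightarrow>
    (\<integral>\<^sup>+x. ennreal (norm (conv (heat c) v x) powr P * (1 + norm x) powr A) \<partial>lborel)
      \<le> ennreal K * (\<integral>\<^sup>+y. ennreal (norm (v y) powr P * (1 + norm y) powr A) \<partial>lborel)"
    using P A by (rule conv_heat_norm[where 'a='a]) blast
  have g: "norm (gauss (1 / c) x * z) powr P * (1 + norm x) powr A \<le> norm z powr P * (1 + norm x) powr A"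
    if "1 \<le> c" for c z and x :: 'a
  proof -
    have "norm (gauss (1 / c) x * z) \<le> 1 * norm z"
      unfolding norm_mult by (intro mult_right_mono norm_gauss_le) (use that in auto)
    then show ?thesis using P by (intro mult_right_mono powr_mono2) auto
  qed
  have 1: "(\<integral>\<^sup>+x. ennreal (norm (mollify c v x) powr P * (1 + norm x) powr A) \<partial>lborel)
      \<le> ennreal K * (\<integral>\<^sup>+y. ennreal (norm (v y) powr P * (1 + norm y) powr A) \<partial>lborel)"
    if c: "1 \<le> c" for c
    unfolding mollify_def
    by (rule order_trans[OF nn_integral_mono K[OF c v]]) (rule ennreal_leI[OF g[OF c]])
  have 2: "(\<integral>\<^sup>+x. ennreal (norm (comollify c v x) powr P * (1 + norm x) powr A) \<partial>lborel)
      \<le> ennreal K * (\<integral>\<^sup>+y. ennreal (norm (v y) powr P * (1 + norm y) powr A) \<partial>lborel)"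
    if c: "1 \<le> c" for c
    unfolding comollify_def
  proof (rule order_trans[OF K[OF c] mult_left_mono[OF nn_integral_mono]])
    show "ennreal (norm (gauss (1 / c) x * v x) powr P * (1 + norm x) powr A)
        \<le> ennreal (norm (v x) powr P * (1 + norm x) powr A)" for x
      by (rule ennreal_leI[OF g[OF c]])
  qed auto
  show ?thesis using 1 2 by (rule that)
qed

section \<open>Functions determined by their pairings with Schwartz functions\<close>

text \<open>The sets over which the integral vanishes form a Dynkin system that contains the intersection-stable
generator of closed sets.\<close>

lemma integrable_zero_of_closed:
  fixes h :: "'a::euclidean_space \<Rightarrow> complex"
  assumes h: "integrable lborel h"
    and C: "\<And>C. closed C \<Longrightarrow> (LINT x:C|lborel. h x) = 0"
  shows "AE x in lborel. h x = 0"
proof (rule sigma_finite_measure.density_zero[OF sigma_finite_lborel h])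
  fix A :: "'a set" assume "A \<in> sets lborel"
  have sb: "sets (lborel :: 'a measure) = sigma_sets UNIV (Collect closed)"
    unfolding sets_lborel borel_eq_closed by (rule sets_measure_of) simp
  have A: "A \<in> sigma_sets UNIV (Collect closed)" using \<open>A \<in> sets lborel\<close> unfolding sb .
  have b: "B \<in> sets lborel" if "B \<in> sigma_sets UNIV (Collect closed)" for B :: "'a set"
    using that unfolding sb .
  have si: "set_integrable lborel B h" if "B \<in> sets lborel" for B
    unfolding set_integrable_def using that h by (intro integrable_mult_indicator) auto
  have u: "(LINT x:UNIV|lborel. h x) = 0" by (intro C) simp
  show "(LINT x:A|lborel. h x) = 0"
  proof (rule sigma_sets_induct_disjoint[OF _ _ A])
    show "Int_stable (Collect closed)" by (auto simp: Int_stable_def)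
    show "Collect closed \<subseteq> Pow UNIV" by simp
    show "(LINT x:B|lborel. h x) = 0" if "B \<in> Collect closed" for B :: "'a set" using that C by simp
    show "(LINT x:{}|lborel. h x) = 0" by (simp add: set_lebesgue_integral_def)
    show "(LINT x:UNIV - B|lborel. h x) = 0"
      if "B \<in> sigma_sets UNIV (Collect closed)" "(LINT x:B|lborel. h x) = 0" for B :: "'a set"
    proof -
      have "(LINT x:B \<union> (UNIV - B)|lborel. h x) = (LINT x:B|lborel. h x) + (LINT x:UNIV - B|lborel. h x)"
        using b[OF that(1)] by (intro set_integral_Un si) auto
      then show ?thesis using that(2) u by simp
    qed
    show "(LINT x:(\<Union>i::nat. B i)|lborel. h x) = 0"
      if "disjoint_family B" "range B \<subseteq> sigma_sets UNIV (Collect closed)" "\<And>i. (LINT x:B i|lborel. h x) = 0"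
      for B :: "nat \<Rightarrow> 'a set"
    proof -
      have "B i \<in> sets lborel" for i using b that(2) by blast
      then have "(LINT x:(\<Union>i. B i)|lborel. h x) = (\<Sum>i. (LINT x:B i|lborel. h x))"
        using that(1) by (intro lebesgue_integral_countable_add si) (auto simp: disjoint_family_on_def)
      then show ?thesis using that(3) by simp
    qed
  qed
qed

text \<open>The indicator of a closed set is the limit of continuous cut-offs of the distance to it.\<close>

lemma integrable_zero_of_continuous:
  fixes h :: "'a::euclidean_space \<Rightarrow> complex"
  assumes h: "integrable lborel h"
    and k: "\<And>k. continuous_on UNIV k \<Longrightarrow> (\<And>x. norm (k x) \<le> 1) \<Longrightarrow> (LINT x|lborel. h x * k x) = 0"
  shows "AE x in lborel. h x = 0"
proof (rule integrable_zero_of_closed[OF h])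
  fix C :: "'a set" assume C: "closed C"
  have [measurable]: "h \<in> borel_measurable borel" using borel_measurable_integrable[OF h] by simp
  show "(LINT x:C|lborel. h x) = 0"
  proof (cases "C = {}")
    case False
    define k where "k m x = complex_of_real (max 0 (1 - real m * infdist x C))" for m x
    have kc: "continuous_on UNIV (k m)" for m
      unfolding k_def by (intro continuous_intros)
    have k1: "norm (k m x) \<le> 1" for m x
      unfolding k_def by (simp add: infdist_nonneg)
    have kl: "(\<lambda>m. k m x) \<longlonglongrightarrow> indicator C x" for x
    proof (cases "x \<in> C")
      case True then show ?thesis by (simp add: k_def)
    next
      case False
      then have "infdist x C > 0" using C \<open>C \<noteq> {}\<close> by (metis infdist_pos_not_in_closed)
      then obtain n0 :: nat where n0: "1 < real n0 * infdist x C" using ex_less_of_nat_mult by blast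
      have "k m x = 0" if "m \<ge> n0" for m
      proof -
        have "real n0 * infdist x C \<le> real m * infdist x C"
          using that by (intro mult_right_mono) (auto simp: infdist_nonneg)
        then show ?thesis using n0 by (simp add: k_def)
      qed
      then have "(\<lambda>m. k m x) \<longlonglongrightarrow> 0" by (intro tendsto_eventually) (auto simp: eventually_sequentially)
      then show ?thesis using False by simp
    qed
    have "(\<lambda>m. LINT x|lborel. h x * k m x) \<longlonglongrightarrow> (LINT x|lborel. h x * indicator C x)"
    proof (rule integral_dominated_convergence[where w="\<lambda>x. norm (h x)"])
      show "AE x in lborel. (\<lambda>m. h x * k m x) \<longlonglongrightarrow> h x * indicator C x"
        by (intro AE_I2 tendsto_mult_left kl)
      show "AE x in lborel. norm (h x * k m x) \<le> norm (h x)" for m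
        using k1 by (intro AE_I2) (simp add: norm_mult mult_left_le)
      show "(\<lambda>x. h x * k m x) \<in> borel_measurable lborel" for m
        using borel_measurable_continuous_onI[OF kc[of m]] by simp
      show "(\<lambda>x. h x * indicator C x) \<in> borel_measurable lborel"
        using C by simp
    qed (use h in simp)
    then have "(LINT x|lborel. h x * indicator C x) = 0"
      using k[OF kc k1] by (simp add: LIMSEQ_const_iff)
    moreover have "h x * indicator C x = indicator C x *\<^sub>R h x" for x by (simp add: indicator_def)
    ultimately show ?thesis by (simp add: set_lebesgue_integral_def)
  qed (simp add: set_lebesgue_integral_def)
qed

text \<open>Damping \<open>D\<close> by a Gaussian makes it integrable.  The heat averages of the damped function are pairings of
\<open>D\<close> with Schwartz functions and vanish; approximating a bounded continuous function by its
regularisations then shows that the damped function is orthogonal to all such functions.\<close>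

lemma zero_of_schwartz_pairings:
  fixes D :: "'a::euclidean_space \<Rightarrow> complex"
  assumes m[measurable]: "D \<in> borel_measurable borel"
    and I: "\<And>\<phi>. \<phi> \<in> schwartz \<Longrightarrow> integrable lborel (\<lambda>x. D x * \<phi> x)"
    and Z: "\<And>\<phi>. \<phi> \<in> schwartz \<Longrightarrow> (LINT x|lborel. D x * \<phi> x) = 0"
  shows "AE x in lborel. D x = 0"
proof -
  let ?h = "\<lambda>x. D x * gauss 1 x"
  have h: "integrable lborel ?h" by (intro I gauss_schwartz) simp
  have tame: "tame ?h" unfolding tame_def using integrable_norm[OF h] by (auto intro!: exI[of _ 0])
  have c0: "conv (heat c) ?h y = 0" if "0 < c" for c y
  proof -
    have "(\<lambda>x. gauss 1 x * heat c (y - x)) \<in> schwartz"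
      using that by (intro schwartz_mult gauss_schwartz schwartz_reflect heat_schwartz) auto
    from Z[OF this] show ?thesis by (simp add: conv_def mult_ac)
  qed
  have "AE x in lborel. ?h x = 0"
  proof (rule integrable_zero_of_continuous[OF h])
    fix k :: "'a \<Rightarrow> complex" assume k: "continuous_on UNIV k" and k1: "\<And>x. norm (k x) \<le> 1"
    have [measurable]: "k \<in> borel_measurable borel" using k by (rule borel_measurable_continuous_onI)
    let ?c = "\<lambda>n. real (Suc n)"
    obtain K where K: "0 \<le> K"
      "\<And>c C (f::'a \<Rightarrow> complex) x. 1 \<le> c \<Longrightarrow> 0 \<le> C \<Longrightarrow> (\<And>x. norm (f x) \<le> C / (1 + norm x) ^ 0)
        \<Longrightarrow> norm (conv (heat c) f x) \<le> K * C / (1 + norm x) ^ 0"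
      by (rule conv_heat_decay[where N=0 and 'a='a]) blast
    have b: "norm (comollify (?c n) k x) \<le> K" for n x
    proof -
      have "norm (gauss (1 / ?c n) y * k y) \<le> 1" for y
        using mult_mono[OF norm_gauss_le k1, of "1 / ?c n" y] by (simp add: norm_mult)
      then show ?thesis using K(2)[of "?c n" 1 "\<lambda>y. gauss (1 / ?c n) y * k y" x] by (simp add: comollify_def)
    qed
    have mk: "comollify (?c n) k \<in> borel_measurable borel" for n
      unfolding comollify_def conv_def[abs_def] by measurable
    have "(\<lambda>n. LINT x|lborel. ?h x * comollify (?c n) k x) \<longlonglongrightarrow> (LINT x|lborel. ?h x * k x)"
    proof (rule integral_dominated_convergence[where w="\<lambda>x. K * norm (?h x)"])
      show "AE x in lborel. (\<lambda>n. ?h x * comollify (?c n) k x) \<longlonglongrightarrow> ?h x * k x"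
        by (intro AE_I2 tendsto_mult_left comollify_tendsto[OF k k1])
      show "AE x in lborel. norm (?h x * comollify (?c n) k x) \<le> K * norm (?h x)" for n
      proof (rule AE_I2)
        fix x show "norm (?h x * comollify (?c n) k x) \<le> K * norm (?h x)"
          unfolding norm_mult[of "?h x"] using mult_left_mono[OF b[of n x] norm_ge_zero[of "?h x"]]
          by (simp only: mult.commute)
      qed
      show "(\<lambda>x. ?h x * comollify (?c n) k x) \<in> borel_measurable lborel" for n
        using mk[of n] by simp
    qed (use h integrable_norm[OF h] in auto)
    moreover have "(LINT x|lborel. ?h x * comollify (?c n) k x) = 0" for n
      using mollify_adjoint[OF tame, of "?c n" k 1] k1 by (simp add: mollify_def c0)
    ultimately show "(LINT x|lborel. ?h x * k x) = 0" by (simp add: LIMSEQ_const_iff)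
  qed
  then show ?thesis by (auto simp: gauss_def)
qed

lemma represents_unique:
  assumes "represents F T" "represents G T"
  shows "AE x in lborel. F x = G x"
proof -
  have m: "F \<in> borel_measurable borel" "G \<in> borel_measurable borel"
    using assms by (auto simp: represents_def)
  have "AE x in lborel. F x - G x = 0"
  proof (rule zero_of_schwartz_pairings)
    fix \<phi> :: "'a \<Rightarrow> complex" assume \<phi>: "\<phi> \<in> schwartz"
    have I: "integrable lborel (\<lambda>x. F x * \<phi> x)" "integrable lborel (\<lambda>x. G x * \<phi> x)"
      and e: "(LINT x|lborel. F x * \<phi> x) = (LINT x|lborel. G x * \<phi> x)"
      using assms \<phi> by (auto simp: represents_def regdist_def)
    show "integrable lborel (\<lambda>x. (F x - G x) * \<phi> x)" using I by (simp add: left_diff_distrib)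
    show "(LINT x|lborel. (F x - G x) * \<phi> x) = 0" using I e by (simp add: left_diff_distrib)
  qed (use m in measurable)
  then show ?thesis by simp
qed

section \<open>The space of the variational problem\<close>

lemma epowr_less_top: "epowr x t < \<infinity> \<longleftrightarrow> x < \<infinity>"
  by (auto simp: epowr_def top.not_eq_extremum)

lemma epowr_ennreal: "0 \<le> x \<Longrightarrow> epowr (ennreal x) t = ennreal (x powr t)"
  by (simp add: epowr_def)

lemma epowr_mono: "x \<le> y \<Longrightarrow> 0 \<le> t \<Longrightarrow> epowr x t \<le> epowr y t"
  unfolding epowr_def by (auto intro!: ennreal_leI powr_mono2 enn2real_mono simp: top.not_eq_extremum top_unique)

lemma Lw_iff:
  "f \<in> Lw p a \<longleftrightarrow> f \<in> borel_measurable borel \<and>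
    (\<integral>\<^sup>+x. ennreal (norm (f x) powr p * (1 + norm x) powr (a * p)) \<partial>lborel) < \<infinity>"
  by (simp add: Lw_def wnorm_def epowr_less_top[unfolded infinity_ennreal_def])

lemma Lw_measurable: "f \<in> Lw p a \<Longrightarrow> f \<in> borel_measurable borel"
  by (simp add: Lw_iff)

lemma Lw_tame:
  assumes f: "f \<in> Lw p a" and p: "1 \<le> p" and a: "0 \<le> a"
  shows "tame (f :: 'a::euclidean_space \<Rightarrow> complex)"
proof -
  have [measurable]: "f \<in> borel_measurable borel" using Lw_measurable[OF f] .
  have I: "integrable lborel (\<lambda>x. norm (f x) powr p * (1 + norm x) powr (a * p))"
    using f by (intro integrableI_nonneg) (auto simp: Lw_iff)
  have "integrable lborel (\<lambda>x. norm (f x) / (1 + norm x) ^ (2 * DIM('a)))"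
  proof (rule Bochner_Integration.integrable_bound[OF Bochner_Integration.integrable_add[OF integrable_weight I]])
    show "AE x in lborel. norm (norm (f x) / (1 + norm x) ^ (2 * DIM('a)))
        \<le> norm (1 / (1 + norm x) ^ (2 * DIM('a)) + norm (f x) powr p * (1 + norm x) powr (a * p))"
    proof (rule AE_I2)
      fix x :: 'a
      let ?w = "(1 + norm x) ^ (2 * DIM('a))"
      have "norm (f x) / ?w \<le> (1 + norm (f x) powr p) / ?w"
        by (intro divide_right_mono le_one_plus_powr p) auto
      also have "\<dots> = 1 / ?w + norm (f x) powr p / ?w" by (rule add_divide_distrib)
      also have "norm (f x) powr p / ?w \<le> norm (f x) powr p * 1"
        using one_le_power[of "1 + norm x" "2 * DIM('a)"] by (simp add: divide_le_eq mult_le_cancel_left1)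
      also have "\<dots> \<le> norm (f x) powr p * (1 + norm x) powr (a * p)"
        using p a by (intro mult_left_mono ge_one_powr_ge_zero) auto
      finally show "norm (norm (f x) / ?w) \<le> norm (1 / ?w + norm (f x) powr p * (1 + norm x) powr (a * p))"
        by simp
    qed
  qed measurable
  then show ?thesis unfolding tame_def by auto
qed

lemma powr_add_le: "0 \<le> x \<Longrightarrow> 0 \<le> y \<Longrightarrow> 0 \<le> p \<Longrightarrow> (x + y) powr p \<le> 2 powr p * (x powr p + y powr p)" for x y p :: real
proof -
  assume *: "0 \<le> x" "0 \<le> y" "0 \<le> p"
  have "(x + y) powr p \<le> (2 * max x y) powr p" using * by (intro powr_mono2) auto
  also have "\<dots> = 2 powr p * max x y powr p" using * by (simp add: powr_mult)
  also have "max x y powr p \<le> x powr p + y powr p" by (simp add: max_def)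
  finally show ?thesis by simp
qed

lemma Lw_lin:
  assumes f: "f \<in> Lw p a" and g: "g \<in> Lw p a" and p: "0 \<le> p"
  shows "(\<lambda>x. f x + c * g x) \<in> Lw p a"
proof -
  have [measurable]: "f \<in> borel_measurable borel" "g \<in> borel_measurable borel" using Lw_measurable f g by auto
  have "(\<integral>\<^sup>+x. ennreal (norm (f x + c * g x) powr p * (1 + norm x) powr (a * p)) \<partial>lborel)
      \<le> (\<integral>\<^sup>+x. ennreal (2 powr p) * ennreal (norm (f x) powr p * (1 + norm x) powr (a * p))
          + ennreal (2 powr p * norm c powr p) * ennreal (norm (g x) powr p * (1 + norm x) powr (a * p)) \<partial>lborel)"
  proof (intro nn_integral_mono)
    fix x
    have "norm (f x + c * g x) powr p \<le> (norm (f x) + norm c * norm (g x)) powr p"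
      using norm_triangle_ineq[of "f x" "c * g x"] p by (intro powr_mono2) (auto simp: norm_mult)
    also have "\<dots> \<le> 2 powr p * (norm (f x) powr p + norm c powr p * norm (g x) powr p)"
      using powr_add_le[of "norm (f x)" "norm c * norm (g x)" p] p by (simp add: powr_mult)
    finally have "norm (f x + c * g x) powr p * (1 + norm x) powr (a * p)
        \<le> 2 powr p * (norm (f x) powr p + norm c powr p * norm (g x) powr p) * (1 + norm x) powr (a * p)"
      by (rule mult_right_mono) simp
    then show "ennreal (norm (f x + c * g x) powr p * (1 + norm x) powr (a * p))
        \<le> ennreal (2 powr p) * ennreal (norm (f x) powr p * (1 + norm x) powr (a * p))
          + ennreal (2 powr p * norm c powr p) * ennreal (norm (g x) powr p * (1 + norm x) powr (a * p))"
      by (simp add: ennreal_mult[symmetric] ennreal_plus[symmetric] ennreal_leI algebra_simps del: ennreal_plus)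
  qed
  also have "\<dots> < \<infinity>"
    using f g by (simp add: nn_integral_add nn_integral_cmult Lw_iff ennreal_mult_eq_top_iff less_top[symmetric])
  finally show ?thesis by (simp add: Lw_iff)
qed

lemma schwartz_norm_ge:
  assumes "\<phi> \<in> schwartz"
  shows "(1 + norm x) ^ N * norm (\<phi> x) \<le> schwartz_norm N \<phi>"
proof -
  let ?I = "{is::'a list. set is \<subseteq> Basis \<and> length is \<le> N}"
  let ?S = "\<lambda>is. SUP x. (1 + norm x) ^ N * norm (iter_deriv is \<phi> x)"
  have bdd: "bdd_above (range (\<lambda>x. (1 + norm x) ^ N * norm (iter_deriv is \<phi> x)))" if "is \<in> ?I" for "is"
  proof -
    have "rapid (iter_deriv is \<phi>)" using assms that by (auto simp: schwartz_eq smooth_with_def)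
    then show ?thesis by (auto simp: rapid_def bdd_above_def)
  qed
  have le: "(1 + norm x) ^ N * norm (iter_deriv is \<phi> x) \<le> ?S is" if "is \<in> ?I" for "is" x
    by (rule cSUP_upper[OF UNIV_I bdd[OF that]])
  have nn: "0 \<le> ?S is" if "is \<in> ?I" for "is"
    using le[OF that, of 0] by (rule order_trans[rotated]) simp
  have "finite ?I" by (rule finite_lists_length_le) simp
  moreover have "[] \<in> ?I" by simp
  ultimately have "?S [] \<le> sum ?S ?I" using nn by (intro member_le_sum) auto
  then show ?thesis unfolding schwartz_norm_def using le[of "[]" x] by simp
qed

lemma tame_tempered:
  assumes u: "tame u" shows "tempered (regdist u)"
  unfolding tempered_def
proof (intro conjI ballI allI)
  fix \<phi> \<psi> :: "'a \<Rightarrow> complex" assume "\<phi> \<in> schwartz" "\<psi> \<in> schwartz"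
  then show "regdist u (\<lambda>x. \<phi> x + \<psi> x) = regdist u \<phi> + regdist u \<psi>"
    using tame_integrable[OF u] by (simp add: regdist_def distrib_left)
next
  fix c and \<phi> :: "'a \<Rightarrow> complex"
  show "regdist u (\<lambda>x. c * \<phi> x) = c * regdist u \<phi>"
    unfolding regdist_def integral_mult_right_zero[symmetric] by (simp add: mult_ac)
next
  obtain N where N: "integrable lborel (\<lambda>y. norm (u y) / (1 + norm y) ^ N)"
    using u by (auto simp: tame_def)
  show "\<exists>C N. \<forall>\<phi>\<in>schwartz. norm (regdist u \<phi>) \<le> C * schwartz_norm N \<phi>"
  proof (intro exI ballI)
    fix \<phi> :: "'a \<Rightarrow> complex" assume \<phi>: "\<phi> \<in> schwartz"
    have "norm (regdist u \<phi>) \<le> (LINT y|lborel. schwartz_norm N \<phi> * (norm (u y) / (1 + norm y) ^ N))"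
      unfolding regdist_def
    proof (rule norm_integral_le[OF integrable_mult_right[OF N]])
      fix y :: 'a
      have "norm (\<phi> y) \<le> schwartz_norm N \<phi> / (1 + norm y) ^ N"
        using schwartz_norm_ge[OF \<phi>, of y N] by (simp add: pos_le_divide_eq mult.commute)
      from mult_left_mono[OF this norm_ge_zero[of "u y"]]
      show "norm (u y * \<phi> y) \<le> schwartz_norm N \<phi> * (norm (u y) / (1 + norm y) ^ N)"
        by (simp add: norm_mult mult_ac)
    qed
    also have "\<dots> = (LINT y|lborel. norm (u y) / (1 + norm y) ^ N) * schwartz_norm N \<phi>"
      unfolding integral_mult_right_zero by (rule mult.commute)
    finally show "norm (regdist u \<phi>) \<le> (LINT y|lborel. norm (u y) / (1 + norm y) ^ N) * schwartz_norm N \<phi>" .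
  qed
qed

lemma fourier_measurable [measurable]:
  assumes [measurable]: "f \<in> borel_measurable borel"
  shows "fourier f \<in> borel_measurable borel"
  unfolding fourier_def[abs_def] by measurable

lemma fourier_rapid:
  assumes "f \<in> schwartz" shows "rapid (fourier f)"
proof (rule rapidI)
  fix N
  obtain C where "C \<ge> 0" "\<And>\<omega>. norm (fourier f \<omega>) \<le> C / (1 + norm \<omega>) ^ N"
    by (rule fourier_schwartz_bound[OF assms, where M=N]) blast
  then show "\<exists>C. \<forall>x. norm (fourier f x) \<le> C / (1 + norm x) ^ N" by blast
qed

lemma tame_fourier_integrable:
  "tame u \<Longrightarrow> \<phi> \<in> schwartz \<Longrightarrow> integrable lborel (\<lambda>y. u y * fourier \<phi> y)"
  by (intro tame_rapid_integrable fourier_rapid fourier_measurable schwartz_measurable)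

lemma represents_lin:
  assumes u: "tame u" and v: "tame v"
    and F: "represents F (fourier_dist (regdist u))" and G: "represents G (fourier_dist (regdist v))"
  shows "represents (\<lambda>x. F x + c * G x) (fourier_dist (regdist (\<lambda>x. u x + c * v x)))"
proof -
  have [measurable]: "F \<in> borel_measurable borel" "G \<in> borel_measurable borel"
    using F G by (auto simp: represents_def)
  show ?thesis unfolding represents_def
  proof (intro conjI ballI)
    show "(\<lambda>x. F x + c * G x) \<in> borel_measurable lborel" by measurable
    fix \<phi> :: "'a \<Rightarrow> complex" assume \<phi>: "\<phi> \<in> schwartz"
    have I: "integrable lborel (\<lambda>x. F x * \<phi> x)" "integrable lborel (\<lambda>x. G x * \<phi> x)"
      and e: "(LINT x|lborel. u x * fourier \<phi> x) = (LINT x|lborel. F x * \<phi> x)"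
        "(LINT x|lborel. v x * fourier \<phi> x) = (LINT x|lborel. G x * \<phi> x)"
      using F G \<phi> by (auto simp: represents_def regdist_def fourier_dist_def)
    show "integrable lborel (\<lambda>x. (F x + c * G x) * \<phi> x)"
      using I by (simp add: distrib_right mult.assoc)
    have "fourier_dist (regdist (\<lambda>x. u x + c * v x)) \<phi>
        = (LINT x|lborel. u x * fourier \<phi> x + c * (v x * fourier \<phi> x))"
      by (simp add: fourier_dist_def regdist_def distrib_right mult.assoc)
    also have "\<dots> = (LINT x|lborel. F x * \<phi> x + c * (G x * \<phi> x))"
      using I e tame_fourier_integrable[OF u \<phi>] tame_fourier_integrable[OF v \<phi>] by simp
    finally show "fourier_dist (regdist (\<lambda>x. u x + c * v x)) \<phi> = regdist (\<lambda>x. F x + c * G x) \<phi>"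
      by (simp add: regdist_def distrib_right mult.assoc)
  qed
qed

text \<open>The regularisation of \<open>u\<close> passes to the Fourier transform of the test function, hence as the dual
regularisation to the test function itself, and from there to \<open>F\<close>.\<close>

lemma represents_mollify:
  assumes u: "tame u" and tF: "tame F" and F: "represents F (fourier_dist (regdist u))" and c: "1 \<le> c"
  shows "represents (comollify c F) (fourier_dist (regdist (mollify c u)))"
  unfolding represents_def
proof (intro conjI ballI)
  have c0: "0 < c" using c by simp
  have slow: "comollify c F \<in> slow"
    unfolding comollify_def using c0 by (intro slow_conv tame_gauss_mult tF heat_schwartz) auto
  then show "comollify c F \<in> borel_measurable lborel" using slow_measurable by simp
  fix \<phi> :: "'a \<Rightarrow> complex" assume \<phi>: "\<phi> \<in> schwartz"
  show "integrable lborel (\<lambda>x. comollify c F x * \<phi> x)"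
    using schwartz_integrable[OF schwartz_mult_slow[OF \<phi> slow]] by (simp add: mult.commute)
  obtain B where B: "\<And>x. norm (fourier \<phi> x) \<le> B"
    by (rule fourier_schwartz_bound[OF \<phi>, where M=0]) auto
  have "fourier_dist (regdist (mollify c u)) \<phi> = (LINT x|lborel. mollify c u x * fourier \<phi> x)"
    by (simp add: fourier_dist_def regdist_def)
  also have "\<dots> = (LINT y|lborel. u y * comollify c (fourier \<phi>) y)"
    by (rule mollify_adjoint[OF u c0 _ B]) (intro fourier_measurable schwartz_measurable \<phi>)
  also have "\<dots> = (LINT y|lborel. u y * fourier (mollify c \<phi>) y)"
    unfolding fourier_mollify[OF c \<phi>] ..
  also have "\<dots> = (LINT y|lborel. F y * mollify c \<phi> y)"
    using F mollify_schwartz[OF schwartz_imp_tame[OF \<phi>] c0]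
    by (auto simp: represents_def fourier_dist_def regdist_def)
  also have "\<dots> = (LINT y|lborel. (gauss (1 / c) y * F y) * conv (heat c) \<phi> y)"
    by (simp add: mollify_def mult_ac)
  also have "\<dots> = (LINT x|lborel. \<phi> x * comollify c F x)"
    unfolding comollify_def
    using c0 by (intro heat_adjoint[symmetric] tame_gauss_mult tF schwartz_rapid schwartz_measurable \<phi>) auto
  finally show "fourier_dist (regdist (mollify c u)) \<phi> = regdist (comollify c F) \<phi>"
    by (simp add: regdist_def mult.commute)
qed

text \<open>The function \<open>fhat u\<close> is some representative chosen by definition; as representatives agree almost
everywhere, it has the norm of the one that witnesses membership.\<close>

lemma Lw_FLwD:
  assumes u: "u \<in> Lw_FLw p a q b"
  shows Lw_FLw_Lw: "u \<in> Lw p a"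
    and represents_fhat: "represents (fhat u) (fourier_dist (regdist u))"
    and fhat_Lw: "fhat u \<in> Lw q b"
proof -
  show "u \<in> Lw p a" using u by (simp add: Lw_FLw_def)
  obtain F where F: "F \<in> Lw q b" "represents F (fourier_dist (regdist u))"
    using u by (auto simp: Lw_FLw_def FLw_def)
  show r: "represents (fhat u) (fourier_dist (regdist u))"
    unfolding fhat_def dist_fun_def using F(2) by (rule someI[where P="\<lambda>F. represents F (fourier_dist (regdist u))"])
  then have ae: "AE x in lborel. fhat u x = F x" using F(2) by (rule represents_unique)
  have [measurable]: "fhat u \<in> borel_measurable borel" "F \<in> borel_measurable borel"
    using r F(2) by (auto simp: represents_def)
  have "(\<integral>\<^sup>+x. ennreal (norm (fhat u x) powr q * (1 + norm x) powr (b * q)) \<partial>lborel)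
      = (\<integral>\<^sup>+x. ennreal (norm (F x) powr q * (1 + norm x) powr (b * q)) \<partial>lborel)"
    by (rule nn_integral_cong_AE) (use ae in eventually_elim, simp)
  then show "fhat u \<in> Lw q b" using F(1) by (simp add: Lw_iff)
qed

lemma Lw_FLwI:
  assumes "u \<in> Lw p a" "F \<in> Lw q b" "represents F (fourier_dist (regdist u))" "1 \<le> p" "0 \<le> a"
  shows "u \<in> Lw_FLw p a q b" and "AE x in lborel. fhat u x = F x"
proof -
  show u: "u \<in> Lw_FLw p a q b"
    using assms Lw_tame tame_tempered by (auto simp: Lw_FLw_def FLw_def)
  show "AE x in lborel. fhat u x = F x"
    using represents_fhat[OF u] assms(3) by (rule represents_unique)
qed

lemma
  assumes u: "u \<in> Lw_FLw p a q b" and v: "v \<in> Lw_FLw p a q b" and "1 \<le> p" "0 \<le> a" "1 \<le> q"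
  shows Lw_FLw_lin: "(\<lambda>x. u x + c * v x) \<in> Lw_FLw p a q b"
    and fhat_lin: "AE x in lborel. fhat (\<lambda>x. u x + c * v x) x = fhat u x + c * fhat v x"
proof -
  have t: "tame u" "tame v" using Lw_tame[OF Lw_FLw_Lw] u v assms(3,4) by blast+
  have 1: "(\<lambda>x. u x + c * v x) \<in> Lw p a"
    using assms by (intro Lw_lin Lw_FLw_Lw[OF u] Lw_FLw_Lw[OF v]) simp
  have 2: "(\<lambda>x. fhat u x + c * fhat v x) \<in> Lw q b"
    using assms by (intro Lw_lin fhat_Lw[OF u] fhat_Lw[OF v]) simp
  note R = Lw_FLwI[OF 1 2 represents_lin[OF t represents_fhat[OF u] represents_fhat[OF v]] assms(3,4)]
  show "(\<lambda>x. u x + c * v x) \<in> Lw_FLw p a q b"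
    "AE x in lborel. fhat (\<lambda>x. u x + c * v x) x = fhat u x + c * fhat v x"
    by (rule R)+
qed

lemma
  assumes u: "u \<in> Lw_FLw p a q b" and p: "1 \<le> p" and a: "0 \<le> a" and q: "1 \<le> q" and b: "0 \<le> b" and c: "1 \<le> c"
  shows mollify_Lw_FLw: "mollify c u \<in> Lw_FLw p a q b"
    and fhat_mollify: "AE x in lborel. fhat (mollify c u) x = comollify c (fhat u) x"
proof -
  note uL = Lw_FLw_Lw[OF u] and FL = fhat_Lw[OF u]
  have tu: "tame u" using uL p a by (rule Lw_tame)
  have tF: "tame (fhat u)" using FL q b by (rule Lw_tame)
  have [measurable]: "u \<in> borel_measurable borel" "fhat u \<in> borel_measurable borel"
    using tu tF tame_measurable by auto
  have c0: "0 < c" using c by simp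
  have ap: "0 \<le> a * p" "0 \<le> b * q" using p a q b by auto
  have m: "u \<in> borel_measurable borel" "fhat u \<in> borel_measurable borel" by measurable
  obtain K where K: "(\<integral>\<^sup>+x. ennreal (norm (mollify c u x) powr p * (1 + norm x) powr (a * p)) \<partial>lborel)
        \<le> ennreal K * (\<integral>\<^sup>+y. ennreal (norm (u y) powr p * (1 + norm y) powr (a * p)) \<partial>lborel)"
    by (rule mollify_norm[OF p ap(1) m(1)]) (use c in blast)
  obtain K' where K': "(\<integral>\<^sup>+x. ennreal (norm (comollify c (fhat u) x) powr q * (1 + norm x) powr (b * q)) \<partial>lborel)
        \<le> ennreal K' * (\<integral>\<^sup>+y. ennreal (norm (fhat u y) powr q * (1 + norm y) powr (b * q)) \<partial>lborel)"
    by (rule mollify_norm[OF q ap(2) m(2)]) (use c in blast)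
  have 1: "mollify c u \<in> Lw p a"
    using schwartz_measurable[OF mollify_schwartz[OF tu c0]] order.strict_trans1[OF K] uL
    by (simp add: Lw_iff ennreal_mult_less_top)
  have "comollify c (fhat u) \<in> slow"
    unfolding comollify_def using c0 by (intro slow_conv tame_gauss_mult tF heat_schwartz) auto
  then have 2: "comollify c (fhat u) \<in> Lw q b"
    using slow_measurable order.strict_trans1[OF K'] FL
    by (simp add: Lw_iff ennreal_mult_less_top)
  have 3: "represents (comollify c (fhat u)) (fourier_dist (regdist (mollify c u)))"
    by (rule represents_mollify[OF tu tF represents_fhat[OF u] c])
  show "mollify c u \<in> Lw_FLw p a q b" "AE x in lborel. fhat (mollify c u) x = comollify c (fhat u) x"
    using Lw_FLwI[OF 1 2 3 p a] by auto
qed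

lemma Lnorm_le_wnorm:
  assumes "0 < p" "0 \<le> a"
  shows "Lnorm p (\<lambda>x. norm x powr a *\<^sub>R f x) \<le> wnorm p a f"
  unfolding wnorm_def
proof (intro epowr_mono nn_integral_mono ennreal_leI)
  fix x :: 'a
  have "norm (norm x powr a *\<^sub>R f x) powr p = norm (f x) powr p * norm x powr (a * p)"
    by (simp add: powr_mult powr_powr mult.commute)
  also have "\<dots> \<le> norm (f x) powr p * (1 + norm x) powr (a * p)"
    using assms by (intro mult_left_mono powr_mono2) auto
  finally show "norm (norm x powr a *\<^sub>R f x) powr p * (1 + norm x) powr (0 * p) \<le> norm (f x) powr p * (1 + norm x) powr (a * p)"
    by simp
qed (use assms in simp)

lemma uncertainty_functional_mollify_bounded:
  assumes u: "u \<in> Lw_FLw p a q b" and p: "1 \<le> p" and a: "0 \<le> a" and q: "1 \<le> q" and b: "0 \<le> b"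
  obtains K where "K < \<infinity>" "\<And>c. 1 \<le> c \<Longrightarrow> uncertainty_functional p a q b (mollify c u) \<le> K"
proof -
  note uL = Lw_FLw_Lw[OF u] and FL = fhat_Lw[OF u]
  have m: "u \<in> borel_measurable borel" "fhat u \<in> borel_measurable borel"
    using uL FL Lw_measurable by auto
  have ap: "0 \<le> a * p" "0 \<le> b * q" using p a q b by auto
  define U where "U = (\<integral>\<^sup>+y. ennreal (norm (u y) powr p * (1 + norm y) powr (a * p)) \<partial>lborel)"
  define V where "V = (\<integral>\<^sup>+y. ennreal (norm (fhat u y) powr q * (1 + norm y) powr (b * q)) \<partial>lborel)"
  obtain K where K: "\<And>c. 1 \<le> c \<Longrightarrow> (\<integral>\<^sup>+x. ennreal (norm (mollify c u x) powr p * (1 + norm x) powr (a * p)) \<partial>lborel) \<le> ennreal K * U"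
    unfolding U_def by (rule mollify_norm[OF p ap(1) m(1)]) blast
  obtain K' where K': "\<And>c. 1 \<le> c \<Longrightarrow> (\<integral>\<^sup>+x. ennreal (norm (comollify c (fhat u) x) powr q * (1 + norm x) powr (b * q)) \<partial>lborel) \<le> ennreal K' * V"
    unfolding V_def by (rule mollify_norm[OF q ap(2) m(2)]) blast
  show ?thesis
  proof (rule that)
    show "epowr (ennreal K * U) (1 / p) + epowr (ennreal K' * V) (1 / q) < \<infinity>"
      using uL FL by (simp add: epowr_less_top[unfolded infinity_ennreal_def] Lw_iff U_def V_def ennreal_mult_less_top)
    fix c :: real assume c: "1 \<le> c"
    have "Lnorm p (\<lambda>x. norm x powr a *\<^sub>R mollify c u x) \<le> wnorm p a (mollify c u)"
      using p a by (intro Lnorm_le_wnorm) auto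
    also have "\<dots> \<le> epowr (ennreal K * U) (1 / p)"
      unfolding wnorm_def using K[OF c] p by (intro epowr_mono) auto
    finally have 1: "Lnorm p (\<lambda>x. norm x powr a *\<^sub>R mollify c u x) \<le> epowr (ennreal K * U) (1 / p)" .
    have "Lnorm q (\<lambda>x. norm x powr b *\<^sub>R fhat (mollify c u) x) \<le> wnorm q b (fhat (mollify c u))"
      using q b by (intro Lnorm_le_wnorm) auto
    also have "\<dots> = wnorm q b (comollify c (fhat u))"
    proof -
      have "(\<integral>\<^sup>+x. ennreal (norm (fhat (mollify c u) x) powr q * (1 + norm x) powr (b * q)) \<partial>lborel)
          = (\<integral>\<^sup>+x. ennreal (norm (comollify c (fhat u) x) powr q * (1 + norm x) powr (b * q)) \<partial>lborel)"
        by (rule nn_integral_cong_AE) (use fhat_mollify[OF u p a q b c] in eventually_elim, simp)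
      then show ?thesis by (simp add: wnorm_def)
    qed
    also have "\<dots> \<le> epowr (ennreal K' * V) (1 / q)"
      unfolding wnorm_def using K'[OF c] q by (intro epowr_mono) auto
    finally show "uncertainty_functional p a q b (mollify c u) \<le> epowr (ennreal K * U) (1 / p) + epowr (ennreal K' * V) (1 / q)"
      unfolding uncertainty_functional_def using 1 by (rule add_mono[rotated])
  qed
qed

text \<open>Translates of the heat kernel are Fourier transforms of Schwartz functions.  Consequently, a function whose
distributional Fourier transform vanishes has vanishing heat averages.\<close>

lemma fourier_modulated_gauss:
  assumes "0 < c"
  shows "fourier (\<lambda>t. gauss (1 / c) t * wave (- x) t) = (\<lambda>\<omega>. heat c (x - \<omega>))"
proof
  fix \<omega>
  have "fourier (\<lambda>t. gauss (1 / c) t * wave (- x) t) \<omega> = fourier (gauss (1 / c)) (\<omega> - x)"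
    unfolding fourier_def by (simp add: mult.assoc cis_mult inner_diff_right right_diff_distrib add.commute)
  then show "fourier (\<lambda>t. gauss (1 / c) t * wave (- x) t) \<omega> = heat c (x - \<omega>)"
    using assms fourier_gauss[of "1 / c", where 'a='a] heat_even(2)[of c x \<omega>] by simp
qed

lemma fhat_zero_imp_pairings_zero:
  assumes u: "tame u" and F: "represents F (fourier_dist (regdist u))" and Z: "AE x in lborel. F x = 0"
    and \<phi>: "\<phi> \<in> schwartz"
  shows "(LINT x|lborel. u x * \<phi> x) = 0"
proof -
  have z: "(LINT x|lborel. u x * fourier \<psi> x) = 0" if "\<psi> \<in> schwartz" for \<psi>
  proof -
    have "(LINT x|lborel. u x * fourier \<psi> x) = (LINT x|lborel. F x * \<psi> x)"
      using F that by (auto simp: represents_def fourier_dist_def regdist_def)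
    also have "\<dots> = 0" by (rule integral_eq_zero_AE) (use Z in eventually_elim, simp)
    finally show ?thesis .
  qed
  have "conv (heat c) u x = 0" if "0 < c" for c x
  proof -
    have "(\<lambda>t. gauss (1 / c) t * wave (- x) t) \<in> schwartz"
      using that by (intro schwartz_wave gauss_schwartz) simp
    from z[OF this] show ?thesis
      unfolding fourier_modulated_gauss[OF that] conv_def by (simp only: mult.commute)
  qed
  then have "mollify (real (Suc n)) u x = 0" for n x by (simp add: mollify_def)
  then show ?thesis using mollify_weak_limit[OF u \<phi>] by (simp add: LIMSEQ_const_iff)
qed

section \<open>The short-time Fourier transform\<close>

lemma stft_atom_schwartz:
  assumes "g \<in> schwartz" shows "(\<lambda>t. cnj (g (t - x)) * wave \<omega> t) \<in> schwartz"
  by (intro schwartz_wave schwartz_translate[OF schwartz_cnj] assms)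

lemma stft_eq_pairing: "stft g u x \<omega> = (LINT t|lborel. u t * (cnj (g (t - x)) * wave \<omega> t))"
  by (simp add: stft_dist_def regdist_def)

lemma stft_lin:
  assumes g: "g \<in> schwartz" and u: "tame u" and v: "tame v"
  shows "stft g (\<lambda>t. u t + c * v t) x \<omega> = stft g u x \<omega> + c * stft g v x \<omega>"
  unfolding stft_eq_pairing
  using tame_integrable[OF u stft_atom_schwartz[OF g]] tame_integrable[OF v stft_atom_schwartz[OF g]]
  by (simp add: distrib_right mult.assoc)

lemma stft_measurable:
  assumes "g \<in> schwartz" and [measurable]: "u \<in> borel_measurable borel"
  shows "(\<lambda>z. stft g u (fst z) (snd z)) \<in> borel_measurable (borel \<Otimes>\<^sub>M borel)"
proof -
  define k where "k t = cnj (g t)" for t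
  have [measurable]: "k \<in> borel_measurable borel"
    unfolding k_def by (rule schwartz_measurable[OF schwartz_cnj[OF assms(1)]])
  show ?thesis unfolding stft_eq_pairing k_def[symmetric] by measurable
qed

lemma stft_mollify_tendsto:
  assumes "g \<in> schwartz" "tame u"
  shows "(\<lambda>n. stft g (mollify (real (Suc n)) u) x \<omega>) \<longlonglongrightarrow> stft g u x \<omega>"
  unfolding stft_eq_pairing by (rule mollify_weak_limit[OF assms(2) stft_atom_schwartz[OF assms(1)]])

text \<open>Products of a function with a window sliding along \<open>x\<close>, closed under differentiation in the
variable \<open>t\<close> of integration.\<close>

inductive_set window_products :: "('a::euclidean_space \<Rightarrow> 'a \<Rightarrow> complex) set" where
  mult: "v \<in> schwartz \<Longrightarrow> w \<in> schwartz \<Longrightarrow> (\<lambda>x t. v t * w (t - x)) \<in> window_products"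
| add: "h \<in> window_products \<Longrightarrow> k \<in> window_products \<Longrightarrow> (\<lambda>x t. h x t + k x t) \<in> window_products"

lemma window_productsD:
  fixes h :: "'a::euclidean_space \<Rightarrow> 'a \<Rightarrow> complex"
  assumes "h \<in> window_products"
  shows "(\<forall>x. h x \<in> schwartz) \<and> (\<forall>i\<in>Basis. (\<lambda>x. partial_deriv i (h x)) \<in> window_products)
    \<and> (\<exists>C\<ge>0. \<forall>x t. norm (h x t) \<le> C * (1 / (1 + norm x) ^ N) / (1 + norm t) ^ M)"
  using assms
proof induction
  case (mult v w)
  have d: "v differentiable (at t)" "(\<lambda>t. w (t - x)) differentiable (at t)" for t x
    using mult schwartz_differentiable schwartz_translate by blast+
  have e: "(\<lambda>x. partial_deriv i (\<lambda>t. v t * w (t - x)))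
      = (\<lambda>x t. partial_deriv i v t * w (t - x) + v t * partial_deriv i w (t - x))" for i
    using partial_deriv_mult[OF d(1) d(2)] partial_deriv_translate[of w i] schwartz_differentiable[OF mult(2)] by simp
  obtain C where C: "C > 0" "\<And>t. norm (v t) \<le> C / (1 + norm t) ^ (M + N)"
    by (rule schwartz_bound[OF mult(1), where N="M + N"]) blast
  obtain D where D: "D > 0" "\<And>t. norm (w t) \<le> D / (1 + norm t) ^ N"
    by (rule schwartz_bound[OF mult(2), where N=N]) blast
  have "norm (v t * w (t - x)) \<le> (C * D) * (1 / (1 + norm x) ^ N) / (1 + norm t) ^ M" for x t
  proof -
    have "norm (v t * w (t - x)) \<le> C / (1 + norm t) ^ (M + N) * (D / (1 + norm (t - x)) ^ N)"
      unfolding norm_mult using C D by (intro mult_mono) auto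
    also have "\<dots> = C / (1 + norm t) ^ (M + N) * D * (1 / (1 + norm (t - x)) ^ N)" by simp
    also have "\<dots> \<le> C / (1 + norm t) ^ (M + N) * D * ((1 + norm t) ^ N / (1 + norm x) ^ N)"
      using C(1) D(1) by (intro mult_left_mono inverse_weight_submult) auto
    also have "\<dots> = (C * D) * (1 / (1 + norm x) ^ N) / (1 + norm t) ^ M"
      by (simp add: power_add)
    finally show ?thesis .
  qed
  moreover have "0 \<le> C * D" using C D by simp
  ultimately have "\<exists>C\<ge>0. \<forall>x t. norm (v t * w (t - x)) \<le> C * (1 / (1 + norm x) ^ N) / (1 + norm t) ^ M" by blast
  moreover have "\<forall>x. (\<lambda>t. v t * w (t - x)) \<in> schwartz"
    using mult by (intro allI schwartz_mult schwartz_translate)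
  moreover have "\<forall>i\<in>Basis. (\<lambda>x. partial_deriv i (\<lambda>t. v t * w (t - x))) \<in> window_products"
    unfolding e using mult by (intro ballI window_products.intros schwartz_partial)
  ultimately show ?case by (intro conjI)
next
  case (add h k)
  obtain C where C: "C \<ge> 0" "\<And>x t. norm (h x t) \<le> C * (1 / (1 + norm x) ^ N) / (1 + norm t) ^ M" using add.IH(1) by blast
  obtain D where D: "D \<ge> 0" "\<And>x t. norm (k x t) \<le> D * (1 / (1 + norm x) ^ N) / (1 + norm t) ^ M" using add.IH(2) by blast
  have "norm (h x t + k x t) \<le> (C + D) * (1 / (1 + norm x) ^ N) / (1 + norm t) ^ M" for x t
    using norm_triangle_le[OF add_mono[OF C(2)[of x t] D(2)[of x t]]] by (simp add: distrib_right add_divide_distrib)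
  moreover have "0 \<le> C + D" using C D by simp
  ultimately have "\<exists>C\<ge>0. \<forall>x t. norm (h x t + k x t) \<le> C * (1 / (1 + norm x) ^ N) / (1 + norm t) ^ M" by blast
  moreover have "(\<lambda>x. partial_deriv i (\<lambda>t. h x t + k x t)) = (\<lambda>x t. partial_deriv i (h x) t + partial_deriv i (k x) t)" for i
    using partial_deriv_add[OF schwartz_differentiable schwartz_differentiable] add.IH by blast
  ultimately show ?case using add.IH
    by (intro conjI allI ballI) (auto intro: schwartz_add window_products.add)
qed

lemma stft_schwartz_decay:
  fixes g v :: "'a::euclidean_space \<Rightarrow> complex"
  assumes g: "g \<in> schwartz" and v: "v \<in> schwartz"
  obtains C where "C \<ge> 0" "\<And>x \<omega>. norm (stft g v x \<omega>) \<le> C / ((1 + norm x) ^ N * (1 + norm \<omega>) ^ M)"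
proof -
  let ?h = "\<lambda>x t. v t * (\<lambda>t. cnj (g t)) (t - x)"
  have "\<exists>C\<ge>0. \<forall>x \<omega>. norm (fourier (?h x) \<omega>) \<le> C * (1 / (1 + norm x) ^ N) / (1 + norm \<omega>) ^ M"
  proof (rule fourier_family_decay[where P=window_products])
    show "?h \<in> window_products" by (rule window_products.mult[OF v schwartz_cnj[OF g]])
    fix h :: "'a \<Rightarrow> 'a \<Rightarrow> complex" assume h: "h \<in> window_products"
    show "h x \<in> schwartz" "i \<in> Basis \<Longrightarrow> (\<lambda>x. partial_deriv i (h x)) \<in> window_products"
      "\<exists>C\<ge>0. \<forall>x t. norm (h x t) \<le> C * (1 / (1 + norm x) ^ N) / (1 + norm t) ^ (2 * DIM('a))" for x i
      using window_productsD[OF h, of N "2 * DIM('a)"] by blast+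
  qed simp
  then obtain C where C: "C \<ge> 0" "\<And>x \<omega>. norm (fourier (?h x) \<omega>) \<le> C * (1 / (1 + norm x) ^ N) / (1 + norm \<omega>) ^ M"
    by blast
  have "stft g v x \<omega> = fourier (?h x) \<omega>" for x \<omega>
    by (simp add: stft_eq fourier_def)
  then show ?thesis using C by (intro that[of C]) auto
qed

lemma mod_norm_schwartz_finite:
  fixes g v :: "'a::euclidean_space \<Rightarrow> complex"
  assumes g: "g \<in> schwartz" and v: "v \<in> schwartz" and r: "1 \<le> r" and s: "1 \<le> s"
  shows "mod_norm g r s \<alpha> \<beta> (regdist v) < \<infinity>"
proof -
  let ?d = "2 * DIM('a)"
  \<comment> \<open>This decay absorbs the weights and leaves an integrable power of \<open>1 + norm\<close> in either variable.\<close>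
  define N where "N = nat \<lceil>\<alpha>\<rceil> + ?d"
  define M where "M = nat \<lceil>\<beta>\<rceil> + ?d"
  obtain C where C: "C \<ge> 0" "\<And>x \<omega>. norm (stft g v x \<omega>) \<le> C / ((1 + norm x) ^ N * (1 + norm \<omega>) ^ M)"
    by (rule stft_schwartz_decay[OF g v, where N=N and M=M]) blast
  have wt: "1 / (1 + norm z) ^ (nat \<lceil>\<gamma>\<rceil> + ?d) * (1 + norm z) powr \<gamma> \<le> 1 / (1 + norm z) ^ ?d" for \<gamma> and z :: 'a
  proof -
    have "(1 + norm z) powr \<gamma> \<le> (1 + norm z) powr real (nat \<lceil>\<gamma>\<rceil>)"
      by (intro powr_mono real_nat_ceiling_ge) auto
    then have "(1 + norm z) powr \<gamma> \<le> (1 + norm z) ^ nat \<lceil>\<gamma>\<rceil>" by (simp add: powr_realpow)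
    then have "1 / (1 + norm z) ^ (nat \<lceil>\<gamma>\<rceil> + ?d) * (1 + norm z) powr \<gamma> \<le> 1 / (1 + norm z) ^ (nat \<lceil>\<gamma>\<rceil> + ?d) * (1 + norm z) ^ nat \<lceil>\<gamma>\<rceil>"
      by (intro mult_left_mono) auto
    then show ?thesis by (simp add: power_add)
  qed
  have pw: "(A / (1 + norm z) ^ ?d) powr P \<le> A powr P * (1 / (1 + norm z) ^ ?d)" if "0 \<le> A" "1 \<le> P" for A P and z :: 'a
  proof -
    let ?y = "1 / (1 + norm z) ^ ?d"
    have "?y powr P \<le> ?y powr 1" using that by (intro powr_mono') auto
    then have "A powr P * ?y powr P \<le> A powr P * ?y" by (intro mult_left_mono) auto
    moreover have "(A / (1 + norm z) ^ ?d) powr P = A powr P * ?y powr P"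
      by (subst powr_mult[symmetric]) simp
    ultimately show ?thesis by simp
  qed
  define K where "K = (LINT z::'a|lborel. 1 / (1 + norm z) ^ ?d)"
  have K0: "0 \<le> K" unfolding K_def by (intro Bochner_Integration.integral_nonneg) auto
  have K: "(\<integral>\<^sup>+z. ennreal (1 / (1 + norm (z::'a)) ^ ?d) \<partial>lborel) = ennreal K"
    unfolding K_def by (rule nn_integral_eq_integral[OF integrable_weight]) auto
  have inner: "wnorm r \<alpha> (\<lambda>x. stft g v x \<omega>) \<le> ennreal (C / (1 + norm \<omega>) ^ M * K powr (1 / r))" for \<omega>
  proof -
    let ?A = "C / (1 + norm \<omega>) ^ M"
    have A0: "0 \<le> ?A" using C(1) by simp
    have "(\<integral>\<^sup>+x. ennreal (norm (stft g v x \<omega>) powr r * (1 + norm x) powr (\<alpha> * r)) \<partial>lborel)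
        \<le> (\<integral>\<^sup>+x. ennreal (?A powr r) * ennreal (1 / (1 + norm (x::'a)) ^ ?d) \<partial>lborel)"
    proof (intro nn_integral_mono)
      fix x :: 'a
      have "norm (stft g v x \<omega>) * (1 + norm x) powr \<alpha> \<le> ?A * (1 / (1 + norm x) ^ N * (1 + norm x) powr \<alpha>)"
        using mult_right_mono[OF C(2)[of x \<omega>], of "(1 + norm x) powr \<alpha>"] by (simp add: mult_ac)
      also have "\<dots> \<le> ?A * (1 / (1 + norm x) ^ ?d)"
        unfolding N_def by (intro mult_left_mono wt A0)
      finally have "norm (stft g v x \<omega>) * (1 + norm x) powr \<alpha> \<le> ?A / (1 + norm x) ^ ?d" by simp
      then have "(norm (stft g v x \<omega>) * (1 + norm x) powr \<alpha>) powr r \<le> (?A / (1 + norm x) ^ ?d) powr r"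
        using r by (intro powr_mono2) auto
      also have "\<dots> \<le> ?A powr r * (1 / (1 + norm x) ^ ?d)" by (rule pw[OF A0 r])
      finally show "ennreal (norm (stft g v x \<omega>) powr r * (1 + norm x) powr (\<alpha> * r))
          \<le> ennreal (?A powr r) * ennreal (1 / (1 + norm x) ^ ?d)"
        by (simp add: powr_mult powr_powr ennreal_mult[symmetric] ennreal_leI)
    qed
    also have "\<dots> = ennreal (?A powr r * K)"
      by (subst nn_integral_cmult) (use K K0 in \<open>simp_all add: ennreal_mult\<close>)
    finally have "wnorm r \<alpha> (\<lambda>x. stft g v x \<omega>) \<le> epowr (ennreal (?A powr r * K)) (1 / r)"
      unfolding wnorm_def using r by (intro epowr_mono) auto
    also have "\<dots> = ennreal (?A * K powr (1 / r))"
    proof -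
      have "(?A powr r * K) powr (1 / r) = ?A * K powr (1 / r)"
        unfolding powr_mult powr_powr using r A0 by (simp del: divide_divide_eq_left abs_divide)
      then show ?thesis using K0 by (subst epowr_ennreal) auto
    qed
    finally show ?thesis by simp
  qed
  define L where "L = C * K powr (1 / r)"
  have L0: "0 \<le> L" unfolding L_def using C(1) by simp
  have "(\<integral>\<^sup>+\<omega>. epowr (wnorm r \<alpha> (\<lambda>x. stft g v x \<omega>)) s * ennreal ((1 + norm \<omega>) powr (\<beta> * s)) \<partial>lborel)
      \<le> (\<integral>\<^sup>+\<omega>. ennreal (L powr s) * ennreal (1 / (1 + norm (\<omega>::'a)) ^ ?d) \<partial>lborel)"
  proof (intro nn_integral_mono)
    fix \<omega> :: 'a
    have "epowr (wnorm r \<alpha> (\<lambda>x. stft g v x \<omega>)) s \<le> ennreal ((C / (1 + norm \<omega>) ^ M * K powr (1 / r)) powr s)"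
      using epowr_mono[OF inner[of \<omega>], of s] s C(1) by (simp add: epowr_ennreal)
    then have "epowr (wnorm r \<alpha> (\<lambda>x. stft g v x \<omega>)) s * ennreal ((1 + norm \<omega>) powr (\<beta> * s))
        \<le> ennreal ((C / (1 + norm \<omega>) ^ M * K powr (1 / r)) powr s) * ennreal ((1 + norm \<omega>) powr (\<beta> * s))"
      by (rule mult_right_mono) simp
    also have "\<dots> = ennreal ((L * (1 / (1 + norm \<omega>) ^ M * (1 + norm \<omega>) powr \<beta>)) powr s)"
    proof -
      have "L * (1 / (1 + norm \<omega>) ^ M * (1 + norm \<omega>) powr \<beta>)
          = (C / (1 + norm \<omega>) ^ M * K powr (1 / r)) * (1 + norm \<omega>) powr \<beta>" by (simp add: L_def)
      moreover have "(Y * (1 + norm \<omega>) powr \<beta>) powr s = Y powr s * (1 + norm \<omega>) powr (\<beta> * s)" for Y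
        by (simp only: powr_mult powr_powr)
      ultimately show ?thesis by (simp only: ennreal_mult powr_ge_zero)
    qed
    also have "\<dots> \<le> ennreal ((L / (1 + norm \<omega>) ^ ?d) powr s)"
    proof -
      have "L * (1 / (1 + norm \<omega>) ^ M * (1 + norm \<omega>) powr \<beta>) \<le> L * (1 / (1 + norm \<omega>) ^ ?d)"
        unfolding M_def by (intro mult_left_mono wt L0)
      then show ?thesis using s L0 by (intro ennreal_leI powr_mono2) auto
    qed
    also have "\<dots> \<le> ennreal (L powr s * (1 / (1 + norm \<omega>) ^ ?d))" by (intro ennreal_leI pw L0 s)
    also have "\<dots> = ennreal (L powr s) * ennreal (1 / (1 + norm \<omega>) ^ ?d)" by (rule ennreal_mult) auto
    finally show "epowr (wnorm r \<alpha> (\<lambda>x. stft g v x \<omega>)) s * ennreal ((1 + norm \<omega>) powr (\<beta> * s))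
        \<le> ennreal (L powr s) * ennreal (1 / (1 + norm \<omega>) ^ ?d)" .
  qed
  also have "\<dots> < \<infinity>"
    by (subst nn_integral_cmult) (use K in \<open>simp_all add: ennreal_mult_less_top\<close>)
  finally show ?thesis unfolding mod_norm_def epowr_less_top .
qed

section \<open>Differentiating integrals of convex functions\<close>

text \<open>The slopes of a convex function at \<open>0\<close> lie between those of its chords to \<open>-1\<close> and to \<open>1\<close>.\<close>

lemma convex_quotient_bound:
  fixes \<phi> :: "real \<Rightarrow> real"
  assumes c: "convex_on UNIV \<phi>" and h: "h \<noteq> 0" "\<bar>h\<bar> \<le> 1"
  shows "\<bar>(\<phi> h - \<phi> 0) / h\<bar> \<le> \<bar>\<phi> 1 - \<phi> 0\<bar> + \<bar>\<phi> (-1) - \<phi> 0\<bar>"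
proof -
  have *: "\<bar>(\<psi> k - \<psi> 0) / k\<bar> \<le> \<bar>\<psi> 1 - \<psi> 0\<bar> + \<bar>\<psi> (-1) - \<psi> 0\<bar>"
    if c: "convex_on UNIV \<psi>" and k: "0 < k" "k \<le> 1" for \<psi> :: "real \<Rightarrow> real" and k
  proof -
    have "\<psi> ((1 - k) *\<^sub>R 0 + k *\<^sub>R 1) \<le> (1 - k) * \<psi> 0 + k * \<psi> 1"
      by (rule convex_onD[OF c]) (use k in auto)
    then have "\<psi> k - \<psi> 0 \<le> k * (\<psi> 1 - \<psi> 0)" by (simp add: algebra_simps)
    then have 1: "(\<psi> k - \<psi> 0) / k \<le> \<psi> 1 - \<psi> 0" using k by (simp add: pos_divide_le_eq mult.commute)
    let ?\<theta> = "1 / (1 + k)"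
    have e: "(1 - ?\<theta>) *\<^sub>R (-1) + ?\<theta> *\<^sub>R k = 0" using k by (simp add: field_simps)
    have "\<psi> ((1 - ?\<theta>) *\<^sub>R (-1) + ?\<theta> *\<^sub>R k) \<le> (1 - ?\<theta>) * \<psi> (-1) + ?\<theta> * \<psi> k"
      by (rule convex_onD[OF c]) (use k in auto)
    moreover have "(1 - ?\<theta>) * \<psi> (-1) + ?\<theta> * \<psi> k = (k * \<psi> (-1) + \<psi> k) / (1 + k)"
    proof -
      have "1 - ?\<theta> = k / (1 + k)" using k by (simp add: field_simps)
      then show ?thesis by (simp only: add_divide_distrib) simp
    qed
    ultimately have "\<psi> 0 \<le> (k * \<psi> (-1) + \<psi> k) / (1 + k)" unfolding e by simp
    then have "\<psi> 0 * (1 + k) \<le> k * \<psi> (-1) + \<psi> k" using k by (simp add: pos_le_divide_eq)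
    then have "k * (\<psi> 0 - \<psi> (-1)) \<le> \<psi> k - \<psi> 0" by (simp add: algebra_simps)
    then have 2: "\<psi> 0 - \<psi> (-1) \<le> (\<psi> k - \<psi> 0) / k" using k by (simp add: pos_le_divide_eq mult.commute)
    show ?thesis using 1 2 by linarith
  qed
  show ?thesis
  proof (cases "h > 0")
    case True then show ?thesis using *[OF c, of h] h by simp
  next
    case False
    have "convex_on UNIV (\<lambda>t. \<phi> (- t))"
    proof (rule convex_onI)
      fix t x y :: real assume "0 < t" "t < 1"
      then show "\<phi> (- ((1 - t) *\<^sub>R x + t *\<^sub>R y)) \<le> (1 - t) * \<phi> (- x) + t * \<phi> (- y)"
        using convex_onD[OF c, of t "- x" "- y"] by simp
    qed simp
    from *[OF this, of "- h"] show ?thesis using h False by (simp add: add.commute)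
  qed
qed

text \<open>The chords of the previous lemma give an integrable majorant of all difference quotients.\<close>

lemma integral_convex_derivative:
  fixes \<phi> :: "'b \<Rightarrow> real \<Rightarrow> real"
  assumes I: "\<And>t. integrable M (\<lambda>x. \<phi> x t)" and m[measurable]: "D \<in> borel_measurable M"
    and conv: "AE x in M. convex_on UNIV (\<phi> x)"
    and D: "AE x in M. (\<phi> x has_real_derivative D x) (at 0)"
  shows "((\<lambda>t. LINT x|M. \<phi> x t) has_real_derivative (LINT x|M. D x)) (at 0)"
proof -
  let ?w = "\<lambda>x. \<bar>\<phi> x 1 - \<phi> x 0\<bar> + \<bar>\<phi> x (-1) - \<phi> x 0\<bar>"
  let ?q = "\<lambda>h x. (\<phi> x h - \<phi> x 0) / h"
  have wI: "integrable M ?w" using I by (intro Bochner_Integration.integrable_add integrable_abs Bochner_Integration.integrable_diff)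
  have lim: "AE x in M. (\<lambda>n. ?q (X n) x) \<longlonglongrightarrow> D x" if X: "\<And>n::nat. X n \<in> {-1<..<1} - {0}" "X \<longlonglongrightarrow> 0" for X
    using D
  proof eventually_elim
    case (elim x)
    then have "((\<lambda>h. ?q h x) \<longlongrightarrow> D x) (at 0)" by (simp add: has_field_derivative_iff)
    moreover have "filterlim X (at 0) sequentially" using X by (auto simp: filterlim_at)
    ultimately show ?case by (rule filterlim_compose)
  qed
  have bnd: "AE x in M. norm (?q h x) \<le> ?w x" if "h \<in> {-1<..<1} - {0}" for h
    using conv by eventually_elim (use convex_quotient_bound that in auto)
  have qm: "?q h \<in> borel_measurable M" for h
    using I by (intro borel_measurable_divide borel_measurable_diff) auto
  have "((\<lambda>h. LINT x|M. ?q h x) \<longlongrightarrow> (LINT x|M. D x)) (at 0 within {-1<..<1})"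
    unfolding tendsto_at_iff_sequentially comp_def
  proof (intro allI impI)
    fix X :: "nat \<Rightarrow> real" assume X: "\<forall>i. X i \<in> {-1<..<1} - {0}" "X \<longlonglongrightarrow> 0"
    show "(\<lambda>n. LINT x|M. ?q (X n) x) \<longlonglongrightarrow> (LINT x|M. D x)"
      by (rule integral_dominated_convergence[OF m qm wI lim bnd]) (use X in auto)
  qed
  moreover have at0: "(at (0::real) within {-1<..<1}) = at 0" by (intro at_within_open) auto
  moreover have eq: "(LINT x|M. ?q h x) = ((LINT x|M. \<phi> x h) - (LINT x|M. \<phi> x 0)) / h" for h
    unfolding integral_divide_zero using I by simp
  ultimately have "((\<lambda>h. ((LINT x|M. \<phi> x h) - (LINT x|M. \<phi> x 0)) / h) \<longlongrightarrow> (LINT x|M. D x)) (at 0)"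
    by (simp only: at0 eq)
  then show "((\<lambda>t. LINT x|M. \<phi> x t) has_real_derivative (LINT x|M. D x)) (at 0)"
    by (simp add: has_field_derivative_iff)
qed

section \<open>Weighted Lebesgue norms along a line\<close>

lemma powr_convex_nonneg:
  fixes x y :: real
  assumes "1 \<le> p" "0 \<le> x" "0 \<le> y" "0 \<le> \<theta>" "\<theta> \<le> 1"
  shows "((1 - \<theta>) * x + \<theta> * y) powr p \<le> (1 - \<theta>) * x powr p + \<theta> * y powr p"
proof (cases "(1 - \<theta>) * x + \<theta> * y = 0")
  case True then show ?thesis using assms by simp
next
  case False
  define m where "m = (1 - \<theta>) * x + \<theta> * y"
  have "0 \<le> m" unfolding m_def using assms by (intro add_nonneg_nonneg mult_nonneg_nonneg) auto
  then have m: "0 < m" using False by (simp add: m_def)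
  let ?k = "p * m powr (p - 1)"
  have "(1 - \<theta>) * (m powr p + ?k * (x - m)) + \<theta> * (m powr p + ?k * (y - m)) \<le> (1 - \<theta>) * x powr p + \<theta> * y powr p"
    using assms m by (intro add_mono mult_left_mono powr_tangent) auto
  moreover have "(1 - \<theta>) * (m powr p + ?k * (x - m)) + \<theta> * (m powr p + ?k * (y - m))
      = m powr p + ?k * (((1 - \<theta>) * x + \<theta> * y) - m)" by (simp add: algebra_simps)
  ultimately show ?thesis by (simp add: m_def)
qed

lemma convex_on_powr:
  assumes c: "convex_on UNIV n" and n: "\<And>t. 0 \<le> n t" and p: "1 \<le> p"
  shows "convex_on UNIV (\<lambda>t::real. n t powr p)"
proof (rule convex_onI)
  fix t x y :: real assume t: "0 < t" "t < 1"
  have "n ((1 - t) *\<^sub>R x + t *\<^sub>R y) powr p \<le> ((1 - t) * n x + t * n y) powr p"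
    using convex_onD[OF c, of t x y] t n p by (intro powr_mono2) auto
  also have "\<dots> \<le> (1 - t) * n x powr p + t * n y powr p"
    using t n p by (intro powr_convex_nonneg) auto
  finally show "n ((1 - t) *\<^sub>R x + t *\<^sub>R y) powr p \<le> (1 - t) * n x powr p + t * n y powr p" .
qed simp

lemma convex_on_norm_line: "convex_on UNIV (\<lambda>t::real. norm (z + of_real t * w :: complex))"
proof (rule convex_onI)
  fix t x y :: real assume t: "0 < t" "t < 1"
  have "z + of_real ((1 - t) *\<^sub>R x + t *\<^sub>R y) * w
      = of_real (1 - t) * (z + of_real x * w) + of_real t * (z + of_real y * w)" by (simp add: algebra_simps)
  also have "norm \<dots> \<le> norm (of_real (1 - t) * (z + of_real x * w)) + norm (of_real t * (z + of_real y * w))"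
    by (rule norm_triangle_ineq)
  also have "\<dots> = (1 - t) * norm (z + of_real x * w) + t * norm (z + of_real y * w)"
    unfolding norm_mult norm_of_real using t by simp
  finally show "norm (z + of_real ((1 - t) *\<^sub>R x + t *\<^sub>R y) * w)
      \<le> (1 - t) * norm (z + of_real x * w) + t * norm (z + of_real y * w)" .
qed simp

text \<open>The derivative at a zero of the function, where the exponent \<open>p > 1\<close> is essential.\<close>

lemma abs_powr_has_derivative_0:
  assumes p: "1 < p"
  shows "((\<lambda>t::real. \<bar>t\<bar> powr p * k) has_real_derivative 0) (at 0)"
  unfolding has_field_derivative_iff
proof (rule Lim_null_comparison)
  show "((\<lambda>h::real. \<bar>h\<bar> powr (p - 1) * \<bar>k\<bar>) \<longlongrightarrow> 0) (at 0)"
  proof -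
    have "((\<lambda>h::real. \<bar>h\<bar> powr (p - 1)) \<longlongrightarrow> 0 powr (p - 1)) (at 0)"
      using p by (intro tendsto_powr2 tendsto_rabs_zero tendsto_ident_at tendsto_const) (auto intro!: always_eventually)
    from tendsto_mult_left_zero[of _ _ "\<bar>k\<bar>"] this show ?thesis using p by simp
  qed
  have "norm ((\<bar>0 + h\<bar> powr p * k - \<bar>0::real\<bar> powr p * k) / h) = \<bar>h\<bar> powr (p - 1) * \<bar>k\<bar>" if "h \<noteq> 0" for h :: real
    using that by (simp add: abs_mult powr_diff)
  then show "\<forall>\<^sub>F h in at 0. norm ((\<bar>h\<bar> powr p * k - \<bar>0::real\<bar> powr p * k) / (h - 0)) \<le> \<bar>h\<bar> powr (p - 1) * \<bar>k\<bar>"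
    by (auto simp: eventually_at_filter)
qed

lemma norm_powr_line_derivative:
  assumes p: "1 < p"
  shows "((\<lambda>t::real. norm (z + of_real t * w :: complex) powr p) has_real_derivative
    p * (norm z powr (p - 2) * Re (z * cnj w))) (at 0)"
proof (cases "z = 0")
  case True
  then show ?thesis using abs_powr_has_derivative_0[OF p, of "norm w powr p"] p by (simp add: norm_mult powr_mult)
next
  case False
  have e: "norm (z + of_real t * w) powr p = ((norm z)\<^sup>2 + 2 * t * Re (z * cnj w) + t\<^sup>2 * (norm w)\<^sup>2) powr (p / 2)" for t
  proof -
    have "(norm (z + of_real t * w))\<^sup>2 = (norm z)\<^sup>2 + 2 * t * Re (z * cnj w) + t\<^sup>2 * (norm w)\<^sup>2"
      unfolding cmod_power2 by (simp add: power2_eq_square algebra_simps)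
    moreover have "((norm (z + of_real t * w))\<^sup>2) powr (p / 2) = norm (z + of_real t * w) powr p"
      by (cases "z + of_real t * w = 0") (simp_all add: powr_powr flip: powr_numeral)
    ultimately show ?thesis by simp
  qed
  have pos: "(norm z)\<^sup>2 > 0" using False by simp
  from pos have "((\<lambda>t::real. ((norm z)\<^sup>2 + 2 * t * Re (z * cnj w) + t\<^sup>2 * (norm w)\<^sup>2) powr (p / 2)) has_real_derivative
      (p / 2) * (norm z)\<^sup>2 powr (p / 2 - 1) * (2 * Re (z * cnj w))) (at 0)"
    by (auto intro!: derivative_eq_intros)
  note D = this
  have pe: "(norm z)\<^sup>2 powr (p / 2 - 1) = norm z powr (p - 2)"
  proof -
    have "(norm z powr 2) powr (p / 2 - 1) = norm z powr (p - 2)"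
      unfolding powr_powr by (simp add: algebra_simps)
    moreover have "(norm z)\<^sup>2 = norm z powr 2" using False by simp
    ultimately show ?thesis by (simp only:)
  qed
  show ?thesis unfolding e by (rule DERIV_cong[OF D[unfolded pe]]) (simp add: algebra_simps)
qed

lemma mult_powr_le:
  fixes x y s :: real
  assumes "0 \<le> x" "0 \<le> y" "1 < s"
  shows "x powr (s - 1) * y \<le> x powr s + y powr s"
proof -
  have "x powr (s - 1) * y \<le> max x y powr (s - 1) * max x y"
    using assms by (intro mult_mono powr_mono2) auto
  also have "\<dots> = max x y powr s"
    using powr_add[of "max x y" "s - 1" 1] assms by (simp add: max_def split: if_splits)
  also have "\<dots> \<le> x powr s + y powr s" by (simp add: max_def)
  finally show ?thesis .
qed

text \<open>The weight is kept apart from the measure, so that the formulas below match the integrands of the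
Euler--Lagrange equation literally.\<close>

definition wint :: "'b measure \<Rightarrow> ('b \<Rightarrow> real) \<Rightarrow> real \<Rightarrow> ('b \<Rightarrow> complex) \<Rightarrow> real"
  where "wint M w p f = (LINT x|M. w x * norm (f x) powr p)"

definition wfin :: "'b measure \<Rightarrow> ('b \<Rightarrow> real) \<Rightarrow> real \<Rightarrow> ('b \<Rightarrow> complex) \<Rightarrow> bool"
  where "wfin M w p f \<longleftrightarrow> f \<in> borel_measurable M \<and> integrable M (\<lambda>x. w x * norm (f x) powr p)"

locale nonneg_weight =
  fixes M :: "'b measure" and w :: "'b \<Rightarrow> real"
  assumes w_measurable [measurable]: "w \<in> borel_measurable M" and w_nonneg: "0 \<le> w x"
begin

abbreviation "nrm p f \<equiv> wint M w p f powr (1 / p)"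

lemma wint_nonneg: "0 \<le> wint M w p f"
  unfolding wint_def using w_nonneg by (intro Bochner_Integration.integral_nonneg) auto

lemma wfin_lin:
  assumes p: "0 \<le> p" and f: "wfin M w p f" and g: "wfin M w p g"
  shows "wfin M w p (\<lambda>x. f x + c * g x)"
proof -
  have [measurable]: "f \<in> borel_measurable M" "g \<in> borel_measurable M" using f g by (auto simp: wfin_def)
  let ?b = "\<lambda>x. 2 powr p * (w x * norm (f x) powr p) + (2 powr p * norm c powr p) * (w x * norm (g x) powr p)"
  have "integrable M (\<lambda>x. w x * norm (f x + c * g x) powr p)"
  proof (rule Bochner_Integration.integrable_bound)
    show "integrable M ?b" using f g unfolding wfin_def by (intro Bochner_Integration.integrable_add integrable_mult_right) auto
    show "AE x in M. norm (w x * norm (f x + c * g x) powr p) \<le> norm (?b x)"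
    proof (rule AE_I2)
      fix x
      have "norm (f x + c * g x) powr p \<le> (norm (f x) + norm c * norm (g x)) powr p"
        using norm_triangle_ineq[of "f x" "c * g x"] p by (intro powr_mono2) (auto simp: norm_mult)
      also have "\<dots> \<le> 2 powr p * (norm (f x) powr p + norm c powr p * norm (g x) powr p)"
        using powr_add_le[of "norm (f x)" "norm c * norm (g x)" p] p by (simp add: powr_mult)
      finally have "w x * norm (f x + c * g x) powr p \<le> w x * (2 powr p * (norm (f x) powr p + norm c powr p * norm (g x) powr p))"
        using w_nonneg by (rule mult_left_mono)
      also have "\<dots> = ?b x" by (simp add: algebra_simps)
      finally show "norm (w x * norm (f x + c * g x) powr p) \<le> norm (?b x)" using w_nonneg by simp
    qed
  qed measurable
  then show ?thesis by (simp add: wfin_def)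
qed

lemma wint_scale: "wint M w p (\<lambda>x. c * f x) = norm c powr p * wint M w p f"
  unfolding wint_def integral_mult_right_zero[symmetric] by (simp add: norm_mult powr_mult mult_ac)

lemma nrm_scale: "0 < p \<Longrightarrow> nrm p (\<lambda>x. c * f x) = norm c * nrm p f"
  unfolding wint_scale by (simp add: powr_mult powr_powr)

text \<open>Minkowski's inequality as convexity of the unit ball: \<open>f + g\<close> is \<open>A + B\<close> times a convex combination of
\<open>f / A\<close> and \<open>g / B\<close>.  Bounds \<open>A\<close> and \<open>B\<close> slightly larger than the norms avoid the division
by zero.\<close>

lemma nrm_triangle:
  assumes p: "1 \<le> p" and f: "wfin M w p f" and g: "wfin M w p g"
  shows "nrm p (\<lambda>x. f x + g x) \<le> nrm p f + nrm p g"
proof (rule field_le_epsilon)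
  fix e :: real assume e: "0 < e"
  define A where "A = nrm p f + e / 2"
  define B where "B = nrm p g + e / 2"
  have A: "A > 0" "wint M w p f \<le> A powr p" and B: "B > 0" "wint M w p g \<le> B powr p"
  proof -
    have *: "0 < nrm p h + e / 2" "wint M w p h \<le> (nrm p h + e / 2) powr p" for h
    proof -
      show "0 < nrm p h + e / 2" using e by (simp add: add_nonneg_pos)
      have "wint M w p h = nrm p h powr p" using p wint_nonneg by (simp add: powr_powr)
      also have "\<dots> \<le> (nrm p h + e / 2) powr p" using e p by (intro powr_mono2) auto
      finally show "wint M w p h \<le> (nrm p h + e / 2) powr p" .
    qed
    show "A > 0" "wint M w p f \<le> A powr p" "B > 0" "wint M w p g \<le> B powr p"
      unfolding A_def B_def by (rule *)+
  qed
  define \<theta> where "\<theta> = B / (A + B)"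
  have \<theta>: "0 \<le> \<theta>" "\<theta> \<le> 1" "1 - \<theta> = A / (A + B)" using A B by (auto simp: \<theta>_def field_simps)
  let ?S = "(A + B) powr p"
  have pt: "w x * norm (f x + g x) powr p
      \<le> ?S * ((1 - \<theta>) / A powr p * (w x * norm (f x) powr p) + \<theta> / B powr p * (w x * norm (g x) powr p))" for x
  proof -
    have "norm (f x + g x) \<le> (A + B) * ((1 - \<theta>) * (norm (f x) / A) + \<theta> * (norm (g x) / B))"
      using norm_triangle_ineq[of "f x" "g x"] A B unfolding \<theta>(3) by (simp add: \<theta>_def distrib_left)
    then have "norm (f x + g x) powr p \<le> ((A + B) * ((1 - \<theta>) * (norm (f x) / A) + \<theta> * (norm (g x) / B))) powr p"
      using p by (intro powr_mono2) auto
    also have "\<dots> = ?S * ((1 - \<theta>) * (norm (f x) / A) + \<theta> * (norm (g x) / B)) powr p" by (rule powr_mult)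
    also have "\<dots> \<le> ?S * ((1 - \<theta>) * (norm (f x) / A) powr p + \<theta> * (norm (g x) / B) powr p)"
      using \<theta> A B p by (intro mult_left_mono powr_convex_nonneg) auto
    also have "\<dots> = ?S * ((1 - \<theta>) / A powr p * norm (f x) powr p + \<theta> / B powr p * norm (g x) powr p)"
      using A B by (simp add: powr_divide)
    finally have "w x * norm (f x + g x) powr p
      \<le> w x * (?S * ((1 - \<theta>) / A powr p * norm (f x) powr p + \<theta> / B powr p * norm (g x) powr p))"
      using w_nonneg by (rule mult_left_mono)
    also have "\<dots> = ?S * ((1 - \<theta>) / A powr p * (w x * norm (f x) powr p) + \<theta> / B powr p * (w x * norm (g x) powr p))"
      by (simp only: distrib_left mult_ac)
    finally show ?thesis .
  qed
  have If: "integrable M (\<lambda>x. w x * norm (f x) powr p)" and Ig: "integrable M (\<lambda>x. w x * norm (g x) powr p)"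
    using f g by (auto simp: wfin_def)
  have Ifg: "integrable M (\<lambda>x. w x * norm (f x + g x) powr p)"
    using wfin_lin[OF _ f g, of 1] p by (simp add: wfin_def)
  have "wint M w p (\<lambda>x. f x + g x)
      \<le> (LINT x|M. ?S * ((1 - \<theta>) / A powr p * (w x * norm (f x) powr p) + \<theta> / B powr p * (w x * norm (g x) powr p)))"
    unfolding wint_def
    by (intro integral_mono Ifg integrable_mult_right Bochner_Integration.integrable_add If Ig pt)
  also have "\<dots> = ?S * ((1 - \<theta>) / A powr p * wint M w p f + \<theta> / B powr p * wint M w p g)"
    unfolding integral_mult_right_zero wint_def
    by (subst Bochner_Integration.integral_add) (intro integrable_mult_right If Ig, intro integrable_mult_right If Ig, simp only: integral_mult_right_zero)
  also have "\<dots> \<le> ?S * ((1 - \<theta>) / A powr p * A powr p + \<theta> / B powr p * B powr p)"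
    using A B \<theta> by (intro mult_left_mono add_mono) auto
  also have "\<dots> = ?S" using A B by simp
  finally have "nrm p (\<lambda>x. f x + g x) \<le> ((A + B) powr p) powr (1 / p)"
    using p wint_nonneg by (intro powr_mono2) auto
  also have "\<dots> = A + B" using A B p by (simp add: powr_powr)
  finally show "nrm p (\<lambda>x. f x + g x) \<le> nrm p f + nrm p g + e" by (simp add: A_def B_def)
qed

lemma nrm_line_convex:
  assumes p: "1 \<le> p" and f: "wfin M w p f" and g: "wfin M w p g"
  shows "convex_on UNIV (\<lambda>t::real. nrm p (\<lambda>x. f x + of_real t * g x))"
proof (rule convex_onI)
  fix t a b :: real assume t: "0 < t" "t < 1"
  have W: "wfin M w p (\<lambda>x. f x + of_real s * g x)" for s :: real using p by (intro wfin_lin f g) simp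
  have Wc: "wfin M w p (\<lambda>x. c * h x)" if "wfin M w p h" for h c
  proof -
    have "wfin M w p (\<lambda>x. 0)" by (simp add: wfin_def)
    from wfin_lin[OF _ this that, of c] p show ?thesis by simp
  qed
  have "(\<lambda>x. f x + of_real ((1 - t) *\<^sub>R a + t *\<^sub>R b) * g x)
      = (\<lambda>x. of_real (1 - t) * (f x + of_real a * g x) + of_real t * (f x + of_real b * g x))"
    by (simp add: algebra_simps)
  then have "nrm p (\<lambda>x. f x + of_real ((1 - t) *\<^sub>R a + t *\<^sub>R b) * g x)
      \<le> nrm p (\<lambda>x. of_real (1 - t) * (f x + of_real a * g x)) + nrm p (\<lambda>x. of_real t * (f x + of_real b * g x))"
    using nrm_triangle[OF p Wc[OF W] Wc[OF W]] by simp
  also have "\<dots> = (1 - t) * nrm p (\<lambda>x. f x + of_real a * g x) + t * nrm p (\<lambda>x. f x + of_real b * g x)"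
    using p t by (subst (1 2) nrm_scale) (simp_all flip: of_real_diff)
  finally show "nrm p (\<lambda>x. f x + of_real ((1 - t) *\<^sub>R a + t *\<^sub>R b) * g x)
      \<le> (1 - t) * nrm p (\<lambda>x. f x + of_real a * g x) + t * nrm p (\<lambda>x. f x + of_real b * g x)" .
qed simp

lemma pairing_bound:
  assumes p: "1 < p"
  shows "norm (of_real (w x * norm z powr (p - 2)) * z * cnj v) \<le> w x * norm z powr p + w x * norm v powr p"
proof -
  have "norm (of_real (w x * norm z powr (p - 2)) * z * cnj v) = w x * (norm z powr (p - 1) * norm v)"
  proof (cases "z = 0")
    case False
    then have "norm z powr (p - 1) = norm z powr (p - 2) * norm z" using powr_add[of "norm z" "p - 2" 1] by simp
    then show ?thesis using w_nonneg[of x] by (simp add: norm_mult)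
  qed simp
  also have "\<dots> \<le> w x * (norm z powr p + norm v powr p)"
  proof (intro mult_left_mono w_nonneg)
    show "norm z powr (p - 1) * norm v \<le> norm z powr p + norm v powr p"
      by (rule mult_powr_le) (use p in auto)
  qed
  finally show ?thesis by (simp add: distrib_left)
qed

lemma pairing_integrable:
  assumes p: "1 < p" and f: "wfin M w p f" and g: "wfin M w p g"
  shows "integrable M (\<lambda>x. of_real (w x * norm (f x) powr (p - 2)) * f x * cnj (g x))"
proof (rule Bochner_Integration.integrable_bound)
  have [measurable]: "f \<in> borel_measurable M" "g \<in> borel_measurable M" using f g by (auto simp: wfin_def)
  have [measurable]: "(\<lambda>x. cnj (g x)) \<in> borel_measurable M"
    by (intro borel_measurable_continuous_on[where f=cnj] continuous_intros) measurable
  show "integrable M (\<lambda>x. w x * norm (f x) powr p + w x * norm (g x) powr p)"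
    using f g by (auto simp: wfin_def)
  show "(\<lambda>x. of_real (w x * norm (f x) powr (p - 2)) * f x * cnj (g x)) \<in> borel_measurable M" by measurable
  show "AE x in M. norm (of_real (w x * norm (f x) powr (p - 2)) * f x * cnj (g x))
      \<le> norm (w x * norm (f x) powr p + w x * norm (g x) powr p)"
    by (intro AE_I2 order_trans[OF pairing_bound[OF p]]) simp
qed

lemma wint_line_derivative:
  assumes p: "1 < p" and f: "wfin M w p f" and g: "wfin M w p g"
  shows "((\<lambda>t. wint M w p (\<lambda>x. f x + of_real t * g x)) has_real_derivative
    p * Re (LINT x|M. of_real (w x * norm (f x) powr (p - 2)) * f x * cnj (g x))) (at 0)"
proof -
  note PI = pairing_integrable[OF p f g]
  let ?D = "\<lambda>x. p * Re (of_real (w x * norm (f x) powr (p - 2)) * f x * cnj (g x))"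
  have "((\<lambda>t. LINT x|M. w x * norm (f x + of_real t * g x) powr p) has_real_derivative (LINT x|M. ?D x)) (at 0)"
  proof (rule integral_convex_derivative)
    show "integrable M (\<lambda>x. w x * norm (f x + of_real t * g x) powr p)" for t
      using wfin_lin[OF _ f g, of "of_real t"] p by (simp add: wfin_def)
    show "?D \<in> borel_measurable M" using borel_measurable_integrable[OF PI] by measurable
    show "AE x in M. convex_on UNIV (\<lambda>t. w x * norm (f x + of_real t * g x) powr p)"
    proof (rule AE_I2)
      fix x
      have "convex_on UNIV (\<lambda>t. norm (f x + of_real t * g x) powr p)"
        using p by (intro convex_on_powr convex_on_norm_line) auto
      then show "convex_on UNIV (\<lambda>t. w x * norm (f x + of_real t * g x) powr p)"
        using w_nonneg by (intro convex_on_cmul)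
    qed
    show "AE x in M. ((\<lambda>t. w x * norm (f x + of_real t * g x) powr p) has_real_derivative ?D x) (at 0)"
    proof (rule AE_I2)
      fix x
      show "((\<lambda>t. w x * norm (f x + of_real t * g x) powr p) has_real_derivative ?D x) (at 0)"
        using DERIV_cmult[OF norm_powr_line_derivative[OF p, of "f x" "g x"], of "w x"]
        by (simp add: algebra_simps)
    qed
  qed
  also have "(LINT x|M. ?D x) = p * Re (LINT x|M. of_real (w x * norm (f x) powr (p - 2)) * f x * cnj (g x))"
    using PI by (simp only: integral_mult_right_zero integral_Re)
  finally show ?thesis unfolding wint_def .
qed

lemma wint_power_line_derivative:
  assumes p: "1 < p" and f: "wfin M w p f" and g: "wfin M w p g" and q: "0 < q" and pos: "wint M w p f > 0"
  shows "((\<lambda>t. nrm p (\<lambda>x. f x + of_real t * g x) powr q) has_real_derivative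
    q * (nrm p f powr (q - p) * Re (LINT x|M. of_real (w x * norm (f x) powr (p - 2)) * f x * cnj (g x)))) (at 0)"
proof -
  let ?R = "Re (LINT x|M. of_real (w x * norm (f x) powr (p - 2)) * f x * cnj (g x))"
  have "((\<lambda>t. wint M w p (\<lambda>x. f x + of_real t * g x) powr (q / p)) has_real_derivative
      (q / p) * wint M w p f powr (q / p - 1) * (p * ?R)) (at 0)"
    using DERIV_fun_powr[OF wint_line_derivative[OF p f g], of "q / p"] pos by (simp add: mult_ac)
  moreover have "nrm p f powr (q - p) = wint M w p f powr (q / p - 1)"
    using p by (simp add: powr_powr diff_divide_distrib)
  ultimately show ?thesis using p by (simp add: powr_powr mult_ac)
qed

text \<open>Young's inequality for \<open>f\<close> and \<open>g\<close> divided by their norms.  It gives Hoelder's inequality with the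
constant \<open>2\<close>, which is enough for integrability.\<close>

lemma nrm_pairing_le:
  assumes p: "1 < p" and f: "wfin M w p f" and g: "wfin M w p g" and pos: "wint M w p f > 0"
  shows "norm (LINT x|M. of_real (w x * norm (f x) powr (p - 2)) * f x * cnj (g x)) \<le> 2 * nrm p f powr (p - 1) * nrm p g"
proof (cases "wint M w p g = 0")
  case True
  have "AE x in M. w x * norm (g x) powr p = 0"
    using g True w_nonneg by (subst integral_nonneg_eq_0_iff_AE[symmetric]) (auto simp: wfin_def wint_def)
  then have "AE x in M. of_real (w x * norm (f x) powr (p - 2)) * f x * cnj (g x) = 0" by eventually_elim auto
  then have "(LINT x|M. of_real (w x * norm (f x) powr (p - 2)) * f x * cnj (g x)) = 0" by (rule integral_eq_zero_AE)
  then show ?thesis by simp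
next
  case False
  then have gpos: "wint M w p g > 0" using wint_nonneg[of p g] by simp
  define A where "A = nrm p f"
  define B where "B = nrm p g"
  have A: "A > 0" and B: "B > 0" using pos gpos by (auto simp: A_def B_def)
  have Ap: "A powr p = wint M w p f" and Bp: "B powr p = wint M w p g"
    using p wint_nonneg by (auto simp: A_def B_def powr_powr)
  have If: "integrable M (\<lambda>x. w x * norm (f x) powr p)" and Ig: "integrable M (\<lambda>x. w x * norm (g x) powr p)"
    using f g by (auto simp: wfin_def)
  let ?k = "A powr (p - 1) * B"
  have k: "?k > 0" using A B by simp
  have pt: "norm (of_real (w x * norm (f x) powr (p - 2)) * f x * cnj (g x))
      \<le> ?k * (w x * norm (f x) powr p / A powr p + w x * norm (g x) powr p / B powr p)" for x
  proof -
    let ?z = "f x / of_real A" and ?v = "g x / of_real B"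
    have "of_real (w x * norm (f x) powr (p - 2)) * f x * cnj (g x)
        = of_real ?k * (of_real (w x * norm ?z powr (p - 2)) * ?z * cnj ?v)"
    proof -
      have "A powr (p - 1) = A powr (p - 2) * A" using A powr_add[of A "p - 2" 1] by simp
      moreover have "norm ?z powr (p - 2) = norm (f x) powr (p - 2) / A powr (p - 2)"
        using A by (simp add: norm_divide powr_divide)
      ultimately show ?thesis using A B by simp
    qed
    also have "norm \<dots> = ?k * norm (of_real (w x * norm ?z powr (p - 2)) * ?z * cnj ?v)"
      unfolding norm_mult[of "of_real ?k"] norm_of_real using k by simp
    also have "\<dots> \<le> ?k * (w x * norm ?z powr p + w x * norm ?v powr p)"
      using k by (intro mult_left_mono pairing_bound p) auto
    finally show ?thesis using A B by (simp add: norm_divide powr_divide)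
  qed
  have "norm (LINT x|M. of_real (w x * norm (f x) powr (p - 2)) * f x * cnj (g x))
      \<le> (LINT x|M. ?k * (w x * norm (f x) powr p / A powr p + w x * norm (g x) powr p / B powr p))"
    by (rule norm_integral_le[OF _ pt]) (intro integrable_mult_right Bochner_Integration.integrable_add integrable_divide If Ig)
  also have "\<dots> = ?k * (wint M w p f / A powr p + wint M w p g / B powr p)"
    using If Ig by (simp add: wint_def)
  also have "\<dots> = ?k * 2" unfolding Ap[symmetric] Bp[symmetric] using A B by simp
  finally show ?thesis by (simp add: A_def B_def)
qed

end

context nonneg_weight
begin

text \<open>Where \<open>f\<close> vanishes, the norm along the line is a multiple of \<open>|t|\<close>.\<close>

lemma nrm_line_degenerate:
  assumes r: "0 < r" and f: "wfin M w r f" and g: "wfin M w r g" and Z: "wint M w r f = 0"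
  shows "nrm r (\<lambda>x. f x + of_real t * g x) = \<bar>t\<bar> * nrm r g"
proof -
  have "AE x in M. w x * norm (f x) powr r = 0"
    using f Z w_nonneg by (subst integral_nonneg_eq_0_iff_AE[symmetric]) (auto simp: wfin_def wint_def)
  then have "AE x in M. w x * norm (f x + of_real t * g x) powr r = w x * norm (of_real t * g x) powr r"
    by eventually_elim auto
  then have "wint M w r (\<lambda>x. f x + of_real t * g x) = wint M w r (\<lambda>x. of_real t * g x)"
    unfolding wint_def using f g by (intro integral_cong_AE) (auto simp: wfin_def)
  then show ?thesis using nrm_scale[OF r, of "of_real t" g] by simp
qed

text \<open>The variable \<open>\<omega>\<close> is that of the outer integral.  For fixed \<open>\<omega>\<close> the \<open>s\<close>-th power of the inner norm is convex
in \<open>t\<close>; it is differentiable at \<open>0\<close> by the chain rule if the inner norm of \<open>f\<close> is positive, and because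
of \<open>s > 1\<close> if it is zero.  In the latter case the convention \<open>0 powr (s - r) = 0\<close> makes the claimed
derivative vanish as well.\<close>

lemma mixed_line:
  fixes f g :: "'c \<Rightarrow> 'b \<Rightarrow> complex" and M' :: "'c measure" and W :: "'c \<Rightarrow> real"
    and P :: "'c \<Rightarrow> complex" and r s :: real
  defines "P \<equiv> \<lambda>\<omega>. LINT x|M. of_real (w x * norm (f \<omega> x) powr (r - 2)) * f \<omega> x * cnj (g \<omega> x)"
  assumes r: "1 < r" and s: "1 < s"
    and W[measurable]: "W \<in> borel_measurable M'" and W0: "\<And>\<omega>. 0 \<le> W \<omega>"
    and f: "AE \<omega> in M'. wfin M w r (f \<omega>)" and g: "AE \<omega> in M'. wfin M w r (g \<omega>)"
    and mt: "\<And>t::real. (\<lambda>\<omega>. nrm r (\<lambda>x. f \<omega> x + of_real t * g \<omega> x)) \<in> borel_measurable M'"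
    and mg[measurable]: "(\<lambda>\<omega>. nrm r (g \<omega>)) \<in> borel_measurable M'"
    and mP[measurable]: "P \<in> borel_measurable M'"
    and If: "integrable M' (\<lambda>\<omega>. W \<omega> * nrm r (f \<omega>) powr s)"
    and Ig: "integrable M' (\<lambda>\<omega>. W \<omega> * nrm r (g \<omega>) powr s)"
  shows mixed_pairing_integrable: "integrable M' (\<lambda>\<omega>. of_real (nrm r (f \<omega>) powr (s - r)) * P \<omega> * of_real (W \<omega>))"
    and mixed_line_derivative:
      "((\<lambda>t. LINT \<omega>|M'. W \<omega> * nrm r (\<lambda>x. f \<omega> x + of_real t * g \<omega> x) powr s) has_real_derivative
        s * Re (LINT \<omega>|M'. of_real (nrm r (f \<omega>) powr (s - r)) * P \<omega> * of_real (W \<omega>))) (at 0)"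
proof -
  let ?N = "\<lambda>\<omega> t::real. nrm r (\<lambda>x. f \<omega> x + of_real t * g \<omega> x)"
  let ?E = "\<lambda>\<omega>. of_real (nrm r (f \<omega>) powr (s - r)) * P \<omega> * of_real (W \<omega>)"
  have mf[measurable]: "(\<lambda>\<omega>. nrm r (f \<omega>)) \<in> borel_measurable M'" using mt[of 0] by simp
  show PI: "integrable M' ?E"
  proof (rule Bochner_Integration.integrable_bound)
    show "integrable M' (\<lambda>\<omega>. 2 * (W \<omega> * nrm r (f \<omega>) powr s) + 2 * (W \<omega> * nrm r (g \<omega>) powr s))"
      using If Ig by (intro Bochner_Integration.integrable_add integrable_mult_right)
    show "AE \<omega> in M'. norm (?E \<omega>) \<le> norm (2 * (W \<omega> * nrm r (f \<omega>) powr s) + 2 * (W \<omega> * nrm r (g \<omega>) powr s))"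
      using f g
    proof eventually_elim
      case (elim \<omega>)
      let ?A = "nrm r (f \<omega>)" and ?B = "nrm r (g \<omega>)"
      have "norm (?E \<omega>) \<le> 2 * (?A powr s + ?B powr s) * W \<omega>"
      proof (cases "wint M w r (f \<omega>) = 0")
        case True then show ?thesis using W0 by simp
      next
        case False
        then have pos: "wint M w r (f \<omega>) > 0" using wint_nonneg[of r "f \<omega>"] by simp
        have "?A powr (s - r) * norm (P \<omega>) \<le> ?A powr (s - r) * (2 * ?A powr (r - 1) * ?B)"
          unfolding P_def using nrm_pairing_le[OF r elim pos] by (intro mult_left_mono) auto
        also have "\<dots> = 2 * (?A powr (s - 1) * ?B)"
          using powr_add[of ?A "s - r" "r - 1"] by simp
        also have "\<dots> \<le> 2 * (?A powr s + ?B powr s)"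
          by (intro mult_left_mono mult_powr_le s) auto
        finally have "?A powr (s - r) * norm (P \<omega>) * W \<omega> \<le> 2 * (?A powr s + ?B powr s) * W \<omega>"
          using W0 by (rule mult_right_mono)
        then show ?thesis using W0[of \<omega>] by (simp add: norm_mult)
      qed
      also have "\<dots> \<le> norm (2 * (W \<omega> * ?A powr s) + 2 * (W \<omega> * ?B powr s))"
        using W0[of \<omega>] by (simp add: algebra_simps)
      finally show ?case .
    qed
  qed measurable
  let ?D = "\<lambda>\<omega>. s * Re (?E \<omega>)"
  have "((\<lambda>t. LINT \<omega>|M'. W \<omega> * ?N \<omega> t powr s) has_real_derivative (LINT \<omega>|M'. ?D \<omega>)) (at 0)"
  proof (rule integral_convex_derivative)
    fix t :: real
    show "integrable M' (\<lambda>\<omega>. W \<omega> * ?N \<omega> t powr s)"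
    proof (rule Bochner_Integration.integrable_bound)
      show "integrable M' (\<lambda>\<omega>. 2 powr s * (W \<omega> * nrm r (f \<omega>) powr s) + (2 powr s * \<bar>t\<bar> powr s) * (W \<omega> * nrm r (g \<omega>) powr s))"
        using If Ig by (intro Bochner_Integration.integrable_add integrable_mult_right)
      show "(\<lambda>\<omega>. W \<omega> * ?N \<omega> t powr s) \<in> borel_measurable M'" using mt[of t] by measurable
      show "AE \<omega> in M'. norm (W \<omega> * ?N \<omega> t powr s)
          \<le> norm (2 powr s * (W \<omega> * nrm r (f \<omega>) powr s) + (2 powr s * \<bar>t\<bar> powr s) * (W \<omega> * nrm r (g \<omega>) powr s))"
        using f g
      proof eventually_elim
        case (elim \<omega>)
        let ?A = "nrm r (f \<omega>)" and ?B = "nrm r (g \<omega>)"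
        have "wfin M w r (\<lambda>x. 0)" by (simp add: wfin_def)
        from wfin_lin[OF _ this elim(2), of "of_real t"] r have tg: "wfin M w r (\<lambda>x. of_real t * g \<omega> x)" by simp
        have "?N \<omega> t \<le> ?A + \<bar>t\<bar> * ?B"
          using nrm_triangle[OF _ elim(1) tg] nrm_scale[of r "of_real t" "g \<omega>"] r by simp
        then have "?N \<omega> t powr s \<le> (?A + \<bar>t\<bar> * ?B) powr s" using s by (intro powr_mono2) auto
        also have "\<dots> \<le> 2 powr s * (?A powr s + (\<bar>t\<bar> * ?B) powr s)" using s by (intro powr_add_le) auto
        finally have "W \<omega> * ?N \<omega> t powr s \<le> W \<omega> * (2 powr s * (?A powr s + \<bar>t\<bar> powr s * ?B powr s))"
          using W0 by (auto simp: powr_mult intro!: mult_left_mono)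
        also have "\<dots> = 2 powr s * (W \<omega> * ?A powr s) + (2 powr s * \<bar>t\<bar> powr s) * (W \<omega> * ?B powr s)"
          by (simp only: distrib_left mult_ac)
        finally show ?case using W0[of \<omega>] by simp
      qed
    qed
  next
    show "?D \<in> borel_measurable M'" using borel_measurable_integrable[OF PI] by measurable
    show "AE \<omega> in M'. convex_on UNIV (\<lambda>t. W \<omega> * ?N \<omega> t powr s)"
      using f g by eventually_elim (use r s W0 in \<open>auto intro!: convex_on_cmul convex_on_powr nrm_line_convex\<close>)
    show "AE \<omega> in M'. ((\<lambda>t. W \<omega> * ?N \<omega> t powr s) has_real_derivative ?D \<omega>) (at 0)"
      using f g
    proof eventually_elim
      case (elim \<omega>)
      show ?case
      proof (cases "wint M w r (f \<omega>) = 0")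
        case True
        have "((\<lambda>t. W \<omega> * (\<bar>t\<bar> powr s * nrm r (g \<omega>) powr s)) has_real_derivative W \<omega> * 0) (at 0)"
          by (intro DERIV_cmult abs_powr_has_derivative_0 s)
        moreover have "?N \<omega> t powr s = \<bar>t\<bar> powr s * nrm r (g \<omega>) powr s" for t
          using nrm_line_degenerate[OF _ elim True] r by (simp add: powr_mult)
        ultimately show ?thesis using True by simp
      next
        case False
        then have pos: "wint M w r (f \<omega>) > 0" using wint_nonneg[of r "f \<omega>"] by simp
        have "((\<lambda>t. W \<omega> * ?N \<omega> t powr s) has_real_derivative
            W \<omega> * (s * (nrm r (f \<omega>) powr (s - r) * Re (P \<omega>)))) (at 0)"
          unfolding P_def using s by (intro DERIV_cmult wint_power_line_derivative r elim pos) auto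
        then show ?thesis by (rule DERIV_cong) simp
      qed
    qed
  qed
  also have "(LINT \<omega>|M'. ?D \<omega>) = s * Re (LINT \<omega>|M'. ?E \<omega>)"
    using PI by (simp only: integral_mult_right_zero integral_Re)
  finally show "((\<lambda>t. LINT \<omega>|M'. W \<omega> * ?N \<omega> t powr s) has_real_derivative s * Re (LINT \<omega>|M'. ?E \<omega>)) (at 0)" .
qed

lemma wfin_iff:
  "wfin M w p f \<longleftrightarrow> f \<in> borel_measurable M \<and> (\<integral>\<^sup>+x. ennreal (norm (f x) powr p * w x) \<partial>M) < \<infinity>"
proof (cases "f \<in> borel_measurable M")
  case True
  then have [measurable]: "f \<in> borel_measurable M" .
  have "integrable M (\<lambda>x. w x * norm (f x) powr p) \<longleftrightarrow> (\<integral>\<^sup>+x. ennreal (norm (f x) powr p * w x) \<partial>M) < \<infinity>"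
    using w_nonneg by (simp add: integrable_iff_bounded abs_mult mult.commute)
  then show ?thesis using True by (simp add: wfin_def)
qed (simp add: wfin_def)

lemma wfin_nn_integral:
  assumes "wfin M w p f"
  shows "(\<integral>\<^sup>+x. ennreal (norm (f x) powr p * w x) \<partial>M) = ennreal (wint M w p f)"
proof -
  have "(\<integral>\<^sup>+x. ennreal (w x * norm (f x) powr p) \<partial>M) = ennreal (LINT x|M. w x * norm (f x) powr p)"
    using assms w_nonneg by (intro nn_integral_eq_integral) (auto simp: wfin_def)
  then show ?thesis by (simp add: wint_def mult.commute)
qed

end

lemma nonneg_weight_powr:
  "nonneg_weight lborel (\<lambda>x::'a::euclidean_space. norm x powr c)"
  "nonneg_weight lborel (\<lambda>x::'a::euclidean_space. (1 + norm x) powr c)"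
  by (unfold_locales; simp)+

section \<open>Lower semicontinuity of the modulation norm\<close>

lemma epowr_epowr:
  assumes "t \<noteq> 0" shows "epowr (epowr x t) (1 / t) = x"
  using assms by (cases x) (auto simp: epowr_def powr_powr)

text \<open>The map is increasing with increasing inverse; lower semicontinuity follows from this alone.\<close>

lemma epowr_liminf:
  fixes X :: "nat \<Rightarrow> ennreal"
  assumes t: "0 < t"
  shows "epowr (liminf X) t \<le> liminf (\<lambda>n. epowr (X n) t)"
proof -
  let ?Y = "liminf (\<lambda>n. epowr (X n) t)"
  have "liminf X \<le> epowr ?Y (1 / t)"
  proof (rule ccontr)
    assume "\<not> liminf X \<le> epowr ?Y (1 / t)"
    then obtain c where c: "epowr ?Y (1 / t) < c" "c < liminf X" using dense[of "epowr ?Y (1 / t)" "liminf X"] by (auto simp: not_le)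
    have "eventually (\<lambda>n. c < X n) sequentially" using c(2) by (rule less_LiminfD)
    then have "eventually (\<lambda>n. epowr c t \<le> epowr (X n) t) sequentially"
      by eventually_elim (use t in \<open>auto intro: epowr_mono\<close>)
    then have "epowr c t \<le> ?Y" by (rule Liminf_bounded)
    then have "epowr (epowr c t) (1 / t) \<le> epowr ?Y (1 / t)" using t by (intro epowr_mono) auto
    then show False using c(1) t by (simp add: epowr_epowr)
  qed
  then have "epowr (liminf X) t \<le> epowr (epowr ?Y (1 / t)) t" using t by (intro epowr_mono) auto
  also have "\<dots> = ?Y" using epowr_epowr[of "1 / t" ?Y] t by simp
  finally show ?thesis .
qed

lemma epowr_measurable [measurable]:
  assumes [measurable]: "f \<in> borel_measurable M"
  shows "(\<lambda>x. epowr (f x) t) \<in> borel_measurable M"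
  unfolding epowr_def by measurable

lemma stft_nn_integral_measurable:
  fixes g u :: "'a::euclidean_space \<Rightarrow> complex"
  assumes "g \<in> schwartz" "u \<in> borel_measurable borel"
  shows "(\<lambda>\<omega>. wnorm r \<alpha> (\<lambda>x. stft g u x \<omega>)) \<in> borel_measurable borel"
proof -
  have "(\<lambda>z. stft g u (fst (snd z, fst z)) (snd (snd z, fst z))) \<in> borel_measurable (borel \<Otimes>\<^sub>M borel)"
    by (rule measurable_compose[OF _ stft_measurable[OF assms]]) measurable
  then have [measurable]: "(\<lambda>z. stft g u (snd z) (fst z)) \<in> borel_measurable (borel \<Otimes>\<^sub>M borel)" by simp
  show ?thesis unfolding wnorm_def by measurable
qed

text \<open>Fatou's lemma for the inner and for the outer integral.  The outer weight is moved into the measure,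
so that the limit inferior is taken of powers of norms only.\<close>

lemma mod_norm_le_of_mollify:
  fixes g u :: "'a::euclidean_space \<Rightarrow> complex"
  assumes g: "g \<in> schwartz" and u: "tame u" and r: "1 \<le> r" and s: "1 \<le> s"
    and B: "\<And>n. mod_norm g r s \<alpha> \<beta> (regdist (mollify (real (Suc n)) u)) \<le> B"
  shows "mod_norm g r s \<alpha> \<beta> (regdist u) \<le> B"
proof -
  let ?u = "\<lambda>n. mollify (real (Suc n)) u"
  let ?J = "\<lambda>u \<omega>. wnorm r \<alpha> (\<lambda>x. stft g u x \<omega>)"
  have mu: "?u n \<in> borel_measurable borel" for n
    by (intro schwartz_measurable mollify_schwartz u) simp
  have sm: "(\<lambda>x. stft g v x \<omega>) \<in> borel_measurable borel" if "v \<in> borel_measurable borel" for v \<omega>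
  proof -
    have "(\<lambda>x. stft g v (fst (x, \<omega>)) (snd (x, \<omega>))) \<in> borel_measurable borel"
      by (rule measurable_compose[OF _ stft_measurable[OF g that]]) measurable
    then show ?thesis by simp
  qed
  have J: "?J u \<omega> \<le> liminf (\<lambda>n. ?J (?u n) \<omega>)" for \<omega>
  proof -
    let ?h = "\<lambda>v x. ennreal (norm (stft g v x \<omega>) powr r * (1 + norm x) powr (\<alpha> * r))"
    have L: "(\<lambda>n. ?h (?u n) x) \<longlonglongrightarrow> ?h u x" for x
      using r by (intro tendsto_ennrealI tendsto_mult tendsto_const tendsto_powr2 tendsto_norm
          stft_mollify_tendsto[OF g u]) (auto intro!: always_eventually)
    have "(\<integral>\<^sup>+x. ?h u x \<partial>lborel) = (\<integral>\<^sup>+x. liminf (\<lambda>n. ?h (?u n) x) \<partial>lborel)"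
      by (intro nn_integral_cong lim_imp_Liminf[symmetric] L) simp
    also have "\<dots> \<le> liminf (\<lambda>n. \<integral>\<^sup>+x. ?h (?u n) x \<partial>lborel)"
      using sm[OF mu] by (intro nn_integral_liminf) simp
    finally have "?J u \<omega> \<le> epowr (liminf (\<lambda>n. \<integral>\<^sup>+x. ?h (?u n) x \<partial>lborel)) (1 / r)"
      unfolding wnorm_def using r by (intro epowr_mono) auto
    also have "\<dots> \<le> liminf (\<lambda>n. ?J (?u n) \<omega>)"
      unfolding wnorm_def using r by (intro epowr_liminf) auto
    finally show ?thesis .
  qed
  let ?M = "density lborel (\<lambda>\<omega>::'a. ennreal ((1 + norm \<omega>) powr (\<beta> * s)))"
  have D: "(\<integral>\<^sup>+\<omega>. epowr (?J v \<omega>) s * ennreal ((1 + norm \<omega>) powr (\<beta> * s)) \<partial>lborel) = (\<integral>\<^sup>+\<omega>. epowr (?J v \<omega>) s \<partial>?M)"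
    if "v \<in> borel_measurable borel" for v
    using stft_nn_integral_measurable[OF g that, of r \<alpha>]
    by (subst nn_integral_density) (auto simp: mult.commute)
  have "(\<integral>\<^sup>+\<omega>. epowr (?J u \<omega>) s \<partial>?M) \<le> (\<integral>\<^sup>+\<omega>. liminf (\<lambda>n. epowr (?J (?u n) \<omega>) s) \<partial>?M)"
  proof (intro nn_integral_mono)
    fix \<omega>
    have "epowr (?J u \<omega>) s \<le> epowr (liminf (\<lambda>n. ?J (?u n) \<omega>)) s" using s by (intro epowr_mono J) auto
    also have "\<dots> \<le> liminf (\<lambda>n. epowr (?J (?u n) \<omega>) s)" using s by (intro epowr_liminf) auto
    finally show "epowr (?J u \<omega>) s \<le> liminf (\<lambda>n. epowr (?J (?u n) \<omega>) s)" .
  qed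
  also have "\<dots> \<le> liminf (\<lambda>n. \<integral>\<^sup>+\<omega>. epowr (?J (?u n) \<omega>) s \<partial>?M)"
    using stft_nn_integral_measurable[OF g mu, of r \<alpha>] by (intro nn_integral_liminf) simp
  finally have "mod_norm g r s \<alpha> \<beta> (regdist u) \<le> epowr (liminf (\<lambda>n. \<integral>\<^sup>+\<omega>. epowr (?J (?u n) \<omega>) s \<partial>?M)) (1 / s)"
    unfolding mod_norm_def D[OF tame_measurable[OF u]] using s by (intro epowr_mono) auto
  also have "\<dots> \<le> liminf (\<lambda>n. epowr (\<integral>\<^sup>+\<omega>. epowr (?J (?u n) \<omega>) s \<partial>?M) (1 / s))"
    using s by (intro epowr_liminf) auto
  also have "\<dots> = liminf (\<lambda>n. mod_norm g r s \<alpha> \<beta> (regdist (?u n)))"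
    unfolding mod_norm_def D[OF mu] ..
  also have "\<dots> \<le> B"
  proof -
    have "liminf (\<lambda>n. mod_norm g r s \<alpha> \<beta> (regdist (?u n))) \<le> liminf (\<lambda>n::nat. B)"
      by (intro Liminf_mono always_eventually allI B)
    then show ?thesis by (simp add: Liminf_const)
  qed
  finally show ?thesis .
qed

section \<open>The Euler--Lagrange equation\<close>

lemma Lw_wfin:
  assumes f: "f \<in> Lw p a" and p: "0 \<le> p" and a: "0 \<le> a"
  shows "wfin lborel (\<lambda>x. norm x powr (a * p)) p f"
proof -
  interpret nonneg_weight lborel "\<lambda>x::'a. norm x powr (a * p)" by (rule nonneg_weight_powr)
  have "(\<integral>\<^sup>+x. ennreal (norm (f x) powr p * norm x powr (a * p)) \<partial>lborel)
      \<le> (\<integral>\<^sup>+x. ennreal (norm (f x) powr p * (1 + norm x) powr (a * p)) \<partial>lborel)"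
    using p a by (intro nn_integral_mono ennreal_leI mult_left_mono powr_mono2) auto
  then show ?thesis using f by (auto simp: wfin_iff Lw_iff)
qed

lemma Lnorm_weighted:
  assumes f: "f \<in> Lw p a" and p: "0 < p" and a: "0 \<le> a"
  shows "Lnorm p (\<lambda>x. norm x powr a *\<^sub>R f x) = ennreal (wint lborel (\<lambda>x. norm x powr (a * p)) p f powr (1 / p))"
proof -
  interpret nonneg_weight lborel "\<lambda>x::'a. norm x powr (a * p)" by (rule nonneg_weight_powr)
  have "norm (norm x powr a *\<^sub>R f x) powr p = norm (f x) powr p * norm x powr (a * p)" for x
    by (simp add: powr_mult powr_powr mult.commute)
  then have "Lnorm p (\<lambda>x. norm x powr a *\<^sub>R f x)
      = epowr (\<integral>\<^sup>+x. ennreal (norm (f x) powr p * norm x powr (a * p)) \<partial>lborel) (1 / p)"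
    by (simp add: Lnorm_eq)
  also have "\<dots> = ennreal (wint lborel (\<lambda>x. norm x powr (a * p)) p f powr (1 / p))"
    using Lw_wfin[OF f _ a] p by (simp add: wfin_nn_integral epowr_ennreal wint_nonneg)
  finally show ?thesis .
qed

lemma pairing_self: "of_real (c * norm z powr (p - 2)) * z * cnj z = of_real (c * norm z powr p)"
proof (cases "z = 0")
  case False
  have "norm z powr p = norm z powr (p - 2) * (norm z)\<^sup>2"
    using powr_add[of "norm z" "p - 2" 2] False by simp
  moreover have "z * cnj z = of_real ((norm z)\<^sup>2)" by (rule complex_norm_square[symmetric])
  ultimately show ?thesis by (simp add: mult.assoc)
qed simp

locale variational_problem =
  fixes g :: "'a::euclidean_space \<Rightarrow> complex" and r s \<alpha> \<beta> p a q b :: real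
  assumes g: "g \<in> schwartz" and r: "1 < r" and s: "1 < s" and p: "1 < p" and q: "1 < q"
    and a: "0 \<le> a" and b: "0 \<le> b"
begin

abbreviation "X \<equiv> (Lw_FLw p a q b :: ('a \<Rightarrow> complex) set)"
abbreviation "time_weight \<equiv> (\<lambda>x::'a. norm x powr (a * p))"
abbreviation "freq_weight \<equiv> (\<lambda>x::'a. norm x powr (b * q))"
abbreviation "inner_weight \<equiv> (\<lambda>x::'a. (1 + norm x) powr (\<alpha> * r))"
abbreviation "outer_weight \<equiv> (\<lambda>\<omega>::'a. (1 + norm \<omega>) powr (\<beta> * s))"

sublocale tw: nonneg_weight lborel time_weight by (rule nonneg_weight_powr)
sublocale fw: nonneg_weight lborel freq_weight by (rule nonneg_weight_powr)
sublocale iw: nonneg_weight lborel inner_weight by (rule nonneg_weight_powr)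

abbreviation "time_norm u \<equiv> tw.nrm p u"
abbreviation "freq_norm u \<equiv> fw.nrm q (fhat u)"
abbreviation "slice_norm u \<omega> \<equiv> iw.nrm r (\<lambda>x. stft g u x \<omega>)"

definition mod_finite :: "('a \<Rightarrow> complex) \<Rightarrow> bool"
  where "mod_finite u \<longleftrightarrow> (AE \<omega> in lborel. wfin lborel inner_weight r (\<lambda>x. stft g u x \<omega>)) \<and>
    integrable lborel (\<lambda>\<omega>. outer_weight \<omega> * slice_norm u \<omega> powr s)"

text \<open>The modulation norm as a real number; it has this meaning for functions with \<open>mod_finite\<close> only.\<close>

definition mod_real :: "('a \<Rightarrow> complex) \<Rightarrow> real"
  where "mod_real u = (LINT \<omega>|lborel. outer_weight \<omega> * slice_norm u \<omega> powr s) powr (1 / s)"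

lemma X_tame: "u \<in> X \<Longrightarrow> tame u"
  using Lw_tame[OF Lw_FLw_Lw] p a by (meson less_imp_le)

lemma X_lin: "u \<in> X \<Longrightarrow> v \<in> X \<Longrightarrow> (\<lambda>x. u x + c * v x) \<in> X"
  by (rule Lw_FLw_lin) (use p a q in auto)

lemma X_fhat_lin: "u \<in> X \<Longrightarrow> v \<in> X \<Longrightarrow> AE x in lborel. fhat (\<lambda>x. u x + c * v x) x = fhat u x + c * fhat v x"
  by (rule fhat_lin) (use p a q in auto)

lemma X_scale:
  assumes "u \<in> X"
  shows "(\<lambda>x. c * u x) \<in> X" and "AE x in lborel. fhat (\<lambda>x. c * u x) x = c * fhat u x"
  using X_lin[OF assms assms, of "c - 1"] X_fhat_lin[OF assms assms, of "c - 1"] by (simp_all add: algebra_simps)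

lemma X_wfin:
  assumes "u \<in> X"
  shows "wfin lborel time_weight p u" "wfin lborel freq_weight q (fhat u)"
  using Lw_wfin[OF Lw_FLw_Lw[OF assms]] Lw_wfin[OF fhat_Lw[OF assms]] p q a b by auto

lemma functional_eq: "u \<in> X \<Longrightarrow> uncertainty_functional p a q b u = ennreal (time_norm u + freq_norm u)"
  unfolding uncertainty_functional_def
  using p q a b Lnorm_weighted[OF Lw_FLw_Lw, of u p a q b] Lnorm_weighted[OF fhat_Lw, of u p a q b]
  by simp

lemma slice_measurable: "u \<in> borel_measurable borel \<Longrightarrow> (\<lambda>x. stft g u x \<omega>) \<in> borel_measurable borel"
proof -
  assume u: "u \<in> borel_measurable borel"
  have "(\<lambda>x. stft g u (fst (x, \<omega>)) (snd (x, \<omega>))) \<in> borel_measurable borel"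
    by (rule measurable_compose[OF _ stft_measurable[OF g u]]) measurable
  then show ?thesis by simp
qed

lemma stft_measurable_swap:
  assumes "u \<in> borel_measurable borel"
  shows "(\<lambda>z. stft g u (snd z) (fst z)) \<in> borel_measurable (borel \<Otimes>\<^sub>M borel)"
proof -
  have "(\<lambda>z. stft g u (fst (snd z, fst z)) (snd (snd z, fst z))) \<in> borel_measurable (borel \<Otimes>\<^sub>M borel)"
    by (rule measurable_compose[OF _ stft_measurable[OF g assms]]) measurable
  then show ?thesis by simp
qed

text \<open>The last equation includes slices of infinite norm: \<open>enn2real\<close> and the Bochner integral both give
\<open>0\<close> then.\<close>

lemma wnorm_slice:
  assumes "u \<in> borel_measurable borel"
  shows "wnorm r \<alpha> (\<lambda>x. stft g u x \<omega>) < \<infinity> \<longleftrightarrow> wfin lborel inner_weight r (\<lambda>x. stft g u x \<omega>)"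
    and "wfin lborel inner_weight r (\<lambda>x. stft g u x \<omega>) \<Longrightarrow> wnorm r \<alpha> (\<lambda>x. stft g u x \<omega>) = ennreal (slice_norm u \<omega>)"
    and "enn2real (wnorm r \<alpha> (\<lambda>x. stft g u x \<omega>)) = slice_norm u \<omega>"
proof -
  show 1: "wnorm r \<alpha> (\<lambda>x. stft g u x \<omega>) < \<infinity> \<longleftrightarrow> wfin lborel inner_weight r (\<lambda>x. stft g u x \<omega>)"
    using slice_measurable[OF assms] unfolding wnorm_def epowr_less_top iw.wfin_iff by simp
  show 2: "wnorm r \<alpha> (\<lambda>x. stft g u x \<omega>) = ennreal (slice_norm u \<omega>)" if "wfin lborel inner_weight r (\<lambda>x. stft g u x \<omega>)"
    unfolding wnorm_def iw.wfin_nn_integral[OF that] by (simp add: epowr_ennreal iw.wint_nonneg)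
  show "enn2real (wnorm r \<alpha> (\<lambda>x. stft g u x \<omega>)) = slice_norm u \<omega>"
  proof (cases "wfin lborel inner_weight r (\<lambda>x. stft g u x \<omega>)")
    case True then show ?thesis using 2 by simp
  next
    case False
    then have "wnorm r \<alpha> (\<lambda>x. stft g u x \<omega>) = \<infinity>" using 1 by (simp add: less_top[symmetric])
    moreover have "wint lborel inner_weight r (\<lambda>x. stft g u x \<omega>) = 0"
      using False slice_measurable[OF assms] by (simp add: wfin_def wint_def not_integrable_integral_eq)
    ultimately show ?thesis by simp
  qed
qed

lemma slice_norm_measurable:
  assumes "u \<in> borel_measurable borel" shows "slice_norm u \<in> borel_measurable borel"
  using stft_nn_integral_measurable[OF g assms, of r \<alpha>] unfolding wnorm_slice(3)[OF assms, symmetric] by measurable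

lemma mod_norm_finiteD:
  assumes u: "u \<in> borel_measurable borel" and fin: "mod_norm g r s \<alpha> \<beta> (regdist u) < \<infinity>"
  shows "mod_finite u"
proof -
  let ?w = "\<lambda>\<omega>. wnorm r \<alpha> (\<lambda>x. stft g u x \<omega>)"
  have [measurable]: "?w \<in> borel_measurable borel" by (rule stft_nn_integral_measurable[OF g u])
  have [measurable]: "slice_norm u \<in> borel_measurable borel" by (rule slice_norm_measurable[OF u])
  let ?I = "\<lambda>\<omega>. epowr (?w \<omega>) s * ennreal (outer_weight \<omega>)"
  have I: "(\<integral>\<^sup>+\<omega>. ?I \<omega> \<partial>lborel) < \<infinity>" using fin unfolding mod_norm_def epowr_less_top .
  have "AE \<omega> in lborel. ?I \<omega> \<noteq> \<infinity>" using I by (intro nn_integral_PInf_AE) auto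
  then have ae: "AE \<omega> in lborel. wfin lborel inner_weight r (\<lambda>x. stft g u x \<omega>)"
  proof eventually_elim
    case (elim \<omega>)
    have "ennreal (outer_weight \<omega>) > 0" by (simp add: ennreal_less_zero_iff)
    then have "epowr (?w \<omega>) s < \<infinity>" using elim by (auto simp: ennreal_mult_eq_top_iff top.not_eq_extremum)
    then show ?case using wnorm_slice(1)[OF u] by (simp add: epowr_less_top[unfolded infinity_ennreal_def])
  qed
  have "(\<integral>\<^sup>+\<omega>. ennreal (outer_weight \<omega> * slice_norm u \<omega> powr s) \<partial>lborel) = (\<integral>\<^sup>+\<omega>. ?I \<omega> \<partial>lborel)"
    by (rule nn_integral_cong_AE)
      (use ae in eventually_elim, simp add: wnorm_slice(2)[OF u] epowr_ennreal ennreal_mult mult.commute)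
  then have "integrable lborel (\<lambda>\<omega>. outer_weight \<omega> * slice_norm u \<omega> powr s)"
    using I by (intro integrableI_nonneg) auto
  then show ?thesis using ae by (simp add: mod_finite_def)
qed

lemma mod_norm_eq:
  assumes u: "u \<in> borel_measurable borel" and fin: "mod_finite u"
  shows "mod_norm g r s \<alpha> \<beta> (regdist u) = ennreal (mod_real u)"
proof -
  have ae: "AE \<omega> in lborel. wfin lborel inner_weight r (\<lambda>x. stft g u x \<omega>)"
    and I: "integrable lborel (\<lambda>\<omega>. outer_weight \<omega> * slice_norm u \<omega> powr s)"
    using fin by (auto simp: mod_finite_def)
  have "(\<integral>\<^sup>+\<omega>. epowr (wnorm r \<alpha> (\<lambda>x. stft g u x \<omega>)) s * ennreal (outer_weight \<omega>) \<partial>lborel)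
      = (\<integral>\<^sup>+\<omega>. ennreal (outer_weight \<omega> * slice_norm u \<omega> powr s) \<partial>lborel)"
    by (rule nn_integral_cong_AE)
      (use ae in eventually_elim, simp add: wnorm_slice(2)[OF u] epowr_ennreal ennreal_mult mult.commute)
  also have "\<dots> = ennreal (LINT \<omega>|lborel. outer_weight \<omega> * slice_norm u \<omega> powr s)"
    by (rule nn_integral_eq_integral[OF I]) auto
  finally show ?thesis unfolding mod_norm_def mod_real_def
    by (simp add: epowr_ennreal Bochner_Integration.integral_nonneg)
qed

lemma stft_scale: "stft g (\<lambda>t. c * u t) x \<omega> = c * stft g u x \<omega>"
  unfolding stft_eq_pairing integral_mult_right_zero[symmetric] by (simp add: mult.assoc)

lemma mod_scale:
  assumes "mod_finite u"
  shows "mod_finite (\<lambda>x. c * u x)" "mod_real (\<lambda>x. c * u x) = norm c * mod_real u"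
proof -
  have n: "slice_norm (\<lambda>x. c * u x) \<omega> = norm c * slice_norm u \<omega>" for \<omega>
    unfolding stft_scale using r by (intro iw.nrm_scale) simp
  have e: "outer_weight \<omega> * slice_norm (\<lambda>x. c * u x) \<omega> powr s = norm c powr s * (outer_weight \<omega> * slice_norm u \<omega> powr s)" for \<omega>
    unfolding n by (simp only: powr_mult mult_ac)
  have z: "wfin lborel inner_weight r (\<lambda>x::'a. 0)" by (simp add: wfin_def)
  have "AE \<omega> in lborel. wfin lborel inner_weight r (\<lambda>x. stft g (\<lambda>x. c * u x) x \<omega>)"
    using conjunct1[OF assms[unfolded mod_finite_def]] unfolding stft_scale
    by eventually_elim (use iw.wfin_lin[where p=r and c=c, OF _ z] r in simp)
  moreover have "integrable lborel (\<lambda>\<omega>. outer_weight \<omega> * slice_norm (\<lambda>x. c * u x) \<omega> powr s)"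
    unfolding e using assms by (intro integrable_mult_right) (simp add: mod_finite_def)
  ultimately show "mod_finite (\<lambda>x. c * u x)" by (simp add: mod_finite_def)
  show "mod_real (\<lambda>x. c * u x) = norm c * mod_real u"
    unfolding mod_real_def e integral_mult_right_zero using s by (simp add: powr_mult powr_powr)
qed

lemma norms_scale:
  assumes "u \<in> X"
  shows "time_norm (\<lambda>x. c * u x) = norm c * time_norm u" "freq_norm (\<lambda>x. c * u x) = norm c * freq_norm u"
proof -
  show "time_norm (\<lambda>x. c * u x) = norm c * time_norm u" using p by (intro tw.nrm_scale) simp
  have m: "fhat (\<lambda>x. c * u x) \<in> borel_measurable borel" "fhat u \<in> borel_measurable borel"
    using fhat_Lw[OF X_scale(1)[OF assms]] fhat_Lw[OF assms] Lw_measurable by auto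
  have "wint lborel freq_weight q (fhat (\<lambda>x. c * u x)) = wint lborel freq_weight q (\<lambda>x. c * fhat u x)"
    unfolding wint_def by (rule integral_cong_AE)
      (use X_scale(2)[OF assms, of c] m in \<open>auto elim: eventually_mono\<close>)
  then show "freq_norm (\<lambda>x. c * u x) = norm c * freq_norm u" using q fw.nrm_scale[of q c "fhat u"] by simp
qed

lemma admissible_iff:
  "f \<in> admissible g r s \<alpha> \<beta> p a q b \<longleftrightarrow> f \<in> X \<and> mod_finite f \<and> mod_real f = 1"
proof
  assume f: "f \<in> admissible g r s \<alpha> \<beta> p a q b"
  then have X: "f \<in> X" and m: "mod_norm g r s \<alpha> \<beta> (regdist f) = 1" by (auto simp: admissible_def)
  have fm: "f \<in> borel_measurable borel" by (rule tame_measurable[OF X_tame[OF X]])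
  have fin: "mod_finite f" by (rule mod_norm_finiteD[OF fm]) (simp add: m)
  have "ennreal (mod_real f) = ennreal 1" using mod_norm_eq[OF fm fin] m by simp
  then have "mod_real f = 1" by (subst (asm) ennreal_inj) (auto simp: mod_real_def)
  then show "f \<in> X \<and> mod_finite f \<and> mod_real f = 1" using X fin by simp
next
  assume f: "f \<in> X \<and> mod_finite f \<and> mod_real f = 1"
  then have "f \<in> borel_measurable borel" using tame_measurable[OF X_tame] by blast
  then show "f \<in> admissible g r s \<alpha> \<beta> p a q b" using f by (simp add: admissible_def mod_norm_eq)
qed

text \<open>If the modulation norm of \<open>h\<close> is positive, then \<open>h\<close> divided by it meets the constraint, and both sides are
homogeneous in \<open>h\<close>.\<close>

lemma minimizer_inequality:
  assumes f: "minimizer g r s \<alpha> \<beta> p a q b f" and h: "h \<in> X" "mod_finite h"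
  shows "mod_real h * (time_norm f + freq_norm f) \<le> time_norm h + freq_norm h"
proof (cases "mod_real h = 0")
  case False
  then have m: "mod_real h > 0" by (simp add: mod_real_def)
  let ?c = "complex_of_real (1 / mod_real h)"
  let ?h = "\<lambda>x. ?c * h x"
  have nc: "norm ?c = 1 / mod_real h" using m by (simp only: norm_of_real) simp
  have "?h \<in> admissible g r s \<alpha> \<beta> p a q b"
    unfolding admissible_iff using m nc
    by (intro conjI X_scale(1)[OF h(1)] mod_scale(1)[OF h(2)]) (simp only: mod_scale(2)[OF h(2)], simp)
  then have "uncertainty_functional p a q b f \<le> uncertainty_functional p a q b ?h"
    using f by (simp add: minimizer_def)
  moreover have "f \<in> X" using f by (simp add: minimizer_def admissible_iff)
  ultimately have "ennreal (time_norm f + freq_norm f) \<le> ennreal (time_norm ?h + freq_norm ?h)"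
    by (simp only: functional_eq X_scale(1)[OF h(1)])
  then have "time_norm f + freq_norm f \<le> time_norm ?h + freq_norm ?h"
    by (subst (asm) ennreal_le_iff) auto
  also have "\<dots> = (time_norm h + freq_norm h) / mod_real h"
    unfolding norms_scale[OF h(1)] nc by (simp add: add_divide_distrib)
  finally show ?thesis using m by (simp add: pos_le_divide_eq mult.commute)
qed simp

lemma admissible_pairings_nonzero:
  assumes f: "f \<in> admissible g r s \<alpha> \<beta> p a q b"
    and Z: "\<And>\<phi>. \<phi> \<in> schwartz \<Longrightarrow> (LINT x|lborel. f x * \<phi> x) = 0"
  shows False
proof -
  have "stft g f x \<omega> = 0" for x \<omega> unfolding stft_eq_pairing by (rule Z[OF stft_atom_schwartz[OF g]])
  then have "mod_real f = 0" using r by (simp add: mod_real_def wint_def)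
  then show False using f by (simp add: admissible_iff)
qed

lemma wint_zero_imp_zero:
  fixes v :: "'a \<Rightarrow> complex"
  assumes "wfin lborel (\<lambda>x. norm x powr c) P v" "wint lborel (\<lambda>x. norm x powr c) P v = 0"
  shows "AE x in lborel. v x = 0"
proof -
  have "AE x in lborel. norm x powr c * norm (v x) powr P = 0"
    using assms by (subst integral_nonneg_eq_0_iff_AE[symmetric]) (auto simp: wfin_def wint_def)
  moreover have "AE x in lborel. x \<noteq> (0::'a)" by (rule AE_lborel_singleton)
  ultimately show ?thesis by eventually_elim auto
qed

text \<open>If one of the two norms vanished, then so would all pairings of \<open>f\<close> with Schwartz functions, among them
the values of its short-time Fourier transform; but \<open>f\<close> has modulation norm \<open>1\<close>.\<close>

lemma admissible_norms_positive:
  assumes f: "f \<in> admissible g r s \<alpha> \<beta> p a q b"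
  shows "wint lborel time_weight p f > 0" "wint lborel freq_weight q (fhat f) > 0"
proof -
  have X: "f \<in> X" using f by (simp add: admissible_iff)
  show "wint lborel time_weight p f > 0"
  proof (rule ccontr)
    assume "\<not> wint lborel time_weight p f > 0"
    then have "wint lborel time_weight p f = 0" using tw.wint_nonneg[of p f] by simp
    then have ae: "AE x in lborel. f x = 0" by (rule wint_zero_imp_zero[OF X_wfin(1)[OF X]])
    have "(LINT x|lborel. f x * \<phi> x) = 0" for \<phi>
      by (rule integral_eq_zero_AE) (use ae in eventually_elim, simp)
    then show False by (rule admissible_pairings_nonzero[OF f])
  qed
  show "wint lborel freq_weight q (fhat f) > 0"
  proof (rule ccontr)
    assume "\<not> wint lborel freq_weight q (fhat f) > 0"
    then have "wint lborel freq_weight q (fhat f) = 0" using fw.wint_nonneg[of q "fhat f"] by simp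
    then have "AE x in lborel. fhat f x = 0" by (rule wint_zero_imp_zero[OF X_wfin(2)[OF X]])
    then show False
      using fhat_zero_imp_pairings_zero[OF X_tame[OF X] represents_fhat[OF X]] admissible_pairings_nonzero[OF f] by blast
  qed
qed

text \<open>The inequality of the minimizer, applied to the regularisations of \<open>u\<close>, bounds their modulation norms
uniformly; the bound passes to \<open>u\<close> by lower semicontinuity.\<close>

lemma X_mod_finite:
  assumes f: "minimizer g r s \<alpha> \<beta> p a q b f" and u: "u \<in> X"
  shows "mod_finite u"
proof -
  have fa: "f \<in> admissible g r s \<alpha> \<beta> p a q b" using f by (simp add: minimizer_def)
  let ?l = "time_norm f + freq_norm f"
  have l: "?l > 0" using admissible_norms_positive[OF fa] by (simp add: add_pos_nonneg)
  obtain K where K: "K < \<infinity>" "\<And>c. 1 \<le> c \<Longrightarrow> uncertainty_functional p a q b (mollify c u) \<le> K"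
    by (rule uncertainty_functional_mollify_bounded[OF u]) (use p q a b in auto)
  have tu: "tame u" by (rule X_tame[OF u])
  have "mod_norm g r s \<alpha> \<beta> (regdist (mollify (real (Suc n)) u)) \<le> ennreal (enn2real K / ?l)" for n
  proof -
    let ?v = "mollify (real (Suc n)) u"
    have v: "?v \<in> schwartz" by (rule mollify_schwartz[OF tu]) simp
    have vX: "?v \<in> X" by (rule mollify_Lw_FLw[OF u]) (use p q a b in auto)
    have vm: "?v \<in> borel_measurable borel" by (rule schwartz_measurable[OF v])
    have fin: "mod_finite ?v"
      by (rule mod_norm_finiteD[OF vm mod_norm_schwartz_finite[OF g v]]) (use r s in auto)
    have "ennreal (time_norm ?v + freq_norm ?v) \<le> K"
      by (rule ord_eq_le_trans[OF functional_eq[OF vX, symmetric] K(2)]) simp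
    then have "ennreal (time_norm ?v + freq_norm ?v) \<le> ennreal (enn2real K)" using K(1) by simp
    then have "time_norm ?v + freq_norm ?v \<le> enn2real K" by (subst (asm) ennreal_le_iff) auto
    then have "mod_real ?v * ?l \<le> enn2real K" using minimizer_inequality[OF f vX fin] by (rule order_trans[rotated])
    then have "mod_real ?v \<le> enn2real K / ?l" using l by (simp only: pos_le_divide_eq)
    then show ?thesis unfolding mod_norm_eq[OF vm fin] by (rule ennreal_leI)
  qed
  then have "mod_norm g r s \<alpha> \<beta> (regdist u) \<le> ennreal (enn2real K / ?l)"
    using r s by (intro mod_norm_le_of_mollify[OF g tu]) auto
  then have "mod_norm g r s \<alpha> \<beta> (regdist u) < \<infinity>" by (rule order.strict_trans1) simp
  then show ?thesis by (rule mod_norm_finiteD[OF tame_measurable[OF tu]])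
qed

lemma EL_inner_eq:
  "EL_inner g r \<alpha> f u \<omega> x = of_real (inner_weight x * norm (stft g f x \<omega>) powr (r - 2)) * stft g f x \<omega> * cnj (stft g u x \<omega>)"
  by (simp add: EL_inner_def mult_ac)

lemma EL_mod_eq:
  assumes "f \<in> borel_measurable borel"
  shows "EL_mod g r s \<alpha> \<beta> f u \<omega> = of_real (slice_norm f \<omega> powr (s - r)) * (LINT x|lborel. EL_inner g r \<alpha> f u \<omega> x) * of_real (outer_weight \<omega>)"
  unfolding EL_mod_def wnorm_slice(3)[OF assms] ..

lemma EL_mod_variation:
  assumes f: "f \<in> X" "mod_finite f" and u: "u \<in> X" "mod_finite u"
  shows "integrable lborel (EL_mod g r s \<alpha> \<beta> f u)"
    and "((\<lambda>t. LINT \<omega>|lborel. outer_weight \<omega> * slice_norm (\<lambda>x. f x + of_real t * u x) \<omega> powr s) has_real_derivative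
      s * Re (LINT \<omega>|lborel. EL_mod g r s \<alpha> \<beta> f u \<omega>)) (at 0)"
proof -
  have fm: "f \<in> borel_measurable borel" and um: "u \<in> borel_measurable borel"
    using tame_measurable[OF X_tame] f u by auto
  have lin: "stft g (\<lambda>x. f x + of_real t * u x) x \<omega> = stft g f x \<omega> + of_real t * stft g u x \<omega>" for t x \<omega>
    by (rule stft_lin[OF g X_tame[OF f(1)] X_tame[OF u(1)]])
  have mt: "(\<lambda>\<omega>. iw.nrm r (\<lambda>x. stft g f x \<omega> + of_real t * stft g u x \<omega>)) \<in> borel_measurable lborel" for t :: real
    unfolding lin[symmetric] using slice_norm_measurable[of "\<lambda>x. f x + of_real t * u x"] fm um by simp
  have mg: "slice_norm u \<in> borel_measurable lborel" using slice_norm_measurable[OF um] by simp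
  have mP: "(\<lambda>\<omega>. LINT x|lborel. of_real (inner_weight x * norm (stft g f x \<omega>) powr (r - 2)) * stft g f x \<omega> * cnj (stft g u x \<omega>))
      \<in> borel_measurable lborel"
  proof -
    note [measurable] = stft_measurable_swap[OF fm] stft_measurable_swap[OF um]
    have [measurable]: "(\<lambda>z. cnj (stft g u (snd z) (fst z))) \<in> borel_measurable (borel \<Otimes>\<^sub>M borel)"
      by (intro borel_measurable_continuous_on[where f=cnj] continuous_intros) measurable
    have "(\<lambda>\<omega>. LINT x|lborel. of_real (inner_weight x * norm (stft g f x \<omega>) powr (r - 2)) * stft g f x \<omega> * cnj (stft g u x \<omega>))
      \<in> borel_measurable borel" by measurable
    then show ?thesis by simp
  qed
  have W: "outer_weight \<in> borel_measurable lborel" by measurable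
  note A = r s W _ conjunct1[OF f(2)[unfolded mod_finite_def]] conjunct1[OF u(2)[unfolded mod_finite_def]] mt mg mP
    conjunct2[OF f(2)[unfolded mod_finite_def]] conjunct2[OF u(2)[unfolded mod_finite_def]]
  have e: "EL_mod g r s \<alpha> \<beta> f u = (\<lambda>\<omega>. of_real (slice_norm f \<omega> powr (s - r))
      * (LINT x|lborel. of_real (inner_weight x * norm (stft g f x \<omega>) powr (r - 2)) * stft g f x \<omega> * cnj (stft g u x \<omega>))
      * of_real (outer_weight \<omega>))"
    unfolding EL_mod_eq[OF fm, abs_def] EL_inner_eq ..
  show "integrable lborel (EL_mod g r s \<alpha> \<beta> f u)"
    unfolding e by (rule iw.mixed_pairing_integrable[OF A]) simp
  show "((\<lambda>t. LINT \<omega>|lborel. outer_weight \<omega> * slice_norm (\<lambda>x. f x + of_real t * u x) \<omega> powr s) has_real_derivative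
      s * Re (LINT \<omega>|lborel. EL_mod g r s \<alpha> \<beta> f u \<omega>)) (at 0)"
    unfolding e lin by (rule iw.mixed_line_derivative[OF A]) simp
qed

definition EL_defect :: "('a \<Rightarrow> complex) \<Rightarrow> real \<Rightarrow> ('a \<Rightarrow> complex) \<Rightarrow> complex"
  where "EL_defect f l u = of_real (time_norm f powr (1 - p)) * (LINT x|lborel. EL_time p a f u x)
    + of_real (freq_norm f powr (1 - q)) * (LINT \<omega>|lborel. EL_freq q b f u \<omega>)
    - of_real l * (LINT \<omega>|lborel. EL_mod g r s \<alpha> \<beta> f u \<omega>)"

text \<open>The first variation of \<open>time_norm + freq_norm - l * mod_real\<close> at its minimum \<open>f\<close>.\<close>

lemma Re_EL_defect:
  assumes f: "minimizer g r s \<alpha> \<beta> p a q b f" and u: "u \<in> X"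
  shows "Re (EL_defect f (time_norm f + freq_norm f) u) = 0"
proof -
  have fa: "f \<in> admissible g r s \<alpha> \<beta> p a q b" using f by (simp add: minimizer_def)
  then have fX: "f \<in> X" and fM: "mod_finite f" and f1: "mod_real f = 1" by (auto simp: admissible_iff)
  let ?l = "time_norm f + freq_norm f"
  let ?v = "\<lambda>t::real. \<lambda>x. f x + of_real t * u x"
  have vX: "?v t \<in> X" for t by (rule X_lin[OF fX u])
  let ?A = "\<lambda>t. time_norm (?v t)"
  let ?B = "\<lambda>t::real. fw.nrm q (\<lambda>x. fhat f x + of_real t * fhat u x)"
  let ?M = "\<lambda>t. mod_real (?v t)"
  have B: "freq_norm (?v t) = ?B t" for t
  proof -
    have m: "fhat (?v t) \<in> borel_measurable borel" "fhat f \<in> borel_measurable borel" "fhat u \<in> borel_measurable borel"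
      using fhat_Lw[OF vX] fhat_Lw[OF fX] fhat_Lw[OF u] Lw_measurable by auto
    have "wint lborel freq_weight q (fhat (?v t)) = wint lborel freq_weight q (\<lambda>x. fhat f x + of_real t * fhat u x)"
      unfolding wint_def by (rule integral_cong_AE)
        (use X_fhat_lin[OF fX u, of "of_real t"] m in \<open>auto elim: eventually_mono\<close>)
    then show ?thesis by simp
  qed
  have dA: "(?A has_real_derivative time_norm f powr (1 - p) * Re (LINT x|lborel. EL_time p a f u x)) (at 0)"
    using tw.wint_power_line_derivative[OF p X_wfin(1)[OF fX] X_wfin(1)[OF u], of 1] admissible_norms_positive[OF fa]
    by (simp add: EL_time_def)
  have dB: "(?B has_real_derivative freq_norm f powr (1 - q) * Re (LINT x|lborel. EL_freq q b f u x)) (at 0)"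
    using fw.wint_power_line_derivative[OF q X_wfin(2)[OF fX] X_wfin(2)[OF u], of 1] admissible_norms_positive[OF fa]
    by (simp add: EL_freq_def)
  have dM: "(?M has_real_derivative Re (LINT \<omega>|lborel. EL_mod g r s \<alpha> \<beta> f u \<omega>)) (at 0)"
  proof -
    let ?S = "\<lambda>t. LINT \<omega>|lborel. outer_weight \<omega> * slice_norm (?v t) \<omega> powr s"
    have S0: "?S 0 = 1"
    proof -
      have "?S 0 = mod_real f powr s"
        using s by (simp add: mod_real_def powr_powr Bochner_Integration.integral_nonneg)
      then show ?thesis using f1 by simp
    qed
    have pos: "?S 0 > 0" using S0 by simp
    show ?thesis unfolding mod_real_def
    proof (rule DERIV_cong[OF DERIV_fun_powr[OF EL_mod_variation(2)[OF fX fM u X_mod_finite[OF f u]] pos]])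
      show "1 / s * ?S 0 powr (1 / s - of_nat 1) * (s * Re (LINT \<omega>|lborel. EL_mod g r s \<alpha> \<beta> f u \<omega>))
          = Re (LINT \<omega>|lborel. EL_mod g r s \<alpha> \<beta> f u \<omega>)"
        unfolding S0 using s by simp
    qed
  qed
  have dF: "((\<lambda>t. ?A t + ?B t - ?l * ?M t) has_real_derivative Re (EL_defect f ?l u)) (at 0)"
    using DERIV_diff[OF DERIV_add[OF dA dB] DERIV_cmult[OF dM, of ?l]] by (simp add: EL_defect_def)
  have "?A 0 + ?B 0 - ?l * ?M 0 \<le> ?A t + ?B t - ?l * ?M t" for t
    using minimizer_inequality[OF f vX X_mod_finite[OF f vX], of t] f1 by (simp add: B mult.commute)
  then show ?thesis by (intro DERIV_local_min[OF dF, of 1]) auto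
qed

text \<open>The equation is conjugate-linear in the test function.\<close>

lemma EL_defect_rotate:
  assumes f: "f \<in> X" and u: "u \<in> X"
  shows "EL_defect f l (\<lambda>x. \<i> * u x) = - \<i> * EL_defect f l u"
proof -
  have 1: "(LINT x|lborel. EL_time p a f (\<lambda>x. \<i> * u x) x) = - \<i> * (LINT x|lborel. EL_time p a f u x)"
    unfolding integral_mult_right_zero[symmetric] by (simp add: EL_time_def mult_ac)
  have m: "fhat (\<lambda>x. \<i> * u x) \<in> borel_measurable borel" "fhat u \<in> borel_measurable borel" "fhat f \<in> borel_measurable borel"
    using fhat_Lw[OF X_scale(1)[OF u]] fhat_Lw[OF u] fhat_Lw[OF f] Lw_measurable by auto
  have mc: "(\<lambda>x. cnj (v x)) \<in> borel_measurable borel" if "v \<in> borel_measurable borel" for v :: "'a \<Rightarrow> complex"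
    using that by (intro borel_measurable_continuous_on[where f=cnj] continuous_intros)
  have EL: "EL_freq q b f v \<in> borel_measurable lborel" if "v \<in> X" for v
  proof -
    have [measurable]: "(\<lambda>x. cnj (fhat v x)) \<in> borel_measurable borel" "fhat f \<in> borel_measurable borel"
      using mc[OF Lw_measurable[OF fhat_Lw[OF that]]] m by auto
    show ?thesis unfolding EL_freq_def[abs_def] by measurable
  qed
  have "(LINT x|lborel. EL_freq q b f (\<lambda>x. \<i> * u x) x) = (LINT x|lborel. - \<i> * EL_freq q b f u x)"
  proof (rule integral_cong_AE)
    show "AE x in lborel. EL_freq q b f (\<lambda>x. \<i> * u x) x = - \<i> * EL_freq q b f u x"
      using X_scale(2)[OF u, of \<i>] by eventually_elim (simp add: EL_freq_def mult_ac)
  qed (use EL[OF u] EL[OF X_scale(1)[OF u]] in auto)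
  then have 2: "(LINT x|lborel. EL_freq q b f (\<lambda>x. \<i> * u x) x) = - \<i> * (LINT x|lborel. EL_freq q b f u x)"
    unfolding integral_mult_right_zero .
  have inner: "EL_inner g r \<alpha> f (\<lambda>x. \<i> * u x) \<omega> x = - \<i> * EL_inner g r \<alpha> f u \<omega> x" for \<omega> x
    by (simp add: EL_inner_def stft_scale mult_ac)
  have "EL_mod g r s \<alpha> \<beta> f (\<lambda>x. \<i> * u x) \<omega> = - \<i> * EL_mod g r s \<alpha> \<beta> f u \<omega>" for \<omega>
    unfolding EL_mod_def inner integral_mult_right_zero by simp
  then have 3: "(LINT \<omega>|lborel. EL_mod g r s \<alpha> \<beta> f (\<lambda>x. \<i> * u x) \<omega>) = - \<i> * (LINT \<omega>|lborel. EL_mod g r s \<alpha> \<beta> f u \<omega>)"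
    unfolding integral_mult_right_zero[symmetric] by simp
  show ?thesis unfolding EL_defect_def 1 2 3 by (simp add: algebra_simps)
qed

lemma enn2real_norms:
  assumes "f \<in> X"
  shows "enn2real (Lnorm p (\<lambda>x. norm x powr a *\<^sub>R f x)) = time_norm f"
    and "enn2real (Lnorm q (\<lambda>\<omega>. norm \<omega> powr b *\<^sub>R fhat f \<omega>)) = freq_norm f"
  using Lnorm_weighted[OF Lw_FLw_Lw[OF assms]] Lnorm_weighted[OF fhat_Lw[OF assms]] p q a b by auto

lemma minimizer_EL_solution:
  assumes f: "minimizer g r s \<alpha> \<beta> p a q b f"
  shows "EL_solution g r s \<alpha> \<beta> p a q b (time_norm f + freq_norm f) f"
  unfolding EL_solution_def
proof (intro ballI conjI)
  fix u assume u: "u \<in> X"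
  let ?l = "time_norm f + freq_norm f"
  have fX: "f \<in> X" and fM: "mod_finite f" using f by (auto simp: minimizer_def admissible_iff)
  have uM: "mod_finite u" by (rule X_mod_finite[OF f u])
  show "integrable lborel (EL_time p a f u)"
    using tw.pairing_integrable[OF p X_wfin(1)[OF fX] X_wfin(1)[OF u]] by (simp add: EL_time_def[abs_def])
  show "integrable lborel (EL_freq q b f u)"
    using fw.pairing_integrable[OF q X_wfin(2)[OF fX] X_wfin(2)[OF u]] by (simp add: EL_freq_def[abs_def])
  show "integrable lborel (EL_mod g r s \<alpha> \<beta> f u)" by (rule EL_mod_variation(1)[OF fX fM u uM])
  show "AE \<omega> in lborel. integrable lborel (EL_inner g r \<alpha> f u \<omega>)"
    using conjunct1[OF fM[unfolded mod_finite_def]] conjunct1[OF uM[unfolded mod_finite_def]]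
    by eventually_elim (use iw.pairing_integrable[OF r] in \<open>simp add: EL_inner_eq[abs_def]\<close>)
  have "Re (EL_defect f ?l (\<lambda>x. \<i> * u x)) = 0" by (rule Re_EL_defect[OF f X_scale(1)[OF u]])
  then have "Im (EL_defect f ?l u) = 0" unfolding EL_defect_rotate[OF fX u] by simp
  then have "EL_defect f ?l u = 0" using Re_EL_defect[OF f u] by (simp add: complex_eq_iff)
  then show "of_real (enn2real (Lnorm p (\<lambda>x. norm x powr a *\<^sub>R f x)) powr (1 - p)) * (LINT x|lborel. EL_time p a f u x)
      + of_real (enn2real (Lnorm q (\<lambda>\<omega>. norm \<omega> powr b *\<^sub>R fhat f \<omega>)) powr (1 - q)) * (LINT \<omega>|lborel. EL_freq q b f u \<omega>)
      = of_real ?l * (LINT \<omega>|lborel. EL_mod g r s \<alpha> \<beta> f u \<omega>)"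
    unfolding enn2real_norms[OF fX] EL_defect_def by simp
qed

text \<open>The equation tested with the solution itself: all integrands become powers of absolute values.\<close>

lemma EL_solution_multiplier:
  assumes f: "f \<in> admissible g r s \<alpha> \<beta> p a q b" and EL: "EL_solution g r s \<alpha> \<beta> p a q b m f"
  shows "m = time_norm f + freq_norm f"
proof -
  have fX: "f \<in> X" and fM: "mod_finite f" and f1: "mod_real f = 1" using f by (auto simp: admissible_iff)
  have fm: "f \<in> borel_measurable borel" by (rule tame_measurable[OF X_tame[OF fX]])
  have n: "(W powr (1 / P)) powr (1 - P) * W = W powr (1 / P)" if "0 \<le> W" "1 < P" for W P :: real
  proof (cases "W = 0")
    case False
    then have "(W powr (1 / P)) powr (1 - P) * W = W powr ((1 - P) / P) * W powr 1" using that by (simp add: powr_powr)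
    also have "\<dots> = W powr ((1 - P) / P + 1)" by (rule powr_add[symmetric])
    also have "(1 - P) / P + 1 = 1 / P" using that by (simp add: field_simps)
    finally show ?thesis .
  qed simp
  have T: "(LINT x|lborel. EL_time p a f f x) = of_real (wint lborel time_weight p f)"
    unfolding EL_time_def pairing_self wint_def by (rule integral_complex_of_real)
  have F: "(LINT x|lborel. EL_freq q b f f x) = of_real (wint lborel freq_weight q (fhat f))"
    unfolding EL_freq_def pairing_self wint_def by (rule integral_complex_of_real)
  have I: "(LINT x|lborel. EL_inner g r \<alpha> f f \<omega> x) = of_real (wint lborel inner_weight r (\<lambda>x. stft g f x \<omega>))" for \<omega>
    unfolding EL_inner_eq pairing_self wint_def by (rule integral_complex_of_real)
  have E: "EL_mod g r s \<alpha> \<beta> f f \<omega> = of_real (outer_weight \<omega> * slice_norm f \<omega> powr s)" for \<omega>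
  proof -
    have "wint lborel inner_weight r (\<lambda>x. stft g f x \<omega>) = slice_norm f \<omega> powr r"
      using r by (simp add: powr_powr iw.wint_nonneg)
    then have "slice_norm f \<omega> powr (s - r) * wint lborel inner_weight r (\<lambda>x. stft g f x \<omega>) = slice_norm f \<omega> powr s"
      using powr_add[of "slice_norm f \<omega>" "s - r" r] by simp
    then show ?thesis unfolding EL_mod_eq[OF fm] I of_real_mult[symmetric] by (simp only: mult.commute)
  qed
  have S: "(LINT \<omega>|lborel. outer_weight \<omega> * slice_norm f \<omega> powr s) = 1"
  proof -
    have "(LINT \<omega>|lborel. outer_weight \<omega> * slice_norm f \<omega> powr s) = mod_real f powr s"
      using s by (simp add: mod_real_def powr_powr Bochner_Integration.integral_nonneg)
    then show ?thesis using f1 by simp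
  qed
  have M: "(LINT \<omega>|lborel. EL_mod g r s \<alpha> \<beta> f f \<omega>) = 1"
    unfolding E integral_complex_of_real S by simp
  have "of_real (time_norm f powr (1 - p)) * (LINT x|lborel. EL_time p a f f x)
      + of_real (freq_norm f powr (1 - q)) * (LINT x|lborel. EL_freq q b f f x) = of_real m * (LINT \<omega>|lborel. EL_mod g r s \<alpha> \<beta> f f \<omega>)"
    using EL fX unfolding EL_solution_def enn2real_norms[OF fX] by blast
  then have "complex_of_real (time_norm f powr (1 - p) * wint lborel time_weight p f
      + freq_norm f powr (1 - q) * wint lborel freq_weight q (fhat f)) = of_real m"
    unfolding T F M by simp
  then have "time_norm f powr (1 - p) * wint lborel time_weight p f
      + freq_norm f powr (1 - q) * wint lborel freq_weight q (fhat f) = m"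
    by (simp only: of_real_eq_iff)
  then show ?thesis using n[OF tw.wint_nonneg p] n[OF fw.wint_nonneg q] by simp
qed

end

theorem theorem13:
  fixes g f0 :: "'a::euclidean_space \<Rightarrow> complex"
    and r s \<alpha> \<beta> a b p q d :: real
  defines "d \<equiv> real DIM('a)"
  assumes "g \<in> schwartz" and "g \<noteq> (\<lambda>_. 0)"
    and "1 < r" "r \<le> 2" and "1 < s" "s \<le> 2"
    and "0 \<le> \<alpha>" and "0 \<le> \<beta>"
    and "0 < a" "a \<le> dual_exponent r" and "0 < b" "b \<le> dual_exponent r"
    and "r \<le> p" "p \<le> dual_exponent r"
    and "s \<le> q" "q \<le> dual_exponent r"
    and "((a - \<alpha>) / d + 1 / p - 1 / r) * ((b - \<beta>) / d + 1 / q - 1 / s)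
       > max (1 / r - 1 / dual_exponent q + \<alpha> / d) (1 / r - 1 / 2 + \<alpha> / d)
         * max (1 / s - 1 / dual_exponent p + \<beta> / d) (1 / s - 1 / 2 + \<beta> / d)"
    and "(a - \<alpha>) / d + 1 / p - 1 / r \<ge> 0"
    and "(b - \<beta>) / d + 1 / q - 1 / s \<ge> 0"
    and "max (1 / r - 1 / dual_exponent q + \<alpha> / d) (1 / r - 1 / 2 + \<alpha> / d) \<ge> 0"
    and "max (1 / s - 1 / dual_exponent p + \<beta> / d) (1 / s - 1 / 2 + \<beta> / d) \<ge> 0"
    and "minimizer g r s \<alpha> \<beta> p a q b f0"
  shows "\<exists>l::real. EL_solution g r s \<alpha> \<beta> p a q b l f0 \<and>
    (\<forall>m::real. (\<exists>f\<in>admissible g r s \<alpha> \<beta> p a q b. EL_solution g r s \<alpha> \<beta> p a q b m f) \<longrightarrow> l \<le> m)"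
proof -
  interpret variational_problem g r s \<alpha> \<beta> p a q b
    by unfold_locales (use assms in auto)
  let ?l = "time_norm f0 + freq_norm f0"
  have min: "minimizer g r s \<alpha> \<beta> p a q b f0" by fact
  have "?l \<le> m" if f: "f \<in> admissible g r s \<alpha> \<beta> p a q b" and EL: "EL_solution g r s \<alpha> \<beta> p a q b m f" for m f
  proof -
    have fX: "f \<in> X" and fM: "mod_finite f" and f1: "mod_real f = 1" using f by (auto simp: admissible_iff)
    show ?thesis
      using minimizer_inequality[OF min fX fM] unfolding EL_solution_multiplier[OF f EL] f1 by simp
  qed
  then show ?thesis using minimizer_EL_solution[OF min] by blast
qed

end
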